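(* Let $k \ge 5$ and $n \ge k^2 - k$ be integers and let $r = (n-2) \bmod (k^2 - k - 2)$. Then $$ar_{\mathcal{P}}(n, C_k) \ge \left( \frac{k-3}{k-2} + \frac{2}{3(k+1)(k-2)} \right)(3n - 6) - \frac{2k^2 - 5k - 5}{k^2 - k - 2}\, r.$$
   Context: All graphs are finite and simple. $C_k$ is the cycle on $k$ vertices. For positive integers $a,b$, $a \bmod b$ is the remainder when $a$ is divided by $b$. A plane triangulation is a plane graph in which every face (including the outer face) is bounded by a triangle. For a planar graph $H$ and $n \ge |H|$ (where $|H|$ is the number of vertices of $H$), $\mathcal{T}_n(H)$ is the family of all plane triangulations on $n$ vertices that contain a (not necessarily induced) subgraph isomorphic to $H$. Edge-colorings are arbitrary (not necessarily proper). A subgraph of an edge-colored graph is rainbow if all its edges have different colors. The planar anti-Ramsey number $ar_{\mathcal{P}}(n,H)$ is the maximum number of colors used in an edge-coloring of a plane triangulation $T \in \mathcal{T}_n(H)$ such that $T$ contains no rainbow copy of $H$ (the maximum is over all $T\in\mathcal{T}_n(H)$ and all such colorings of $T$). *)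

theory Defs
  imports "HOL-Analysis.Analysis"
begin

section \<open>Simple graphs\<close>

text \<open>A graph is a pair of a vertex set and a set of edges, an edge being a two-element set of
  vertices.\<close>

type_synonym 'a graph = "'a set \<times> 'a set set"

abbreviation verts :: "'a graph \<Rightarrow> 'a set" where "verts G \<equiv> fst G"
abbreviation edges :: "'a graph \<Rightarrow> 'a set set" where "edges G \<equiv> snd G"

definition simple_graph :: "'a graph \<Rightarrow> bool" where
  "simple_graph G \<longleftrightarrow> finite (verts G) \<and> (\<forall>e\<in>edges G. e \<subseteq> verts G \<and> card e = 2)"

definition subgraph :: "'a graph \<Rightarrow> 'a graph \<Rightarrow> bool" where
  "subgraph S G \<longleftrightarrow> simple_graph S \<and> verts S \<subseteq> verts G \<and> edges S \<subseteq> edges G"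

definition isomorphic :: "'a graph \<Rightarrow> 'b graph \<Rightarrow> bool" where
  "isomorphic G H \<longleftrightarrow> (\<exists>f. bij_betw f (verts G) (verts H) \<and> (\<lambda>e. f ` e) ` edges G = edges H)"

definition copy_of :: "'b graph \<Rightarrow> 'a graph \<Rightarrow> 'a graph \<Rightarrow> bool" where
  "copy_of H S G \<longleftrightarrow> subgraph S G \<and> isomorphic S H"

text \<open>The cycle on \<open>k\<close> vertices; meaningful for \<open>k \<ge> 3\<close>.\<close>

definition cycle_graph :: "nat \<Rightarrow> nat graph" where
  "cycle_graph k = ({0..<k}, {{i, (i + 1) mod k} | i. i < k})"

section \<open>Plane graphs and plane triangulations\<close>

text \<open>The plane is the type of complex numbers. A plane graph is a pair \<open>(V, A)\<close> of a finite set
  of points and a finite set of arcs, each arc being given by its point set. The condition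
  \<open>e \<inter> V = {pathstart g, pathfinish g}\<close> says both that the ends of \<open>e\<close> are vertices and that no
  vertex lies in the interior of \<open>e\<close>; hence two edges meeting only in \<open>V\<close> meet at most in common
  ends. There are no loops, since \<^const>\<open>arc\<close> requires injectivity on the closed interval.\<close>

definition plane_graph :: "complex set \<Rightarrow> complex set set \<Rightarrow> bool" where
  "plane_graph V A \<longleftrightarrow>
     finite V \<and> finite A \<and>
     (\<forall>e\<in>A. \<exists>g. arc g \<and> path_image g = e \<and> e \<inter> V = {pathstart g, pathfinish g}) \<and>
     (\<forall>e\<in>A. \<forall>e'\<in>A. e \<noteq> e' \<longrightarrow> e \<inter> V \<noteq> e' \<inter> V \<and> e \<inter> e' \<subseteq> V)"

definition faces :: "complex set \<Rightarrow> complex set set \<Rightarrow> complex set set" where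
  "faces V A = components (- (V \<union> \<Union>A))"

definition bounded_by_triangle :: "complex set \<Rightarrow> complex set set \<Rightarrow> complex set \<Rightarrow> bool" where
  "bounded_by_triangle V A F \<longleftrightarrow>
     (\<exists>u v w a b c. u \<noteq> v \<and> v \<noteq> w \<and> u \<noteq> w \<and> {a, b, c} \<subseteq> A \<and>
        a \<inter> V = {u, v} \<and> b \<inter> V = {v, w} \<and> c \<inter> V = {u, w} \<and>
        frontier F = a \<union> b \<union> c)"

text \<open>The faces include the unbounded one.\<close>

definition plane_triangulation :: "complex set \<Rightarrow> complex set set \<Rightarrow> bool" where
  "plane_triangulation V A \<longleftrightarrow>
     plane_graph V A \<and> (\<forall>F\<in>faces V A. bounded_by_triangle V A F)"

text \<open>The abstract graph drawn by a plane graph: an arc becomes the set of its two ends.\<close>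

definition graph_of :: "complex set \<Rightarrow> complex set set \<Rightarrow> complex graph" where
  "graph_of V A = (V, (\<lambda>e. e \<inter> V) ` A)"

definition triangulations :: "nat \<Rightarrow> 'b graph \<Rightarrow> complex graph set" where
  "triangulations n H =
     {graph_of V A | V A. plane_triangulation V A \<and> card V = n \<and>
        (\<exists>S. copy_of H S (graph_of V A))}"

section \<open>Planar anti-Ramsey numbers\<close>

definition rainbow :: "('a set \<Rightarrow> nat) \<Rightarrow> 'a graph \<Rightarrow> bool" where
  "rainbow c S \<longleftrightarrow> inj_on c (edges S)"

text \<open>The set below is finite, as its elements are at most \<open>n choose 2\<close>. Colours are natural
  numbers, which loses nothing for finite graphs; only the colours that occur are counted.\<close>

definition ar_planar :: "nat \<Rightarrow> 'b graph \<Rightarrow> nat" where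
  "ar_planar n H =
     Max {card (c ` edges T) | T c. T \<in> triangulations n H \<and>
            \<not> (\<exists>S. copy_of H S T \<and> rainbow c S)}"

end

theory Submission
  imports Defs
begin

text \<open>With \<open>N = k^2 - k - 2 = (k - 2) * (k + 1)\<close> and \<open>n - 2 = q * N + r\<close> the bound equals
  \<open>q * (3 * k^2 - 6 * k - 7) + r\<close>. Start from a plane base graph with \<open>q * (k + 1)\<close> edges whose
  \<open>2 * q\<close> faces and whose shortest cycles all have length \<open>k + 1\<close>. Put a centre into each face, join
  it to the boundary of the face, and enlarge every edge to a block, a triangulation on \<open>k - 1\<close>
  vertices with \<open>3 * k - 9\<close> edges. All block edges get different colours, and each centre gives one
  colour to all its edges. A rainbow cycle avoids the centres, so it lies in one block and is shorter
  than \<open>k\<close>, or it induces a cycle of the base graph and is longer than \<open>k\<close>. The remaining \<open>r\<close> vertices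
  are put into faces, and each brings one new colour.

  The drawing is straight-line: placing a vertex into a triangle or onto an edge is a stellar
  subdivision of a simplicial complex, whose open simplices partition the outer triangle.\<close>

section \<open>Open simplices and stellar subdivision\<close>

text \<open>Two lengths are too short and too long by one: a block has \<open>k - 1\<close>
  vertices, a cycle of the base graph at least \<open>k + 1\<close> edges. With
  \<open>q * (k + 1)\<close> edges and \<open>2 * q\<close> faces, Euler's formula gives the base
  graph \<open>2 + q * (k - 1)\<close> vertices; adding \<open>k - 3\<close> vertices for each edge
  and one for each face gives \<open>n - 2 = q * N\<close>. The coefficient of \<open>r\<close> in
  the statement is the number of colours per vertex, \<open>(3 * k^2 - 6 * k - 7) / N\<close>, minus
  1, since a leftover vertex brings one colour only. Faces are defined as components, so curved arcs
  would call for the Jordan curve theorem. In a straight-line drawing the open triangles and the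
  outside of the outer triangle are visibly open, connected and disjoint, hence they are the
  components. The price is that every intermediate graph must be a triangulation, while the base
  graph has long faces. So its centres come before its paths: a coarse version with two edges for
  each path has triangular faces only, these receive the centres, and a coarse edge is subdivided
  once it has a centre on either side.\<close>

definition open_simplex :: "('a \<Rightarrow> 'b::real_vector) \<Rightarrow> 'a set \<Rightarrow> 'b set" where
  "open_simplex \<phi> s = {\<Sum>i\<in>s. w i *\<^sub>R \<phi> i | w. (\<forall>i\<in>s. 0 < w i) \<and> sum w s = 1}"

text \<open>Affine independence, but of the indexed family and not of its set of values: a repeated
  point counts as a dependence, and \<open>\<phi>\<close> can be changed at one index.\<close>

definition indep :: "('a \<Rightarrow> 'b::real_vector) \<Rightarrow> 'a set \<Rightarrow> bool" where
  "indep \<phi> s \<longleftrightarrow> (\<forall>w. sum w s = 0 \<longrightarrow> (\<Sum>i\<in>s. w i *\<^sub>R \<phi> i) = 0 \<longrightarrow> (\<forall>i\<in>s. w i = 0))"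

definition barycenter :: "('a \<Rightarrow> 'b::real_vector) \<Rightarrow> 'a set \<Rightarrow> 'b" where
  "barycenter \<phi> \<sigma> = (1 / real (card \<sigma>)) *\<^sub>R (\<Sum>i\<in>\<sigma>. \<phi> i)"

lemma open_simplexI:
  assumes "\<And>i. i \<in> s \<Longrightarrow> 0 < w i" "sum w s = 1" "x = (\<Sum>i\<in>s. w i *\<^sub>R \<phi> i)"
  shows "x \<in> open_simplex \<phi> s"
  using assms unfolding open_simplex_def by blast

lemma open_simplexE:
  assumes "x \<in> open_simplex \<phi> s"
  obtains w where "\<And>i. i \<in> s \<Longrightarrow> 0 < w i" "sum w s = 1" "x = (\<Sum>i\<in>s. w i *\<^sub>R \<phi> i)"
  using assms unfolding open_simplex_def by blast

lemma open_simplex_cong: "(\<And>i. i \<in> s \<Longrightarrow> \<phi> i = \<psi> i) \<Longrightarrow> open_simplex \<phi> s = open_simplex \<psi> s"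
  unfolding open_simplex_def by (intro Collect_cong ex_cong1) (auto intro!: sum.cong)

lemma open_simplex_singleton [simp]: "open_simplex \<phi> {v} = {\<phi> v}"
  unfolding open_simplex_def by (auto intro: exI[of _ "\<lambda>_. 1"])

lemma indep_cong: "(\<And>i. i \<in> s \<Longrightarrow> \<phi> i = \<psi> i) \<Longrightarrow> indep \<phi> s = indep \<psi> s"
  unfolding indep_def by (simp cong: sum.cong)

lemma indep_unique:
  assumes "indep \<phi> s" "sum v s = sum w s" "(\<Sum>i\<in>s. v i *\<^sub>R \<phi> i) = (\<Sum>i\<in>s. w i *\<^sub>R \<phi> i)" "i \<in> s"
  shows "v i = w i"
proof -
  have "sum (\<lambda>i. v i - w i) s = 0" "(\<Sum>i\<in>s. (v i - w i) *\<^sub>R \<phi> i) = 0"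
    using assms by (simp_all add: sum_subtractf scaleR_left_diff_distrib)
  then show ?thesis using assms(1,4) unfolding indep_def by fastforce
qed

lemma indep_subset:
  assumes "indep \<phi> s" "t \<subseteq> s" "finite s"
  shows "indep \<phi> t"
  unfolding indep_def
proof (intro allI impI ballI)
  fix w i assume w: "sum w t = 0" "(\<Sum>i\<in>t. w i *\<^sub>R \<phi> i) = 0" "i \<in> t"
  let ?w = "\<lambda>i. if i \<in> t then w i else 0"
  have "sum ?w s = 0"
    using w assms by (simp add: sum.If_cases Int_absorb1)
  moreover have "(\<Sum>i\<in>s. ?w i *\<^sub>R \<phi> i) = 0"
    using w(2) assms(2,3) by (simp add: if_distrib[of "\<lambda>c. c *\<^sub>R _"] sum.If_cases Int_absorb1 cong: if_cong)
  ultimately have "\<forall>i\<in>s. ?w i = 0"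
    using assms(1)[unfolded indep_def, rule_format, of ?w] by blast
  then have "?w i = 0" using w(3) assms(2) by blast
  then show "w i = 0" using w(3) by simp
qed

lemma indep_imp_inj:
  assumes "indep \<phi> s" "finite s"
  shows "inj_on \<phi> s"
proof (rule inj_onI, rule ccontr)
  fix u v assume uv: "u \<in> s" "v \<in> s" "\<phi> u = \<phi> v" "u \<noteq> v"
  then have "indep \<phi> {u, v}" using assms indep_subset[of \<phi> s "{u,v}"] by auto
  from this[unfolded indep_def, rule_format, of "\<lambda>i. if i = u then 1 else -1" u] uv
  show False by simp
qed

lemma indep_imp_not_affine_dependent:
  assumes "indep \<phi> s" "finite s"
  shows "\<not> affine_dependent (\<phi> ` s)"
proof -
  have inj: "inj_on \<phi> s" using indep_imp_inj assms by blast
  show ?thesis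
    unfolding affine_dependent_explicit_finite[OF finite_imageI[OF assms(2)]]
    using assms(1) unfolding indep_def by (fastforce simp: sum.reindex[OF inj] o_def)
qed

lemma open_simplex_image:
  assumes "inj_on \<phi> s"
  shows "open_simplex \<phi> s =
    {y. \<exists>u. (\<forall>x\<in>\<phi> ` s. 0 < u x) \<and> sum u (\<phi> ` s) = 1 \<and> (\<Sum>x\<in>\<phi> ` s. u x *\<^sub>R x) = y}"
    (is "?l = ?r")
proof
  show "?l \<subseteq> ?r"
  proof
    fix x assume "x \<in> ?l"
    then obtain w where w: "\<And>i. i \<in> s \<Longrightarrow> 0 < w i" "sum w s = 1" "x = (\<Sum>i\<in>s. w i *\<^sub>R \<phi> i)"
      by (rule open_simplexE) blast
    let ?u = "\<lambda>x. w (inv_into s \<phi> x)"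
    have "(\<forall>x\<in>\<phi> ` s. 0 < ?u x) \<and> sum ?u (\<phi> ` s) = 1 \<and> (\<Sum>x\<in>\<phi> ` s. ?u x *\<^sub>R x) = x"
      using w assms by (simp add: sum.reindex o_def)
    then show "x \<in> ?r" by (intro CollectI exI[of _ ?u])
  qed
  show "?r \<subseteq> ?l"
  proof
    fix x assume "x \<in> ?r"
    then obtain u where u: "\<forall>x\<in>\<phi> ` s. 0 < u x" "sum u (\<phi> ` s) = 1" "(\<Sum>x\<in>\<phi> ` s. u x *\<^sub>R x) = x"
      by blast
    show "x \<in> ?l"
      by (rule open_simplexI[of _ "\<lambda>i. u (\<phi> i)"]) (use u assms in \<open>simp_all add: sum.reindex o_def\<close>)
  qed
qed

text \<open>The support of a weight function tells in which open face its point lies.\<close>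

lemma convex_hull_eq_Union_open_simplex:
  assumes "finite s" "inj_on \<phi> s"
  shows "convex hull (\<phi> ` s) = (\<Union>t\<in>Pow s - {{}}. open_simplex \<phi> t)"
proof
  show "convex hull (\<phi> ` s) \<subseteq> (\<Union>t\<in>Pow s - {{}}. open_simplex \<phi> t)"
  proof
    fix x assume "x \<in> convex hull (\<phi> ` s)"
    then obtain u where u: "\<forall>x\<in>\<phi> ` s. 0 \<le> u x" "sum u (\<phi> ` s) = 1" "(\<Sum>x\<in>\<phi> ` s. u x *\<^sub>R x) = x"
      using convex_hull_finite[of "\<phi> ` s"] assms by auto
    define t where "t = {i\<in>s. u (\<phi> i) \<noteq> 0}"
    have ts: "t \<subseteq> s" "finite t" using assms by (auto simp: t_def)
    have "sum (\<lambda>i. u (\<phi> i)) t = sum (\<lambda>i. u (\<phi> i)) s"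
      by (rule sum.mono_neutral_left) (use assms in \<open>auto simp: t_def\<close>)
    then have 1: "sum (\<lambda>i. u (\<phi> i)) t = 1" using u(2) assms by (simp add: sum.reindex o_def)
    have "(\<Sum>i\<in>t. u (\<phi> i) *\<^sub>R \<phi> i) = (\<Sum>i\<in>s. u (\<phi> i) *\<^sub>R \<phi> i)"
      by (rule sum.mono_neutral_left) (use assms in \<open>auto simp: t_def\<close>)
    then have 2: "(\<Sum>i\<in>t. u (\<phi> i) *\<^sub>R \<phi> i) = x" using u(3) assms by (simp add: sum.reindex o_def)
    have "t \<noteq> {}" using 1 by auto
    moreover have "x \<in> open_simplex \<phi> t"
      by (rule open_simplexI[OF _ 1 2[symmetric]]) (use u(1) in \<open>force simp: t_def\<close>)
    ultimately show "x \<in> (\<Union>t\<in>Pow s - {{}}. open_simplex \<phi> t)" using ts by blast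
  qed
  show "(\<Union>t\<in>Pow s - {{}}. open_simplex \<phi> t) \<subseteq> convex hull (\<phi> ` s)"
  proof
    fix x assume "x \<in> (\<Union>t\<in>Pow s - {{}}. open_simplex \<phi> t)"
    then obtain t where t: "t \<subseteq> s" "x \<in> open_simplex \<phi> t" by auto
    then obtain w where w: "\<And>i. i \<in> t \<Longrightarrow> 0 < w i" "sum w t = 1" "x = (\<Sum>i\<in>t. w i *\<^sub>R \<phi> i)"
      by (auto elim: open_simplexE)
    have ft: "finite t" using assms t finite_subset by blast
    have "x \<in> convex hull (\<phi> ` t)"
      unfolding w(3)
      by (rule convex_sum[OF ft convex_convex_hull w(2)]) (use w in \<open>auto intro: hull_inc less_imp_le\<close>)
    then show "x \<in> convex hull (\<phi> ` s)" using t hull_mono[of "\<phi> ` t" "\<phi> ` s"] by blast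
  qed
qed

text \<open>The barycenter spreads the weight of \<open>p\<close> evenly over
  \<open>\<sigma>\<close>. This change of coordinates from the subdivided simplex to the old one is
  the source of all facts about subdivision below.\<close>

lemma stellar_sum:
  fixes f :: "'a \<Rightarrow> 'b::real_vector"
  assumes "finite t" "finite \<sigma>" "p \<notin> t \<union> \<sigma>" "s = t \<union> \<sigma>"
  shows "(\<Sum>i\<in>insert p t. w i *\<^sub>R (f(p := barycenter f \<sigma>)) i) =
    (\<Sum>i\<in>s. ((if i \<in> t then w i else 0) + (if i \<in> \<sigma> then w p / card \<sigma> else 0)) *\<^sub>R f i)"
proof -
  have fs: "finite s" using assms by simp
  have "(\<Sum>i\<in>s. (if i \<in> t then w i else 0) *\<^sub>R f i) = (\<Sum>i\<in>t. w i *\<^sub>R f i)"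
    by (rule sum.mono_neutral_cong_right) (use assms in auto)
  moreover have "(\<Sum>i\<in>s. (if i \<in> \<sigma> then w p / card \<sigma> else 0) *\<^sub>R f i) = (\<Sum>i\<in>\<sigma>. (w p / card \<sigma>) *\<^sub>R f i)"
    by (rule sum.mono_neutral_cong_right) (use assms in auto)
  moreover have "(\<Sum>i\<in>\<sigma>. (w p / card \<sigma>) *\<^sub>R f i) = w p *\<^sub>R barycenter f \<sigma>"
    unfolding barycenter_def by (simp add: scaleR_sum_right)
  moreover have "(\<Sum>i\<in>insert p t. w i *\<^sub>R (f(p := barycenter f \<sigma>)) i)
      = w p *\<^sub>R barycenter f \<sigma> + (\<Sum>i\<in>t. w i *\<^sub>R f i)"
    using assms by (subst sum.insert) (auto intro!: sum.cong)
  ultimately show ?thesis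
    by (simp add: scaleR_add_left sum.distrib)
qed

text \<open>The total weight is the case of the constant map 1, whose barycenter is again 1.\<close>

lemma stellar_sum_weights:
  assumes "finite t" "finite \<sigma>" "\<sigma> \<noteq> {}" "p \<notin> t \<union> \<sigma>" "s = t \<union> \<sigma>"
  shows "sum w (insert p t) =
    (\<Sum>i\<in>s. (if i \<in> t then w i else 0) + (if i \<in> \<sigma> then w p / card \<sigma> else (0::real)))"
proof -
  have "barycenter (\<lambda>_. 1::real) \<sigma> = 1"
    using assms by (simp add: barycenter_def)
  then have "((\<lambda>_. 1::real)(p := barycenter (\<lambda>_. 1) \<sigma>)) = (\<lambda>_. 1)" by auto
  then show ?thesis using stellar_sum[OF assms(1,2,4,5), of w "\<lambda>_. 1::real"] by simp
qed

text \<open>A vertex of \<open>\<sigma>\<close> outside \<open>t\<close> has the share of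
  \<open>p\<close> as its only weight in the old coordinates. So a vanishing combination has weight
  0 at \<open>p\<close>, and then everywhere.\<close>

lemma indep_stellar:
  fixes \<phi> :: "'a \<Rightarrow> 'b::real_vector"
  assumes "indep \<phi> s" "finite t" "finite \<sigma>" "p \<notin> t \<union> \<sigma>" "s = t \<union> \<sigma>" "\<not> \<sigma> \<subseteq> t"
  shows "indep (\<phi>(p := barycenter \<phi> \<sigma>)) (insert p t)"
  unfolding indep_def
proof (intro allI impI)
  fix w assume w: "sum w (insert p t) = 0"
    "(\<Sum>i\<in>insert p t. w i *\<^sub>R (\<phi>(p := barycenter \<phi> \<sigma>)) i) = 0"
  have ne: "\<sigma> \<noteq> {}" using assms by auto
  let ?W = "\<lambda>i. (if i \<in> t then w i else 0) + (if i \<in> \<sigma> then w p / card \<sigma> else 0)"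
  have "sum ?W s = 0" using stellar_sum_weights[OF assms(2,3) ne assms(4,5), of w] w(1) by simp
  moreover have "(\<Sum>i\<in>s. ?W i *\<^sub>R \<phi> i) = 0" using stellar_sum[OF assms(2-5), of w \<phi>] w(2) by simp
  ultimately have 0: "\<forall>i\<in>s. ?W i = 0"
    using assms(1)[unfolded indep_def, rule_format, of ?W] by blast
  obtain j where "j \<in> \<sigma>" "j \<notin> t" using assms by auto
  then have "w p / card \<sigma> = 0" using 0[rule_format, of j] assms(5) by auto
  then have p: "w p = 0" using ne assms(3) by auto
  have "w i = 0" if "i \<in> t" for i
    using 0[rule_format, of i] that p assms(5) by (auto split: if_splits)
  then show "\<forall>i\<in>insert p t. w i = 0" using p by auto
qed

lemma open_simplex_stellar_subset:
  fixes \<phi> :: "'a \<Rightarrow> 'b::real_vector"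
  assumes "finite t" "finite \<sigma>" "\<sigma> \<noteq> {}" "p \<notin> t \<union> \<sigma>" "s = t \<union> \<sigma>"
  shows "open_simplex (\<phi>(p := barycenter \<phi> \<sigma>)) (insert p t) \<subseteq> open_simplex \<phi> s"
proof
  fix x assume "x \<in> open_simplex (\<phi>(p := barycenter \<phi> \<sigma>)) (insert p t)"
  then obtain w where w: "\<And>i. i \<in> insert p t \<Longrightarrow> 0 < w i" "sum w (insert p t) = 1"
    "x = (\<Sum>i\<in>insert p t. w i *\<^sub>R (\<phi>(p := barycenter \<phi> \<sigma>)) i)" by (rule open_simplexE) blast
  have c: "0 < card \<sigma>" using assms by (simp add: card_gt_0_iff)
  let ?W = "\<lambda>i. (if i \<in> t then w i else 0) + (if i \<in> \<sigma> then w p / card \<sigma> else 0)"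
  show "x \<in> open_simplex \<phi> s"
  proof (rule open_simplexI[of _ ?W])
    show "sum ?W s = 1" using stellar_sum_weights[OF assms, of w] w(2) by simp
    show "x = (\<Sum>i\<in>s. ?W i *\<^sub>R \<phi> i)" using stellar_sum[OF assms(1,2,4,5), of w \<phi>] w(3) by simp
    show "0 < ?W i" if "i \<in> s" for i
      using that w(1)[of i] w(1)[of p] assms(5) c by (auto intro!: add_pos_pos)
  qed
qed

text \<open>The weight of the new vertex is forced to be the minimum over \<open>\<sigma>\<close> of the old weights,
  times \<open>card \<sigma>\<close>.\<close>

lemma open_simplex_stellar_disjoint:
  fixes \<phi> :: "'a \<Rightarrow> 'b::real_vector"
  assumes "indep \<phi> s" "finite s" "\<sigma> \<noteq> {}" "p \<notin> s"
    and "s = t \<union> \<sigma>" "\<not> \<sigma> \<subseteq> t" "s = t' \<union> \<sigma>" "\<not> \<sigma> \<subseteq> t'"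
    and "x \<in> open_simplex (\<phi>(p := barycenter \<phi> \<sigma>)) (insert p t)"
    and "x \<in> open_simplex (\<phi>(p := barycenter \<phi> \<sigma>)) (insert p t')"
  shows "t = t'"
proof -
  have fin: "finite t" "finite t'" "finite \<sigma>" "p \<notin> t \<union> \<sigma>" "p \<notin> t' \<union> \<sigma>"
    using assms by (auto intro: finite_subset)
  obtain w where w: "\<And>i. i \<in> insert p t \<Longrightarrow> 0 < w i" "sum w (insert p t) = 1"
    "x = (\<Sum>i\<in>insert p t. w i *\<^sub>R (\<phi>(p := barycenter \<phi> \<sigma>)) i)"
    using assms(9) by (rule open_simplexE) blast
  obtain v where v: "\<And>i. i \<in> insert p t' \<Longrightarrow> 0 < v i" "sum v (insert p t') = 1"
    "x = (\<Sum>i\<in>insert p t'. v i *\<^sub>R (\<phi>(p := barycenter \<phi> \<sigma>)) i)"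
    using assms(10) by (rule open_simplexE) blast
  let ?W = "\<lambda>i. (if i \<in> t then w i else 0) + (if i \<in> \<sigma> then w p / card \<sigma> else 0)"
  let ?V = "\<lambda>i. (if i \<in> t' then v i else 0) + (if i \<in> \<sigma> then v p / card \<sigma> else 0)"
  have eq: "?W i = ?V i" if "i \<in> s" for i
  proof (rule indep_unique[OF assms(1) _ _ that])
    show "sum ?W s = sum ?V s"
      using stellar_sum_weights[OF fin(1,3) assms(3) fin(4) assms(5), of w] w(2)
        stellar_sum_weights[OF fin(2,3) assms(3) fin(5) assms(7), of v] v(2) by simp
    show "(\<Sum>i\<in>s. ?W i *\<^sub>R \<phi> i) = (\<Sum>i\<in>s. ?V i *\<^sub>R \<phi> i)"
      using stellar_sum[OF fin(1,3,4) assms(5), of w \<phi>] w(3)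
        stellar_sum[OF fin(2,3,5) assms(7), of v \<phi>] v(3) by simp
  qed
  obtain a where a: "a \<in> \<sigma>" "a \<notin> t" using assms by auto
  obtain b where b: "b \<in> \<sigma>" "b \<notin> t'" using assms by auto
  have "w p / card \<sigma> \<ge> v p / card \<sigma>"
    using eq[of a] a v(1)[of a] assms(5) by (auto split: if_splits)
  moreover have "w p / card \<sigma> \<le> v p / card \<sigma>"
    using eq[of b] b w(1)[of b] assms(5) by (auto split: if_splits)
  ultimately have m: "w p / card \<sigma> = v p / card \<sigma>" by (rule antisym[rotated])
  have "i \<in> t \<longleftrightarrow> i \<in> t'" if "i \<in> s" for i
    using eq[OF that] m w(1)[of i] v(1)[of i] by (auto split: if_splits)
  then show ?thesis using assms(5,7) by auto
qed

text \<open>The change of coordinates backwards: the minimum \<open>m\<close> of the old weights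
  over \<open>\<sigma>\<close> is taken away from every vertex of \<open>\<sigma>\<close> and
  collected at \<open>p\<close>. The vertices where the minimum is attained drop out, which
  determines \<open>t\<close>.\<close>

lemma open_simplex_stellar_cover:
  fixes \<phi> :: "'a \<Rightarrow> 'b::real_vector"
  assumes "finite s" "\<sigma> \<noteq> {}" "\<sigma> \<subseteq> s" "p \<notin> s" "x \<in> open_simplex \<phi> s"
  obtains t where "t \<union> \<sigma> = s" "\<not> \<sigma> \<subseteq> t" "x \<in> open_simplex (\<phi>(p := barycenter \<phi> \<sigma>)) (insert p t)"
proof -
  have f\<sigma>: "finite \<sigma>" using assms finite_subset by blast
  then have c: "0 < card \<sigma>" using assms by (simp add: card_gt_0_iff)
  obtain l where l: "\<And>i. i \<in> s \<Longrightarrow> 0 < l i" "sum l s = 1" "x = (\<Sum>i\<in>s. l i *\<^sub>R \<phi> i)"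
    using assms(5) by (rule open_simplexE) blast
  define m where "m = Min (l ` \<sigma>)"
  have m: "m \<in> l ` \<sigma>" "\<And>i. i \<in> \<sigma> \<Longrightarrow> m \<le> l i"
    using f\<sigma> assms(2) by (auto simp: m_def)
  have mpos: "0 < m" using m(1) l(1) assms(3) by auto
  define t where "t = {i\<in>s. i \<notin> \<sigma> \<or> l i \<noteq> m}"
  have ts: "t \<union> \<sigma> = s" "\<not> \<sigma> \<subseteq> t" "finite t" using assms m by (auto simp: t_def)
  have p: "p \<notin> t \<union> \<sigma>" using ts assms by simp
  define w where "w = (\<lambda>i. if i = p then m * card \<sigma> else if i \<in> \<sigma> then l i - m else l i)"
  have W: "(if i \<in> t then w i else 0) + (if i \<in> \<sigma> then w p / card \<sigma> else 0) = l i" if "i \<in> s" for i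
    using that c assms(4) by (auto simp: t_def w_def)
  show ?thesis
  proof
    show "t \<union> \<sigma> = s" "\<not> \<sigma> \<subseteq> t" by fact+
    show "x \<in> open_simplex (\<phi>(p := barycenter \<phi> \<sigma>)) (insert p t)"
    proof (rule open_simplexI[of _ w])
      show "0 < w i" if "i \<in> insert p t" for i
        using that mpos c l(1)[of i] m(2)[of i] by (auto simp: t_def w_def)
      show "sum w (insert p t) = 1"
        unfolding stellar_sum_weights[OF ts(3) f\<sigma> assms(2) p ts(1)[symmetric], of w]
        using W l(2) by simp
      show "x = (\<Sum>i\<in>insert p t. w i *\<^sub>R (\<phi>(p := barycenter \<phi> \<sigma>)) i)"
        unfolding stellar_sum[OF ts(3) f\<sigma> p ts(1)[symmetric], of w]
        using W l(3) by simp
    qed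
  qed
qed

section \<open>Stellar subdivision of a simplicial disc and of its drawing\<close>

definition link :: "'a set set \<Rightarrow> 'a set \<Rightarrow> 'a set" where
  "link K e = {w. w \<notin> e \<and> insert w e \<in> K}"

text \<open>The simplices above \<open>\<sigma>\<close> give way to the cone from \<open>p\<close>
  over those of their faces that miss a vertex of \<open>\<sigma>\<close>. The choice
  \<open>t = {}\<close> yields the new vertex \<open>{p}\<close>.\<close>

definition stellar :: "'a set \<Rightarrow> 'a \<Rightarrow> 'a set set \<Rightarrow> 'a set set" where
  "stellar \<sigma> p K = {s\<in>K. \<not> \<sigma> \<subseteq> s} \<union> {insert p t | t. t \<union> \<sigma> \<in> K \<and> \<not> \<sigma> \<subseteq> t}"

text \<open>\<open>K\<close> contains the nonempty simplices, \<open>B\<close> is the boundary triangle. The bound on the links is what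
  makes the subdivision of an interior edge affect two triangles only.\<close>

definition disc_complex :: "'a set \<Rightarrow> 'a set set \<Rightarrow> bool" where
  "disc_complex B K \<longleftrightarrow> finite K \<and> card B = 3 \<and> (\<forall>t. t \<noteq> {} \<longrightarrow> t \<subset> B \<longrightarrow> t \<in> K) \<and>
     (\<forall>s\<in>K. s \<noteq> {} \<and> finite s \<and> card s \<le> 3) \<and>
     (\<forall>s\<in>K. \<forall>t. t \<subseteq> s \<longrightarrow> t \<noteq> {} \<longrightarrow> t \<in> K) \<and>
     (\<forall>e\<in>K. card e = 2 \<longrightarrow> card (link K e) \<le> (if e \<subseteq> B then 1 else 2))"

definition draws :: "'a set \<Rightarrow> 'a set set \<Rightarrow> ('a \<Rightarrow> complex) \<Rightarrow> bool" where
  "draws B K \<phi> \<longleftrightarrow> (\<forall>s\<in>K. indep \<phi> s) \<and>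
     (\<forall>s\<in>K. \<forall>t\<in>K. s \<noteq> t \<longrightarrow> open_simplex \<phi> s \<inter> open_simplex \<phi> t = {}) \<and>
     (\<Union>s\<in>K. open_simplex \<phi> s) = convex hull (\<phi> ` B)"

lemma disc_complexD:
  assumes "disc_complex B K"
  shows "finite K" "card B = 3" "finite B"
    "\<And>t. t \<noteq> {} \<Longrightarrow> t \<subset> B \<Longrightarrow> t \<in> K"
    "\<And>s. s \<in> K \<Longrightarrow> s \<noteq> {}" "\<And>s. s \<in> K \<Longrightarrow> finite s" "\<And>s. s \<in> K \<Longrightarrow> card s \<le> 3"
    "\<And>s t. s \<in> K \<Longrightarrow> t \<subseteq> s \<Longrightarrow> t \<noteq> {} \<Longrightarrow> t \<in> K"
    "\<And>e. e \<in> K \<Longrightarrow> card e = 2 \<Longrightarrow> card (link K e) \<le> (if e \<subseteq> B then 1 else 2)"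
    "B \<subseteq> \<Union>K"
proof -
  have c: "finite K" "card B = 3" "\<forall>t. t \<noteq> {} \<longrightarrow> t \<subset> B \<longrightarrow> t \<in> K"
    "\<forall>s\<in>K. s \<noteq> {} \<and> finite s \<and> card s \<le> 3"
    "\<forall>s\<in>K. \<forall>t. t \<subseteq> s \<longrightarrow> t \<noteq> {} \<longrightarrow> t \<in> K"
    "\<forall>e\<in>K. card e = 2 \<longrightarrow> card (link K e) \<le> (if e \<subseteq> B then 1 else 2)"
    using assms unfolding disc_complex_def by - (elim conjE, assumption)+
  show "finite K" by (rule c)
  show "card B = 3" by (rule c)
  show "finite B" using c(2) by (intro card_ge_0_finite) simp
  show 4: "t \<in> K" if "t \<noteq> {}" "t \<subset> B" for t by (rule c(3)[rule_format, OF that])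
  show "s \<noteq> {}" "finite s" "card s \<le> 3" if "s \<in> K" for s
    using c(4)[rule_format, OF that] by - (elim conjE, assumption)+
  show "t \<in> K" if "s \<in> K" "t \<subseteq> s" "t \<noteq> {}" for s t
    by (rule c(5)[rule_format, OF that])
  show "card (link K e) \<le> (if e \<subseteq> B then 1 else 2)" if "e \<in> K" "card e = 2" for e
    by (rule c(6)[rule_format, OF that])
  show "B \<subseteq> \<Union>K"
  proof
    fix x assume x: "x \<in> B"
    moreover have "B \<noteq> {x}" using c(2) by auto
    ultimately have "{x} \<subset> B" by blast
    then show "x \<in> \<Union>K" using 4[of "{x}"] by blast
  qed
qed

lemma finite_link:
  assumes "disc_complex B K"
  shows "finite (link K e)"
proof -
  have "link K e \<subseteq> \<Union>K" unfolding link_def by auto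
  moreover have "finite (\<Union>K)" using disc_complexD(1,6)[OF assms] by blast
  ultimately show ?thesis by (rule finite_subset)
qed

lemma insert_mem_stellar_iff:
  assumes "p \<notin> \<Union>K" "p \<notin> t"
  shows "insert p t \<in> stellar \<sigma> p K \<longleftrightarrow> t \<union> \<sigma> \<in> K \<and> \<not> \<sigma> \<subseteq> t"
proof
  assume "insert p t \<in> stellar \<sigma> p K"
  then obtain t' where t': "insert p t = insert p t'" "t' \<union> \<sigma> \<in> K" "\<not> \<sigma> \<subseteq> t'"
    using assms unfolding stellar_def by auto
  then have "p \<notin> t'" using assms by auto
  then have "t = t'" using t'(1) assms(2) by auto
  then show "t \<union> \<sigma> \<in> K \<and> \<not> \<sigma> \<subseteq> t" using t' by simp
qed (auto simp: stellar_def)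

lemma mem_stellar_iff:
  assumes "p \<notin> s"
  shows "s \<in> stellar \<sigma> p K \<longleftrightarrow> s \<in> K \<and> \<not> \<sigma> \<subseteq> s"
  using assms unfolding stellar_def by auto

lemma stellar_cases:
  assumes "s \<in> stellar \<sigma> p K" "p \<notin> \<Union>K"
  obtains (old) "s \<in> K" "\<not> \<sigma> \<subseteq> s" "p \<notin> s"
  | (new) t where "s = insert p t" "p \<notin> t" "t \<union> \<sigma> \<in> K" "\<not> \<sigma> \<subseteq> t" "p \<notin> t \<union> \<sigma>"
  using assms unfolding stellar_def by blast

text \<open>At an old edge a destroyed triangle is replaced by one with apex \<open>p\<close>, so
  the count does not grow. At a new edge \<open>{p, a}\<close> the apexes are vertices of
  \<open>\<sigma>\<close> or, if \<open>\<sigma>\<close> is an edge that ends in \<open>a\<close>,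
  apexes of triangles at \<open>\<sigma>\<close>.\<close>

lemma disc_complex_stellar_link:
  assumes K: "disc_complex B K" and "\<sigma> \<in> K" "2 \<le> card \<sigma>" and p: "p \<notin> \<Union>K"
    and e: "e \<in> stellar \<sigma> p K" "card e = 2"
  shows "card (link (stellar \<sigma> p K) e) \<le> (if e \<subseteq> B then 1 else 2)"
  using e(1) p
proof (cases rule: stellar_cases)
  case old
  have fl: "finite (link K e)" using finite_link[OF K] .
  have "card (link (stellar \<sigma> p K) e) \<le> card (link K e)"
  proof (cases "e \<union> \<sigma> \<in> K")
    case False
    have "link (stellar \<sigma> p K) e \<subseteq> link K e"
    proof
      fix w assume "w \<in> link (stellar \<sigma> p K) e"
      then have w: "w \<notin> e" "insert w e \<in> stellar \<sigma> p K" by (auto simp: link_def)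
      then have "w \<noteq> p" using insert_mem_stellar_iff[OF p old(3)] False by blast
      then show "w \<in> link K e" using w old(3) mem_stellar_iff[of p "insert w e"] by (auto simp: link_def)
    qed
    then show ?thesis using card_mono fl by blast
  next
    case True
    have fe: "finite (e \<union> \<sigma>)" "card (e \<union> \<sigma>) \<le> 3" using disc_complexD(6,7)[OF K True] by auto
    obtain a where a: "a \<in> \<sigma>" "a \<notin> e" using old by auto
    have "insert a e \<subseteq> e \<union> \<sigma>" "card (insert a e) = 3" using a e(2) fe by (auto simp: card_insert_if)
    then have eq: "e \<union> \<sigma> = insert a e" using card_seteq[OF fe(1)] fe(2) by metis
    \<comment> \<open>The triangle \<open>insert a e\<close> contains \<open>\<sigma>\<close> and is
      destroyed, so \<open>a\<close> leaves the link and makes room for \<open>p\<close>.\<close>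
    have "link (stellar \<sigma> p K) e \<subseteq> insert p (link K e - {a})"
    proof
      fix w assume "w \<in> link (stellar \<sigma> p K) e"
      then have w: "w \<notin> e" "insert w e \<in> stellar \<sigma> p K" by (auto simp: link_def)
      show "w \<in> insert p (link K e - {a})"
      proof (cases "w = p")
        case False
        then have "insert w e \<in> K" "\<not> \<sigma> \<subseteq> insert w e" using w(2) old(3) mem_stellar_iff[of p "insert w e"] by auto
        then show ?thesis using w(1) eq by (auto simp: link_def)
      qed simp
    qed
    then have "card (link (stellar \<sigma> p K) e) \<le> card (insert p (link K e - {a}))"
      using card_mono fl by (metis finite_Diff finite_insert)
    also have "\<dots> \<le> Suc (card (link K e - {a}))" by (rule card_insert_le_m1) simp_all
    also have "\<dots> = card (link K e)"
    proof -
      have "a \<in> link K e" using a True eq by (auto simp: link_def)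
      then show ?thesis by (rule card_Suc_Diff1[OF fl])
    qed
    finally show ?thesis .
  qed
  also have "\<dots> \<le> (if e \<subseteq> B then 1 else 2)" using disc_complexD(9)[OF K old(1) e(2)] .
  finally show ?thesis .
next
  case (new t)
  have "\<not> e \<subseteq> B" using new p disc_complexD(10)[OF K] by auto
  have "finite t" using new(3) disc_complexD(6)[OF K] by blast
  then have "card t = 1" using new e(2) by simp
  then obtain a where a: "t = {a}" by (rule card_1_singletonE)
  have f\<sigma>: "finite \<sigma>" "card \<sigma> \<le> 3" using disc_complexD(6,7)[OF K assms(2)] by auto
  have b: "b \<noteq> a \<and> {a,b} \<union> \<sigma> \<in> K \<and> \<not> \<sigma> \<subseteq> {a,b}" if "b \<in> link (stellar \<sigma> p K) e" for b
  proof -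
    have "b \<noteq> p" "b \<noteq> a" "insert b (insert p {a}) \<in> stellar \<sigma> p K"
      using that new a by (auto simp: link_def)
    then have "insert p {a,b} \<in> stellar \<sigma> p K" by (simp add: insert_commute)
    then show ?thesis using insert_mem_stellar_iff[OF p, of "{a,b}" \<sigma>] new(2) a \<open>b \<noteq> p\<close> \<open>b \<noteq> a\<close> by auto
  qed
  \<comment> \<open>Here \<open>\<sigma>\<close> is a triangle with corner \<open>a\<close>, or an
    edge opposite to \<open>a\<close>. In both cases \<open>insert a \<sigma>\<close> is already
    full, and no further vertex fits.\<close>
  have in\<sigma>: "link (stellar \<sigma> p K) e \<subseteq> \<sigma> - {a}" if "card (insert a \<sigma>) = 3"
  proof
    fix x assume "x \<in> link (stellar \<sigma> p K) e"
    then have x: "x \<noteq> a" "{a,x} \<union> \<sigma> \<in> K" using b by auto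
    then have "card ({a,x} \<union> \<sigma>) \<le> card (insert a \<sigma>)" using disc_complexD(7)[OF K] that by auto
    then have "insert a \<sigma> = {a,x} \<union> \<sigma>" using f\<sigma>(1) by (intro card_seteq) auto
    then show "x \<in> \<sigma> - {a}" using x(1) by auto
  qed
  have "card (link (stellar \<sigma> p K) e) \<le> 2"
  proof (cases "card (insert a \<sigma>) = 3")
    case True
    have "insert a \<sigma> = insert a (\<sigma> - {a})" by auto
    then have "card (\<sigma> - {a}) = 2" using True f\<sigma> by (metis Diff_iff card_insert_disjoint finite_Diff insertI1
          One_nat_def add_2_eq_Suc' nat.inject numeral_3_eq_3 numeral_2_eq_2)
    then show ?thesis using card_mono[OF _ in\<sigma>[OF True]] f\<sigma>(1) by simp
  next
    case False
    have "card (insert a \<sigma>) \<le> 3" using new(3) a disc_complexD(7)[OF K] by auto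
    then have "card (insert a \<sigma>) = 2"
      using False assms(3) card_insert_le[of \<sigma> a] by linarith
    then have "\<sigma> = insert a \<sigma>" using assms(3) f\<sigma>(1) by (intro card_seteq) auto
    then have a\<sigma>: "a \<in> \<sigma>" "card \<sigma> = 2" using \<open>card (insert a \<sigma>) = 2\<close> by auto
    \<comment> \<open>The remaining case is the subdivision of an edge. It relies on the bound for
      \<open>\<sigma>\<close> in \<open>K\<close> itself, which is why the bound is carried along as
      an invariant.\<close>
    have "link (stellar \<sigma> p K) e \<subseteq> link K \<sigma>"
    proof
      fix x assume "x \<in> link (stellar \<sigma> p K) e"
      then have x: "x \<noteq> a" "{a,x} \<union> \<sigma> \<in> K" "\<not> \<sigma> \<subseteq> {a,x}" using b by auto
      have "x \<notin> \<sigma>"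
      proof
        assume "x \<in> \<sigma>"
        then have "{a,x} = \<sigma>" using a\<sigma> x(1) f\<sigma>(1) by (intro card_seteq) auto
        then show False using x(3) by simp
      qed
      then show "x \<in> link K \<sigma>" using x(2) a\<sigma> by (simp add: link_def insert_absorb)
    qed
    then have "card (link (stellar \<sigma> p K) e) \<le> card (link K \<sigma>)" using card_mono finite_link[OF K] by blast
    also have "\<dots> \<le> 2" using disc_complexD(9)[OF K assms(2) a\<sigma>(2)] by (auto split: if_splits)
    finally show ?thesis .
  qed
  then show ?thesis using \<open>\<not> e \<subseteq> B\<close> by simp
qed

text \<open>A proper face of \<open>B\<close> must not be subdivided, as the boundary has to stay.
  The case \<open>\<sigma> = B\<close> is allowed: it occurs when the first vertex is put into a
  complex that is a single triangle.\<close>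

lemma disc_complex_stellar:
  assumes K: "disc_complex B K" and \<sigma>: "\<sigma> \<in> K" "2 \<le> card \<sigma>" "\<not> \<sigma> \<subset> B" and p: "p \<notin> \<Union>K"
  shows "disc_complex B (stellar \<sigma> p K)"
  unfolding disc_complex_def
proof (intro conjI ballI allI impI)
  note D = disc_complexD[OF K]
  have ne: "\<sigma> \<noteq> {}" using D(5) \<sigma> by blast
  have "finite (\<Union>K)" using D(1,6) by blast
  then have "finite (Pow (insert p (\<Union>K)))" by simp
  moreover have "stellar \<sigma> p K \<subseteq> Pow (insert p (\<Union>K))" unfolding stellar_def by auto
  ultimately show "finite (stellar \<sigma> p K)" by (rule rev_finite_subset)
  show "card B = 3" by (rule D)
  show "t \<in> stellar \<sigma> p K" if "t \<noteq> {}" "t \<subset> B" for t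
    using D(4)[OF that] that(2) \<sigma>(3) unfolding stellar_def by blast
  show "s \<noteq> {}" if "s \<in> stellar \<sigma> p K" for s
    using that p by (cases rule: stellar_cases) (use D(5) in blast)+
  show "finite s" if "s \<in> stellar \<sigma> p K" for s
    using that p
  proof (cases rule: stellar_cases)
    case old
    then show ?thesis using D(6) by blast
  next
    case (new t)
    then show ?thesis using D(6)[OF new(3)] by simp
  qed
  show "card s \<le> 3" if "s \<in> stellar \<sigma> p K" for s
    using that p
  proof (cases rule: stellar_cases)
    case old
    then show ?thesis using D(7) by blast
  next
    case (new t)
    have f: "finite (t \<union> \<sigma>)" "card (t \<union> \<sigma>) \<le> 3" using D(6,7)[OF new(3)] by auto
    have "t \<subset> t \<union> \<sigma>" using new(4) by blast
    then have "card t < card (t \<union> \<sigma>)" by (rule psubset_card_mono[OF f(1)])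
    then have "card t < 3" using f by linarith
    then show ?thesis using new f by simp
  qed
  show "t \<in> stellar \<sigma> p K" if s: "s \<in> stellar \<sigma> p K" and t: "t \<subseteq> s" "t \<noteq> {}" for s t
    using s p
  proof (cases rule: stellar_cases)
    case old
    then have "t \<in> K" "\<not> \<sigma> \<subseteq> t" using D(8)[OF old(1) t] t(1) by blast+
    then show ?thesis unfolding stellar_def by blast
  next
    case (new r)
    show ?thesis
    proof (cases "p \<in> t")
      case False
      then have "t \<subseteq> r" using t new by auto
      moreover have "t \<in> K" by (rule D(8)[OF new(3) _ t(2)]) (use \<open>t \<subseteq> r\<close> in blast)
      ultimately show ?thesis using new(4) unfolding stellar_def by blast
    next
      case True
      have sub: "t - {p} \<subseteq> r" using t new by auto
      have "(t - {p}) \<union> \<sigma> \<in> K" by (rule D(8)[OF new(3)]) (use sub ne in auto)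
      moreover have "\<not> \<sigma> \<subseteq> t - {p}" using sub new by blast
      ultimately have "insert p (t - {p}) \<in> stellar \<sigma> p K" unfolding stellar_def by blast
      then show ?thesis using True by (simp add: insert_absorb)
    qed
  qed
  show "card (link (stellar \<sigma> p K) e) \<le> (if e \<subseteq> B then 1 else 2)"
    if "e \<in> stellar \<sigma> p K" "card e = 2" for e
    using disc_complex_stellar_link[OF K \<sigma>(1,2) p that] .
qed

text \<open>Every new open simplex lies in an old one, \<open>t \<union> \<sigma>\<close>. So two
  new simplices can only clash inside a single old simplex, where the weights exclude it, and the
  covering can be checked for each old simplex separately.\<close>

lemma draws_stellar:
  assumes K: "disc_complex B K" and d: "draws B K \<phi>" and \<sigma>: "\<sigma> \<in> K" and p: "p \<notin> \<Union>K"
  shows "draws B (stellar \<sigma> p K) (\<phi>(p := barycenter \<phi> \<sigma>))" (is "draws B ?K ?\<phi>")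
proof -
  note D = disc_complexD[OF K]
  have ne: "\<sigma> \<noteq> {}" and f\<sigma>: "finite \<sigma>" using D(5,6)[OF \<sigma>] by auto
  have i: "indep \<phi> s" if "s \<in> K" for s using d that unfolding draws_def by blast
  have dj: "s = t" if "s \<in> K" "t \<in> K" "x \<in> open_simplex \<phi> s" "x \<in> open_simplex \<phi> t" for s t x
    using d that unfolding draws_def by blast
  have U: "(\<Union>s\<in>K. open_simplex \<phi> s) = convex hull (\<phi> ` B)"
    using d unfolding draws_def by (elim conjE)
  have old_eq: "open_simplex ?\<phi> s = open_simplex \<phi> s" if "p \<notin> s" for s
    by (rule open_simplex_cong) (use that in auto)
  have new_sub: "open_simplex ?\<phi> (insert p t) \<subseteq> open_simplex \<phi> (t \<union> \<sigma>)"
    if "t \<union> \<sigma> \<in> K" for t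
    by (rule open_simplex_stellar_subset) (use that D(6)[OF that] ne p in auto)
  show ?thesis unfolding draws_def
  proof (intro conjI ballI impI)
    show "indep ?\<phi> s" if "s \<in> ?K" for s
      using that p
    proof (cases rule: stellar_cases)
      case old
      then show ?thesis using i[of s] by (metis fun_upd_other indep_cong)
    next
      case (new t)
      have "finite (t \<union> \<sigma>)" using new D(6) by blast
      then show ?thesis unfolding new(1)
        by (intro indep_stellar[OF i[OF new(3)]]) (use new in auto)
    qed
    show "open_simplex ?\<phi> s \<inter> open_simplex ?\<phi> t = {}" if st: "s \<in> ?K" "t \<in> ?K" "s \<noteq> t" for s t
    proof (rule ccontr)
      assume "open_simplex ?\<phi> s \<inter> open_simplex ?\<phi> t \<noteq> {}"
      then obtain x where x: "x \<in> open_simplex ?\<phi> s" "x \<in> open_simplex ?\<phi> t" by auto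
      show False using st(1) p
      proof (cases rule: stellar_cases)
        case s: old
        show False using st(2) p
        proof (cases rule: stellar_cases)
          case t: old
          show False using dj[OF s(1) t(1)] x old_eq[OF s(3)] old_eq[OF t(3)] st(3) by auto
        next
          case (new t')
          then have "x \<in> open_simplex \<phi> (t' \<union> \<sigma>)" using new_sub x by auto
          then have "s = t' \<union> \<sigma>" using dj[OF s(1) new(3)] x old_eq[OF s(3)] by auto
          then show False using s by auto
        qed
      next
        case s: (new s')
        then have xs: "x \<in> open_simplex \<phi> (s' \<union> \<sigma>)" using new_sub x by auto
        show False using st(2) p
        proof (cases rule: stellar_cases)
          case t: old
          then have "t = s' \<union> \<sigma>" using dj[OF t(1) s(3)] x old_eq[OF t(3)] xs by auto
          then show False using t by auto
        next
          case t: (new t')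
          then have "x \<in> open_simplex \<phi> (t' \<union> \<sigma>)" using new_sub x by auto
          then have eq: "s' \<union> \<sigma> = t' \<union> \<sigma>" using dj[OF s(3) t(3)] xs by auto
          have "s' = t'"
            by (rule open_simplex_stellar_disjoint[OF i[OF s(3)] _ ne s(5) refl s(4) eq t(4)])
              (use x s t D(6) in auto)
          then show False using st(3) s t by simp
        qed
      qed
    qed
    have "(\<Union>s\<in>?K. open_simplex ?\<phi> s) = (\<Union>s\<in>K. open_simplex \<phi> s)"
    proof
      show "(\<Union>s\<in>?K. open_simplex ?\<phi> s) \<subseteq> (\<Union>s\<in>K. open_simplex \<phi> s)"
      proof (rule UN_least)
        fix s assume "s \<in> ?K"
        then show "open_simplex ?\<phi> s \<subseteq> (\<Union>s\<in>K. open_simplex \<phi> s)" using p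
        proof (cases rule: stellar_cases)
          case old
          then show ?thesis using old_eq by auto
        next
          case (new t)
          then show ?thesis using new_sub[OF new(3)] by auto
        qed
      qed
      show "(\<Union>s\<in>K. open_simplex \<phi> s) \<subseteq> (\<Union>s\<in>?K. open_simplex ?\<phi> s)"
      proof (rule UN_least)
        fix s assume s: "s \<in> K"
        then have ps: "p \<notin> s" using p by auto
        show "open_simplex \<phi> s \<subseteq> (\<Union>s\<in>?K. open_simplex ?\<phi> s)"
        proof (cases "\<sigma> \<subseteq> s")
          case False
          then have "s \<in> ?K" using s by (auto simp: stellar_def)
          then show ?thesis using old_eq[OF ps] by auto
        next
          case True
          show ?thesis
          proof
            fix x assume "x \<in> open_simplex \<phi> s"
            then obtain t where t: "t \<union> \<sigma> = s" "\<not> \<sigma> \<subseteq> t" "x \<in> open_simplex ?\<phi> (insert p t)"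
              by (rule open_simplex_stellar_cover[OF D(6)[OF s] ne True ps])
            then have "insert p t \<in> ?K" using s unfolding stellar_def by auto
            then show "x \<in> (\<Union>s\<in>?K. open_simplex ?\<phi> s)" using t by auto
          qed
        qed
      qed
    qed
    moreover have "?\<phi> ` B = \<phi> ` B" using p D(10) by (intro image_cong) auto
    ultimately show "(\<Union>s\<in>?K. open_simplex ?\<phi> s) = convex hull (?\<phi> ` B)" using U by simp
  qed
qed

section \<open>Straight-line triangulations\<close>

text \<open>Barycentric coordinates with respect to \<open>S\<close> are unique, and their support
  is the face. This starts the subdivisions: it shows that a single triangle is properly
  drawn.\<close>

lemma open_simplex_disjoint_faces:
  assumes "indep \<phi> S" "finite S" "s \<subseteq> S" "t \<subseteq> S" "x \<in> open_simplex \<phi> s" "x \<in> open_simplex \<phi> t"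
  shows "s = t"
proof -
  have ext: "\<exists>w. (\<forall>i\<in>S. 0 \<le> w i) \<and> sum w S = 1 \<and> (\<Sum>i\<in>S. w i *\<^sub>R \<phi> i) = x \<and> {i\<in>S. w i \<noteq> 0} = s"
    if s: "s \<subseteq> S" "x \<in> open_simplex \<phi> s" for s
  proof -
    obtain w where w: "\<And>i. i \<in> s \<Longrightarrow> 0 < w i" "sum w s = 1" "x = (\<Sum>i\<in>s. w i *\<^sub>R \<phi> i)"
      using s(2) by (rule open_simplexE) blast
    let ?w = "\<lambda>i. if i \<in> s then w i else 0"
    have "sum ?w S = sum w s"
      by (rule sum.mono_neutral_cong_right) (use s assms(2) in auto)
    moreover have "(\<Sum>i\<in>S. ?w i *\<^sub>R \<phi> i) = (\<Sum>i\<in>s. w i *\<^sub>R \<phi> i)"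
      by (rule sum.mono_neutral_cong_right) (use s assms(2) in auto)
    moreover have "w i \<noteq> 0" if "i \<in> s" for i using w(1)[OF that] by simp
    then have "{i\<in>S. ?w i \<noteq> 0} = s" using s(1) by auto
    moreover have "\<forall>i\<in>S. 0 \<le> ?w i" using w(1) by (simp add: less_imp_le)
    ultimately show ?thesis using w(2,3) by (intro exI[of _ ?w]) simp
  qed
  obtain w where w: "sum w S = 1" "(\<Sum>i\<in>S. w i *\<^sub>R \<phi> i) = x" "{i\<in>S. w i \<noteq> 0} = s"
    using ext[OF assms(3,5)] by (elim exE conjE) rule
  obtain v where v: "sum v S = 1" "(\<Sum>i\<in>S. v i *\<^sub>R \<phi> i) = x" "{i\<in>S. v i \<noteq> 0} = t"
    using ext[OF assms(4,6)] by (elim exE conjE) rule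
  have "w i = v i" if "i \<in> S" for i
    by (rule indep_unique[OF assms(1) _ _ that]) (use w v in simp_all)
  then have "{i\<in>S. w i \<noteq> 0} = {i\<in>S. v i \<noteq> 0}" by auto
  then show ?thesis using w v by simp
qed

lemma open_simplex_triangle:
  fixes \<phi> :: "'a \<Rightarrow> complex"
  assumes "indep \<phi> f" "card f = 3"
  shows "open_simplex \<phi> f = interior (convex hull (\<phi> ` f))" "open_simplex \<phi> f \<noteq> {}"
proof -
  have f: "finite f" using assms(2) card.infinite by fastforce
  have inj: "inj_on \<phi> f" by (rule indep_imp_inj[OF assms(1) f])
  have "card (\<phi> ` f) = 3" using card_image[OF inj] assms(2) by simp
  then show "open_simplex \<phi> f = interior (convex hull (\<phi> ` f))"
    using interior_convex_hull_explicit_minimal[OF indep_imp_not_affine_dependent[OF assms(1) f]]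
      open_simplex_image[OF inj] by simp
  have "(\<Sum>i\<in>f. (1/3::real) *\<^sub>R \<phi> i) \<in> open_simplex \<phi> f"
    by (rule open_simplexI[of _ "\<lambda>_. 1/3"]) (use assms(2) in simp_all)
  then show "open_simplex \<phi> f \<noteq> {}" by blast
qed

lemma card3_obtain:
  assumes "card f = 3"
  obtains u v w where "f = {u, v, w}" "u \<noteq> v" "v \<noteq> w" "u \<noteq> w"
  using assms unfolding card_3_iff by blast

lemma draws_plane_triangulation:
  fixes \<phi> :: "'a \<Rightarrow> complex"
  assumes K: "disc_complex B K" and d: "draws B K \<phi>"
  defines "V \<equiv> \<Union>K" and "E \<equiv> {e\<in>K. card e = 2}"
  defines "A \<equiv> (\<lambda>e. convex hull (\<phi> ` e)) ` E"
  shows "inj_on \<phi> V" "plane_triangulation (\<phi> ` V) A"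
    "graph_of (\<phi> ` V) A = (\<phi> ` V, (`) \<phi> ` E)"
proof -
  note D = disc_complexD[OF K]
  have i: "indep \<phi> s" if "s \<in> K" for s using d that unfolding draws_def by blast
  have dj: "s = t" if "s \<in> K" "t \<in> K" "x \<in> open_simplex \<phi> s" "x \<in> open_simplex \<phi> t" for s t x
    using d that unfolding draws_def by blast
  have U: "(\<Union>s\<in>K. open_simplex \<phi> s) = convex hull (\<phi> ` B)"
    using d unfolding draws_def by (elim conjE)
  have single: "{v} \<in> K" if "v \<in> V" for v
  proof -
    obtain s where "s \<in> K" "v \<in> s" using \<open>v \<in> V\<close> unfolding V_def by blast
    then show ?thesis by (intro D(8)[of s "{v}"]) simp_all
  qed
  have finV: "finite V" unfolding V_def using D(1,6) by (rule finite_Union)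
  have finE: "finite E" unfolding E_def using D(1) by simp
  show inj: "inj_on \<phi> V"
  proof (rule inj_onI)
    fix u v assume "u \<in> V" "v \<in> V" "\<phi> u = \<phi> v"
    then have "{u} = {v}" by (intro dj[OF single single, of u v "\<phi> u"]) simp_all
    then show "u = v" by simp
  qed
  have EV: "e \<subseteq> V" if "e \<in> E" for e using that unfolding E_def V_def by blast
  have hull: "convex hull (\<phi> ` e) = open_simplex \<phi> e \<union> \<phi> ` e" if e: "e \<in> E" for e
  proof -
    obtain u v where uv: "e = {u, v}" "u \<noteq> v" using e unfolding E_def card_2_iff by blast
    have "Pow e - {{}} = {{u}, {v}, e}" using uv by auto
    moreover have "inj_on \<phi> e" using inj EV[OF e] inj_on_subset by blast
    ultimately show ?thesis
      using convex_hull_eq_Union_open_simplex[of e \<phi>] uv by auto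
  qed
  have capV: "convex hull (\<phi> ` e) \<inter> \<phi> ` V = \<phi> ` e" if e: "e \<in> E" for e
  proof
    show "\<phi> ` e \<subseteq> convex hull (\<phi> ` e) \<inter> \<phi> ` V" using hull[OF e] EV[OF e] by blast
    show "convex hull (\<phi> ` e) \<inter> \<phi> ` V \<subseteq> \<phi> ` e"
    proof
      fix x assume x: "x \<in> convex hull (\<phi> ` e) \<inter> \<phi> ` V"
      then obtain w where w: "w \<in> V" "x = \<phi> w" by blast
      have "x \<notin> open_simplex \<phi> e"
      proof
        assume "x \<in> open_simplex \<phi> e"
        then have "e = {w}" using dj[OF _ single[OF w(1)], of e x] e w(2) unfolding E_def by simp
        then show False using e unfolding E_def by simp
      qed
      then show "x \<in> \<phi> ` e" using x hull[OF e] by blast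
    qed
  qed
  have seg: "convex hull (\<phi> ` {u, v}) = closed_segment (\<phi> u) (\<phi> v)" for u v
    by (simp add: segment_convex_hull)
  have pg: "plane_graph (\<phi> ` V) A"
    unfolding plane_graph_def
  proof (intro conjI ballI impI)
    show "finite (\<phi> ` V)" "finite A" using finV finE unfolding A_def by simp_all
  next
    fix a assume "a \<in> A"
    then obtain e where e: "e \<in> E" "a = convex hull (\<phi> ` e)" unfolding A_def by blast
    obtain u v where uv: "e = {u, v}" "u \<noteq> v" using e(1) unfolding E_def card_2_iff by blast
    have "\<phi> u \<noteq> \<phi> v" using inj EV[OF e(1)] uv unfolding inj_on_def by blast
    then have "arc (linepath (\<phi> u) (\<phi> v))" by (rule arc_linepath)
    moreover have "path_image (linepath (\<phi> u) (\<phi> v)) = a" using e(2) uv seg by simp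
    moreover have "a \<inter> \<phi> ` V = {pathstart (linepath (\<phi> u) (\<phi> v)), pathfinish (linepath (\<phi> u) (\<phi> v))}"
      using capV[OF e(1)] e(2) uv by simp
    ultimately show "\<exists>g. arc g \<and> path_image g = a \<and> a \<inter> \<phi> ` V = {pathstart g, pathfinish g}" by blast
  next
    fix a b assume ab: "a \<in> A" "b \<in> A" "a \<noteq> b"
    then obtain e f where e: "e \<in> E" "a = convex hull (\<phi> ` e)" and f: "f \<in> E" "b = convex hull (\<phi> ` f)"
      unfolding A_def by blast
    show "a \<inter> \<phi> ` V \<noteq> b \<inter> \<phi> ` V" using capV[OF e(1)] capV[OF f(1)] e f ab(3) by auto
    show "a \<inter> b \<subseteq> \<phi> ` V"
    proof (rule subsetI, rule ccontr)
      fix x assume x: "x \<in> a \<inter> b" "x \<notin> \<phi> ` V"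
      have "x \<in> open_simplex \<phi> e" "x \<in> open_simplex \<phi> f"
        using x hull[OF e(1)] hull[OF f(1)] e f EV[OF e(1)] EV[OF f(1)] by blast+
      then have "e = f" by (intro dj) (use e f in \<open>simp_all add: E_def\<close>)
      then show False using e f ab(3) by simp
    qed
  qed
  let ?S = "\<phi> ` V \<union> \<Union>A"
  let ?F = "{f\<in>K. card f = 3}"
  let ?H = "convex hull (\<phi> ` B)"
  have finB: "finite (\<phi> ` B)" using D(3) by simp
  have cards: "card s = 1 \<or> card s = 2 \<or> card s = 3" if "s \<in> K" for s
  proof -
    have "card s \<noteq> 0" using D(5,6)[OF that] by simp
    then show ?thesis using D(7)[OF that] by linarith
  qed
  \<comment> \<open>The drawing is the union of the open simplices with at most two vertices. Its
    complement is the rest of the partition: the open triangles and the outside of the hull.\<close>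
  have skel: "x \<in> ?S \<longleftrightarrow> (\<exists>s\<in>K. card s \<le> 2 \<and> x \<in> open_simplex \<phi> s)" for x
  proof
    assume "x \<in> ?S"
    then consider v where "v \<in> V" "x = \<phi> v" | e where "e \<in> E" "x \<in> convex hull (\<phi> ` e)"
      unfolding A_def by blast
    then show "\<exists>s\<in>K. card s \<le> 2 \<and> x \<in> open_simplex \<phi> s"
    proof cases
      case 1
      then show ?thesis by (intro bexI[OF _ single]) simp_all
    next
      case 2
      then consider "x \<in> open_simplex \<phi> e" | v where "v \<in> e" "x = \<phi> v" using hull by blast
      then show ?thesis
      proof cases
        case 1
        then show ?thesis using 2(1) unfolding E_def by (intro bexI[of _ e]) simp_all
      next
        case (2 v)
        then show ?thesis using EV[OF \<open>e \<in> E\<close>] by (intro bexI[OF _ single[of v]]) auto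
      qed
    qed
  next
    assume "\<exists>s\<in>K. card s \<le> 2 \<and> x \<in> open_simplex \<phi> s"
    then obtain s where s: "s \<in> K" "card s \<le> 2" "x \<in> open_simplex \<phi> s" by blast
    consider "card s = 1" | "card s = 2" using cards[OF s(1)] s(2) by linarith
    then show "x \<in> ?S"
    proof cases
      case 1
      then obtain v where v: "s = {v}" by (rule card_1_singletonE)
      then have "v \<in> V" using s(1) unfolding V_def by blast
      then show ?thesis using v s(3) by simp
    next
      case 2
      then have "s \<in> E" using s(1) unfolding E_def by simp
      then show ?thesis using hull[of s] s(3) unfolding A_def by blast
    qed
  qed
  have UH: "x \<in> ?H \<longleftrightarrow> (\<exists>s\<in>K. x \<in> open_simplex \<phi> s)" for x
    unfolding U[symmetric] by blast
  have comps: "components (- ?S) = insert (- ?H) (open_simplex \<phi> ` ?F)"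
  proof (rule components_open_unique)
    show "pairwise disjnt (insert (- ?H) (open_simplex \<phi> ` ?F))"
    proof (rule pairwiseI)
      fix X Y assume XY: "X \<in> insert (- ?H) (open_simplex \<phi> ` ?F)" "Y \<in> insert (- ?H) (open_simplex \<phi> ` ?F)" "X \<noteq> Y"
      have a: "disjnt (open_simplex \<phi> f) (- ?H)" if "f \<in> ?F" for f
        using that UH unfolding disjnt_def by blast
      have b: "disjnt (open_simplex \<phi> f) (open_simplex \<phi> g)"
        if "f \<in> ?F" "g \<in> ?F" "open_simplex \<phi> f \<noteq> open_simplex \<phi> g" for f g
        using dj[of f g] that unfolding disjnt_def by blast
      consider "X = - ?H" "Y = - ?H"
        | f where "f \<in> ?F" "X = open_simplex \<phi> f" "Y = - ?H"
        | g where "g \<in> ?F" "X = - ?H" "Y = open_simplex \<phi> g"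
        | f g where "f \<in> ?F" "g \<in> ?F" "X = open_simplex \<phi> f" "Y = open_simplex \<phi> g"
        using XY(1,2) by blast
      then show "disjnt X Y"
      proof cases
        case 1
        then show ?thesis using XY(3) by simp
      next
        case (2 f)
        then show ?thesis using a by simp
      next
        case (3 g)
        show ?thesis unfolding 3(2,3) by (rule disjnt_sym[OF a[OF 3(1)]])
      next
        case (4 f g)
        then show ?thesis using b[OF 4(1,2)] XY(3) by simp
      qed
    qed
    show "\<Union> (insert (- ?H) (open_simplex \<phi> ` ?F)) = - ?S"
    proof (rule set_eqI)
      fix x
      have "x \<in> \<Union> (insert (- ?H) (open_simplex \<phi> ` ?F)) \<longleftrightarrow>
          x \<notin> ?H \<or> (\<exists>f\<in>K. card f = 3 \<and> x \<in> open_simplex \<phi> f)" by blast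
      also have "\<dots> \<longleftrightarrow> \<not> (\<exists>s\<in>K. card s \<le> 2 \<and> x \<in> open_simplex \<phi> s)"
      proof
        assume L: "x \<notin> ?H \<or> (\<exists>f\<in>K. card f = 3 \<and> x \<in> open_simplex \<phi> f)"
        show "\<not> (\<exists>s\<in>K. card s \<le> 2 \<and> x \<in> open_simplex \<phi> s)"
        proof
          assume "\<exists>s\<in>K. card s \<le> 2 \<and> x \<in> open_simplex \<phi> s"
          then obtain s where s: "s \<in> K" "card s \<le> 2" "x \<in> open_simplex \<phi> s" by blast
          then obtain f where f: "f \<in> K" "card f = 3" "x \<in> open_simplex \<phi> f" using L UH by blast
          then have "s = f" using dj s by blast
          then show False using s f by simp
        qed
      next
        assume R: "\<not> (\<exists>s\<in>K. card s \<le> 2 \<and> x \<in> open_simplex \<phi> s)"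
        show "x \<notin> ?H \<or> (\<exists>f\<in>K. card f = 3 \<and> x \<in> open_simplex \<phi> f)"
        proof (cases "x \<in> ?H")
          case True
          then obtain s where s: "s \<in> K" "x \<in> open_simplex \<phi> s" using UH by blast
          then have "\<not> card s \<le> 2" using R by blast
          then have "card s = 3" using cards[OF s(1)] by linarith
          then show ?thesis using s by blast
        qed simp
      qed
      also have "\<dots> \<longleftrightarrow> x \<in> - ?S" by (simp only: Compl_iff skel)
      finally show "x \<in> \<Union> (insert (- ?H) (open_simplex \<phi> ` ?F)) \<longleftrightarrow> x \<in> - ?S" .
    qed
    fix X assume "X \<in> insert (- ?H) (open_simplex \<phi> ` ?F)"
    then consider "X = - ?H" | f where "f \<in> K" "card f = 3" "X = open_simplex \<phi> f" by blast
    then show "open X \<and> connected X \<and> X \<noteq> {}"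
    proof cases
      case 1
      have c: "compact ?H" using finB by (simp add: compact_convex_hull finite_imp_compact)
      have "open X" using compact_imp_closed[OF c] 1 by (simp add: open_Compl)
      moreover have "connected X"
        unfolding 1 by (rule connected_complement_bounded_convex) (use compact_imp_bounded[OF c] in auto)
      moreover have "?H \<noteq> UNIV" using compact_imp_bounded[OF c] not_bounded_UNIV by metis
      ultimately show ?thesis using 1 by auto
    next
      case (2 f)
      have "open X \<and> connected X"
        unfolding 2(3) open_simplex_triangle(1)[OF i[OF 2(1)] 2(2)]
        by (simp add: convex_connected convex_interior)
      then show ?thesis using open_simplex_triangle(2)[OF i[OF 2(1)] 2(2)] 2(3) by simp
    qed
  qed
  \<comment> \<open>Formulated for \<open>f\<close> with its edges in \<open>K\<close>, but not for
    \<open>f\<close> in \<open>K\<close>, so that it also serves the outer face: \<open>B\<close>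
    need not be a simplex of \<open>K\<close>, while its edges are.\<close>
  have bt: "bounded_by_triangle (\<phi> ` V) A F"
    if f: "card f = 3" "\<And>e. e \<subseteq> f \<Longrightarrow> card e = 2 \<Longrightarrow> e \<in> K" and F: "frontier F = frontier (convex hull (\<phi> ` f))" for f F
  proof -
    obtain u v w where uvw: "f = {u, v, w}" "u \<noteq> v" "v \<noteq> w" "u \<noteq> w" using f(1) by (rule card3_obtain)
    have e: "{u, v} \<in> E" "{v, w} \<in> E" "{u, w} \<in> E" unfolding E_def using f(2) uvw by simp_all
    have V: "u \<in> V" "v \<in> V" "w \<in> V" using EV[OF e(1)] EV[OF e(2)] by simp_all
    have "\<phi> u \<noteq> \<phi> v" "\<phi> v \<noteq> \<phi> w" "\<phi> u \<noteq> \<phi> w" using inj V uvw(2-4) unfolding inj_on_def by blast+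
    moreover have "frontier F = convex hull (\<phi> ` {u, v}) \<union> convex hull (\<phi> ` {v, w}) \<union> convex hull (\<phi> ` {u, w})"
      unfolding F uvw(1) seg using frontier_of_triangle[of "\<phi> u" "\<phi> v" "\<phi> w"]
      by (simp add: closed_segment_commute)
    moreover have "{convex hull (\<phi> ` {u, v}), convex hull (\<phi> ` {v, w}), convex hull (\<phi> ` {u, w})} \<subseteq> A"
      unfolding A_def using e by blast
    ultimately show ?thesis unfolding bounded_by_triangle_def
      using capV[OF e(1)] capV[OF e(2)] capV[OF e(3)]
      by (intro exI[of _ "\<phi> u"] exI[of _ "\<phi> v"] exI[of _ "\<phi> w"] exI[of _ "convex hull (\<phi> ` {u, v})"]
        exI[of _ "convex hull (\<phi> ` {v, w})"] exI[of _ "convex hull (\<phi> ` {u, w})"] conjI) simp_all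
  qed
  show "plane_triangulation (\<phi> ` V) A"
    unfolding plane_triangulation_def faces_def comps
  proof (intro conjI ballI pg)
    fix X assume "X \<in> insert (- ?H) (open_simplex \<phi> ` ?F)"
    then consider "X = - ?H" | f where "f \<in> K" "card f = 3" "X = open_simplex \<phi> f" by blast
    then show "bounded_by_triangle (\<phi> ` V) A X"
    proof cases
      case 1
      show ?thesis
      proof (rule bt[OF D(2)])
        show "e \<in> K" if "e \<subseteq> B" "card e = 2" for e
          by (rule D(4)) (use that D(2) in auto)
        show "frontier X = frontier ?H" unfolding 1 by (rule frontier_complement)
      qed
    next
      case (2 f)
      show ?thesis
      proof (rule bt[OF 2(2)])
        show "e \<in> K" if "e \<subseteq> f" "card e = 2" for e
          by (rule D(8)[OF 2(1)]) (use that in auto)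
        have ne: "interior (convex hull (\<phi> ` f)) \<noteq> {}"
          using open_simplex_triangle[OF i[OF 2(1)] 2(2)] by simp
        show "frontier X = frontier (convex hull (\<phi> ` f))"
          unfolding 2(3) open_simplex_triangle(1)[OF i[OF 2(1)] 2(2)] frontier_def
          by (simp add: convex_closure_interior[OF convex_convex_hull ne])
      qed
    qed
  qed
  have "(\<lambda>e. e \<inter> \<phi> ` V) ` A = (`) \<phi> ` E"
    unfolding A_def image_image by (intro image_cong refl capV)
  then show "graph_of (\<phi> ` V) A = (\<phi> ` V, (`) \<phi> ` E)" unfolding graph_of_def by simp
qed

text \<open>\<open>G\<close> need not contain all bounded faces: forgetting faces keeps later statements short.\<close>

definition plane_tri :: "'a set \<Rightarrow> 'a set set \<Rightarrow> 'a set set \<Rightarrow> bool" where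
  "plane_tri V E G \<longleftrightarrow> (\<exists>B K (\<phi>::'a \<Rightarrow> complex). disc_complex B K \<and> draws B K \<phi> \<and>
     V = \<Union>K \<and> E = {e\<in>K. card e = 2} \<and> G \<subseteq> {f\<in>K. card f = 3})"

lemma plane_triE:
  assumes "plane_tri V E G"
  obtains B K and \<phi> :: "'a \<Rightarrow> complex" where "disc_complex B K" "draws B K \<phi>"
    "V = \<Union>K" "E = {e\<in>K. card e = 2}" "G \<subseteq> {f\<in>K. card f = 3}"
  using assms unfolding plane_tri_def by (elim exE conjE) rule

lemma plane_tri_realize:
  assumes "plane_tri V E G"
  obtains A and \<phi> :: "'a \<Rightarrow> complex" where "inj_on \<phi> V" "plane_triangulation (\<phi> ` V) A"
    "graph_of (\<phi> ` V) A = (\<phi> ` V, (`) \<phi> ` E)"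
proof -
  obtain B K and \<phi> :: "'a \<Rightarrow> complex" where K: "disc_complex B K" "draws B K \<phi>"
    "V = \<Union>K" "E = {e\<in>K. card e = 2}"
    using assms by (rule plane_triE)
  show ?thesis by (rule that[OF draws_plane_triangulation[OF K(1,2), folded K(3,4)]])
qed

lemma plane_tri_finite:
  assumes "plane_tri V E G"
  shows "finite V" "finite E" "\<And>e. e \<in> E \<Longrightarrow> e \<subseteq> V \<and> card e = 2"
proof -
  obtain B K and \<phi> :: "'a \<Rightarrow> complex" where K: "disc_complex B K" "V = \<Union>K" "E = {e\<in>K. card e = 2}"
    using assms by (rule plane_triE)
  show "finite V" unfolding K(2) using disc_complexD(1,6)[OF K(1)] by (rule finite_Union)
  show "finite E" unfolding K(3) using disc_complexD(1)[OF K(1)] by simp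
  show "e \<subseteq> V \<and> card e = 2" if "e \<in> E" for e using that unfolding K(2,3) by blast
qed

lemma plane_tri_face:
  assumes "plane_tri V E G" "f \<in> G"
  shows "f \<subseteq> V" "card f = 3" "\<And>e. e \<subseteq> f \<Longrightarrow> card e = 2 \<Longrightarrow> e \<in> E"
proof -
  obtain B K and \<phi> :: "'a \<Rightarrow> complex" where K: "disc_complex B K" "V = \<Union>K" "E = {e\<in>K. card e = 2}"
      "G \<subseteq> {f\<in>K. card f = 3}"
    using assms(1) by (rule plane_triE)
  have f: "f \<in> K" "card f = 3" using assms(2) K(4) by blast+
  show "f \<subseteq> V" using f K(2) by blast
  show "card f = 3" by (rule f)
  show "e \<in> E" if "e \<subseteq> f" "card e = 2" for e
  proof -
    have "e \<in> K" by (rule disc_complexD(8)[OF K(1) f(1)]) (use that in auto)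
    then show ?thesis using K(3) that by simp
  qed
qed

lemma plane_tri_mono:
  assumes "plane_tri V E G" "G' \<subseteq> G"
  shows "plane_tri V E G'"
proof -
  obtain B K and \<phi> :: "'a \<Rightarrow> complex" where K: "disc_complex B K" "draws B K \<phi>" "V = \<Union>K"
      "E = {e\<in>K. card e = 2}" "G \<subseteq> {f\<in>K. card f = 3}"
    using assms(1) by (rule plane_triE)
  have "G' \<subseteq> {f\<in>K. card f = 3}" using assms(2) K(5) by (rule subset_trans)
  with K(1-4) show ?thesis unfolding plane_tri_def by (intro exI conjI)
qed

lemma plane_tri_triangle:
  fixes a b c :: 'a
  assumes "a \<noteq> b" "b \<noteq> c" "a \<noteq> c"
  shows "plane_tri {a, b, c} {{a, b}, {b, c}, {a, c}} {{a, b, c}}"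
proof -
  define \<phi> :: "'a \<Rightarrow> complex" where "\<phi> = (\<lambda>x. if x = a then 0 else if x = b then 1 else \<i>)"
  let ?B = "{a, b, c}"
  let ?K = "Pow ?B - {{}}"
  have B: "finite ?B" "card ?B = 3" using assms by simp_all
  have sub: "finite s \<and> s \<subseteq> ?B" if "s \<in> ?K" for s
    using that finite_subset[OF _ B(1)] by blast
  have "disc_complex ?B ?K"
    unfolding disc_complex_def
  proof (intro conjI ballI allI impI)
    show "finite ?K" "card ?B = 3" using B by simp_all
    show "s \<noteq> {}" "finite s" "card s \<le> 3" if "s \<in> ?K" for s
    proof -
      show "s \<noteq> {}" "finite s" using that sub[OF that] by simp_all
      show "card s \<le> 3" using card_mono[OF B(1), of s] B(2) sub[OF that] by simp
    qed
    show "card (link ?K e) \<le> (if e \<subseteq> ?B then 1 else 2)" if e: "e \<in> ?K" "card e = 2" for e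
    proof -
      have "link ?K e \<subseteq> ?B - e" unfolding link_def by blast
      then have "card (link ?K e) \<le> card (?B - e)" by (rule card_mono[rotated]) simp
      also have "\<dots> = 1" using card_Diff_subset[of e ?B] sub[OF e(1)] e(2) B(2) by simp
      finally show ?thesis using sub[OF e(1)] by simp
    qed
    show "t \<in> ?K" if "t \<noteq> {}" "t \<subset> ?B" for t using that by blast
    show "t \<in> ?K" if "s \<in> ?K" "t \<subseteq> s" "t \<noteq> {}" for s t using that by blast
  qed
  moreover have ind: "indep \<phi> ?B"
    unfolding indep_def
  proof (intro allI impI)
    fix w assume w: "sum w ?B = 0" "(\<Sum>i\<in>?B. w i *\<^sub>R \<phi> i) = 0"
    have "w b *\<^sub>R (1::complex) + w c *\<^sub>R \<i> = 0" using w(2) assms by (simp add: \<phi>_def)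
    then have "w b = 0" "w c = 0" by (simp_all add: complex_eq_iff)
    then show "\<forall>i\<in>?B. w i = 0" using w(1) assms by simp
  qed
  have "draws ?B ?K \<phi>"
    unfolding draws_def
  proof (intro conjI ballI impI)
    show "indep \<phi> s" if "s \<in> ?K" for s
      using indep_subset[OF ind _ B(1)] sub[OF that] by simp
    show "open_simplex \<phi> s \<inter> open_simplex \<phi> t = {}" if "s \<in> ?K" "t \<in> ?K" "s \<noteq> t" for s t
      using open_simplex_disjoint_faces[OF ind B(1), of s t] sub[OF that(1)] sub[OF that(2)] that(3) by blast
    show "(\<Union>s\<in>?K. open_simplex \<phi> s) = convex hull (\<phi> ` ?B)"
      by (rule convex_hull_eq_Union_open_simplex[symmetric, OF B(1) indep_imp_inj[OF ind B(1)]])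
  qed
  moreover have "{a, b, c} = \<Union>?K" by blast
  moreover have "{{a, b}, {b, c}, {a, c}} = {e\<in>?K. card e = 2}"
  proof
    show "{{a, b}, {b, c}, {a, c}} \<subseteq> {e\<in>?K. card e = 2}" using assms by simp
    show "{e\<in>?K. card e = 2} \<subseteq> {{a, b}, {b, c}, {a, c}}"
    proof
      fix e assume "e \<in> {e\<in>?K. card e = 2}"
      then obtain x y where "e = {x, y}" "x \<noteq> y" "x \<in> ?B" "y \<in> ?B" by (auto simp: card_2_iff)
      then show "e \<in> {{a, b}, {b, c}, {a, c}}" by (elim insertE) (auto simp: insert_commute)
    qed
  qed
  moreover have "{{a, b, c}} \<subseteq> {f\<in>?K. card f = 3}" using B by simp
  ultimately show ?thesis unfolding plane_tri_def by (intro exI conjI)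
qed

text \<open>The common part of placing a vertex into a triangle and onto an edge. In
  \<open>insert a \<sigma> \<in> K\<close> the vertex \<open>a\<close> is a vertex of
  \<open>\<sigma>\<close> or an apex over it; these are the neighbours of \<open>p\<close>.\<close>

lemma plane_tri_stellar:
  assumes K: "disc_complex B K" "draws B K \<phi>" and \<sigma>: "\<sigma> \<in> K" "2 \<le> card \<sigma>" "\<not> \<sigma> \<subset> B" and p: "p \<notin> \<Union>K"
  shows "plane_tri (insert p (\<Union>K))
    ({e\<in>K. card e = 2 \<and> e \<noteq> \<sigma>} \<union> {{p, a} | a. insert a \<sigma> \<in> K})
    ({f\<in>K. card f = 3 \<and> \<not> \<sigma> \<subseteq> f} \<union> {{p, a, b} | a b. a \<noteq> b \<and> {a, b} \<union> \<sigma> \<in> K \<and> \<not> \<sigma> \<subseteq> {a, b}})"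
proof -
  note D = disc_complexD[OF K(1)]
  let ?K = "stellar \<sigma> p K"
  have f\<sigma>: "finite \<sigma>" using D(6) \<sigma>(1) by blast
  have ne: "\<sigma> \<noteq> {}" using \<sigma>(2) by auto
  have nsub: "\<not> \<sigma> \<subseteq> {a}" for a
  proof
    assume "\<sigma> \<subseteq> {a}"
    then have "card \<sigma> \<le> card {a}" by (rule card_mono[rotated]) simp
    then show False using \<sigma>(2) by simp
  qed
  have "disc_complex B ?K" by (rule disc_complex_stellar[OF K(1) \<sigma> p])
  moreover have "draws B ?K (\<phi>(p := barycenter \<phi> \<sigma>))" by (rule draws_stellar[OF K \<sigma>(1) p])
  moreover have "insert p (\<Union>K) = \<Union>?K"
  proof
    show "insert p (\<Union>K) \<subseteq> \<Union>?K"
    proof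
      fix x assume "x \<in> insert p (\<Union>K)"
      then consider "x = p" | s where "x \<in> s" "s \<in> K" by blast
      then show "x \<in> \<Union>?K"
      proof cases
        case 1
        have "insert p {} \<in> ?K" unfolding stellar_def using \<sigma>(1) ne by (intro UnI2 CollectI exI[of _ "{}"]) simp
        then show ?thesis using 1 by blast
      next
        case 2
        then have "{x} \<in> K" by (intro D(8)[OF 2(2)]) simp_all
        then have "{x} \<in> ?K" unfolding stellar_def using nsub by blast
        then show ?thesis by blast
      qed
    qed
    show "\<Union>?K \<subseteq> insert p (\<Union>K)" unfolding stellar_def by blast
  qed
  moreover have "{e\<in>K. card e = 2 \<and> e \<noteq> \<sigma>} \<union> {{p, a} | a. insert a \<sigma> \<in> K} = {e\<in>?K. card e = 2}"
  proof (intro equalityI subsetI)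
    fix e assume "e \<in> {e\<in>K. card e = 2 \<and> e \<noteq> \<sigma>} \<union> {{p, a} | a. insert a \<sigma> \<in> K}"
    then consider "e \<in> K" "card e = 2" "e \<noteq> \<sigma>" | a where "e = {p, a}" "insert a \<sigma> \<in> K" by blast
    then show "e \<in> {e\<in>?K. card e = 2}"
    proof cases
      case 1
      have "\<not> \<sigma> \<subseteq> e"
      proof
        assume "\<sigma> \<subseteq> e"
        then have "\<sigma> = e" by (rule card_seteq[OF D(6)[OF 1(1)]]) (use 1(2) \<sigma>(2) in simp)
        then show False using 1(3) by simp
      qed
      then show ?thesis using 1 unfolding stellar_def by blast
    next
      case (2 a)
      have "{a} \<union> \<sigma> \<in> K" using 2(2) by simp
      then have "insert p {a} \<in> ?K" unfolding stellar_def using nsub by blast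
      moreover have "p \<noteq> a" using 2(2) p by blast
      ultimately show ?thesis using 2(1) by simp
    qed
  next
    fix e assume "e \<in> {e\<in>?K. card e = 2}"
    then have e: "e \<in> ?K" "card e = 2" by simp_all
    show "e \<in> {e\<in>K. card e = 2 \<and> e \<noteq> \<sigma>} \<union> {{p, a} | a. insert a \<sigma> \<in> K}"
      using e(1) p
    proof (cases rule: stellar_cases)
      case old
      then show ?thesis using e by blast
    next
      case (new t)
      have "finite t" using D(6)[OF new(3)] by simp
      then have "card t = 1" using e(2) new(1,2) by simp
      then obtain a where "t = {a}" by (rule card_1_singletonE)
      then have "e = {p, a}" "insert a \<sigma> \<in> K" using new(1,3) by simp_all
      then show ?thesis by blast
    qed
  qed
  moreover have "{f\<in>K. card f = 3 \<and> \<not> \<sigma> \<subseteq> f} \<union> {{p, a, b} | a b. a \<noteq> b \<and> {a, b} \<union> \<sigma> \<in> K \<and> \<not> \<sigma> \<subseteq> {a, b}}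
      \<subseteq> {f\<in>?K. card f = 3}"
  proof
    fix f assume "f \<in> {f\<in>K. card f = 3 \<and> \<not> \<sigma> \<subseteq> f} \<union> {{p, a, b} | a b. a \<noteq> b \<and> {a, b} \<union> \<sigma> \<in> K \<and> \<not> \<sigma> \<subseteq> {a, b}}"
    then consider "f \<in> K" "card f = 3" "\<not> \<sigma> \<subseteq> f"
      | a b where "f = {p, a, b}" "a \<noteq> b" "{a, b} \<union> \<sigma> \<in> K" "\<not> \<sigma> \<subseteq> {a, b}" by blast
    then show "f \<in> {f\<in>?K. card f = 3}"
    proof cases
      case 1
      then show ?thesis unfolding stellar_def by blast
    next
      case (2 a b)
      have "insert p {a, b} \<in> ?K" unfolding stellar_def using 2(3,4) by blast
      moreover have "p \<noteq> a" "p \<noteq> b" using 2(3) p by blast+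
      ultimately show ?thesis using 2(1,2) by simp
    qed
  qed
  ultimately show ?thesis unfolding plane_tri_def by (intro exI conjI)
qed

text \<open>Nothing in \<open>K\<close> lies properly above a triangle, so \<open>p\<close> is
  joined to the three corners only.\<close>

lemma plane_tri_stack:
  assumes T: "plane_tri V E G" and f: "{u, v, w} \<in> G" and p: "p \<notin> V"
  shows "plane_tri (insert p V) (E \<union> {{p, u}, {p, v}, {p, w}})
    (G - {{u, v, w}} \<union> {{p, u, v}, {p, v, w}, {p, u, w}})"
proof -
  obtain B K and \<phi> :: "'a \<Rightarrow> complex" where K: "disc_complex B K" "draws B K \<phi>" "V = \<Union>K"
      "E = {e\<in>K. card e = 2}" "G \<subseteq> {f\<in>K. card f = 3}"
    using T by (rule plane_triE)
  note D = disc_complexD[OF K(1)]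
  let ?s = "{u, v, w}"
  have s: "?s \<in> K" "card ?s = 3" using K(5) f by blast+
  have d: "u \<noteq> v" "v \<noteq> w" "u \<noteq> w" using s(2) by (auto simp: card_insert_if split: if_splits)
  have nB: "\<not> ?s \<subset> B" using psubset_card_mono[OF D(3), of ?s] D(2) s(2) by linarith
  have eq: "s = ?s" if "s \<in> K" "?s \<subseteq> s" for s
    using card_seteq[OF D(6)[OF that(1)] that(2)] D(7)[OF that(1)] s(2) by simp
  have T': "plane_tri (insert p (\<Union>K))
    ({e\<in>K. card e = 2 \<and> e \<noteq> ?s} \<union> {{p, a} | a. insert a ?s \<in> K})
    ({f\<in>K. card f = 3 \<and> \<not> ?s \<subseteq> f} \<union> {{p, a, b} | a b. a \<noteq> b \<and> {a, b} \<union> ?s \<in> K \<and> \<not> ?s \<subseteq> {a, b}})"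
    by (rule plane_tri_stellar[OF K(1,2) s(1) _ nB]) (use s(2) p K(3) in simp_all)
  have E: "{e\<in>K. card e = 2 \<and> e \<noteq> ?s} \<union> {{p, a} | a. insert a ?s \<in> K} = E \<union> {{p, u}, {p, v}, {p, w}}"
  proof -
    have "{e\<in>K. card e = 2 \<and> e \<noteq> ?s} = E" unfolding K(4) using s(2) by fastforce
    moreover have "insert a ?s \<in> K \<longleftrightarrow> a = u \<or> a = v \<or> a = w" for a
    proof
      assume "insert a ?s \<in> K"
      then have "insert a ?s = ?s" by (rule eq) blast
      then show "a = u \<or> a = v \<or> a = w" by blast
    next
      assume "a = u \<or> a = v \<or> a = w"
      then have "insert a ?s = ?s" by blast
      then show "insert a ?s \<in> K" using s(1) by simp
    qed
    ultimately show ?thesis by auto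
  qed
  have n: "\<not> ?s \<subseteq> {a, b}" for a b
  proof
    assume "?s \<subseteq> {a, b}"
    then have "card ?s \<le> card {a, b}" by (rule card_mono[rotated]) simp
    moreover have "card {a, b} \<le> 2" by (simp add: card_insert_if)
    ultimately show False using s(2) by linarith
  qed
  have G: "G - {?s} \<union> {{p, u, v}, {p, v, w}, {p, u, w}} \<subseteq>
    {f\<in>K. card f = 3 \<and> \<not> ?s \<subseteq> f} \<union> {{p, a, b} | a b. a \<noteq> b \<and> {a, b} \<union> ?s \<in> K \<and> \<not> ?s \<subseteq> {a, b}}"
  proof (intro Un_mono)
    show "G - {?s} \<subseteq> {f\<in>K. card f = 3 \<and> \<not> ?s \<subseteq> f}" using K(5) eq by blast
    have m: "{p, a, b} \<in> {{p, a, b} | a b. a \<noteq> b \<and> {a, b} \<union> ?s \<in> K \<and> \<not> ?s \<subseteq> {a, b}}"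
      if "a \<in> ?s" "b \<in> ?s" "a \<noteq> b" for a b
    proof -
      have "{a, b} \<union> ?s = ?s" using that by blast
      then have "{a, b} \<union> ?s \<in> K" using s(1) by simp
      then show ?thesis using n[of a b] that(3) by blast
    qed
    show "{{p, u, v}, {p, v, w}, {p, u, w}} \<subseteq>
        {{p, a, b} | a b. a \<noteq> b \<and> {a, b} \<union> ?s \<in> K \<and> \<not> ?s \<subseteq> {a, b}}"
      by (intro insert_subsetI m empty_subsetI) (use d in simp_all)
  qed
  show ?thesis using plane_tri_mono[OF T' G] unfolding E K(3) .
qed

text \<open>Two known faces at \<open>{u, v}\<close> show that it is no boundary edge, as such an
  edge has only one apex. The general bound of two apexes then shows that there are no other faces,
  so that \<open>p\<close> has exactly four neighbours.\<close>

lemma plane_tri_subdivide: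
  assumes T: "plane_tri V E G" and f: "{u, v, w} \<in> G" "{u, v, x} \<in> G" "w \<noteq> x" and p: "p \<notin> V"
  shows "plane_tri (insert p V) (E - {{u, v}} \<union> {{p, u}, {p, v}, {p, w}, {p, x}})
    (G - {{u, v, w}, {u, v, x}} \<union> {{p, u, w}, {p, v, w}, {p, u, x}, {p, v, x}})"
proof -
  obtain B K and \<phi> :: "'a \<Rightarrow> complex" where K: "disc_complex B K" "draws B K \<phi>" "V = \<Union>K"
      "E = {e\<in>K. card e = 2}" "G \<subseteq> {f\<in>K. card f = 3}"
    using T by (rule plane_triE)
  note D = disc_complexD[OF K(1)]
  let ?s = "{u, v}"
  have w: "{u, v, w} \<in> K" "card {u, v, w} = 3" and x: "{u, v, x} \<in> K" "card {u, v, x} = 3"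
    using K(5) f(1,2) by blast+
  have d: "u \<noteq> v" "v \<noteq> w" "u \<noteq> w" "v \<noteq> x" "u \<noteq> x"
    using w(2) x(2) by (auto simp: card_insert_if split: if_splits)
  have s: "?s \<in> K" "card ?s = 2" using D(8)[OF w(1), of ?s] d by auto
  have wl: "w \<in> link K ?s" "x \<in> link K ?s"
    using w(1) x(1) d unfolding link_def by (simp_all add: insert_commute)
  have c2: "card {w, x} = 2" using f(3) by simp
  have "card (link K ?s) \<ge> 2"
    using card_mono[OF finite_link[OF K(1), of ?s], of "{w, x}"] wl c2 by simp
  then have nB: "\<not> ?s \<subset> B" and c: "card (link K ?s) \<le> 2"
    using D(9)[OF s] by (auto split: if_splits)
  have lk: "link K ?s = {w, x}"
    by (rule card_seteq[symmetric, OF finite_link[OF K(1)]]) (use wl c c2 in simp_all)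
  have mem: "insert a ?s \<in> K \<longleftrightarrow> a \<in> {u, v, w, x}" for a
  proof (cases "a \<in> ?s")
    case True
    then have "insert a ?s = ?s" by blast
    then show ?thesis using True s(1) by auto
  next
    case False
    then have "insert a ?s \<in> K \<longleftrightarrow> a \<in> link K ?s" unfolding link_def by simp
    then show ?thesis using lk False by simp
  qed
  have T': "plane_tri (insert p (\<Union>K))
    ({e\<in>K. card e = 2 \<and> e \<noteq> ?s} \<union> {{p, a} | a. insert a ?s \<in> K})
    ({f\<in>K. card f = 3 \<and> \<not> ?s \<subseteq> f} \<union> {{p, a, b} | a b. a \<noteq> b \<and> {a, b} \<union> ?s \<in> K \<and> \<not> ?s \<subseteq> {a, b}})"
    by (rule plane_tri_stellar[OF K(1,2) s(1) _ nB]) (use s(2) p K(3) in simp_all)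
  have E: "{e\<in>K. card e = 2 \<and> e \<noteq> ?s} \<union> {{p, a} | a. insert a ?s \<in> K} = E - {{u, v}} \<union> {{p, u}, {p, v}, {p, w}, {p, x}}"
  proof -
    have "{{p, a} | a. a \<in> {u, v, w, x}} = (\<lambda>a. {p, a}) ` {u, v, w, x}" by (rule Setcompr_eq_image)
    moreover have "{e\<in>K. card e = 2 \<and> e \<noteq> ?s} = E - {?s}" unfolding K(4) by auto
    ultimately show ?thesis unfolding mem by simp
  qed
  have G: "G - {{u, v, w}, {u, v, x}} \<union> {{p, u, w}, {p, v, w}, {p, u, x}, {p, v, x}} \<subseteq>
    {f\<in>K. card f = 3 \<and> \<not> ?s \<subseteq> f} \<union> {{p, a, b} | a b. a \<noteq> b \<and> {a, b} \<union> ?s \<in> K \<and> \<not> ?s \<subseteq> {a, b}}"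
  proof (intro Un_mono)
    show "G - {{u, v, w}, {u, v, x}} \<subseteq> {f\<in>K. card f = 3 \<and> \<not> ?s \<subseteq> f}"
    proof
      fix g assume g: "g \<in> G - {{u, v, w}, {u, v, x}}"
      then have gK: "g \<in> K" "card g = 3" using K(5) by blast+
      have "\<not> ?s \<subseteq> g"
      proof
        assume sg: "?s \<subseteq> g"
        have "card (g - ?s) = 1" using card_Diff_subset[of ?s g] sg gK(2) s(2) by simp
        then obtain a where a: "g - ?s = {a}" by (rule card_1_singletonE)
        then have ga: "g = insert a ?s" "a \<notin> ?s" using sg by blast+
        then have "a = w \<or> a = x" using gK(1) mem[of a] by simp
        then show False using g ga(1) by (auto simp: insert_commute)
      qed
      then show "g \<in> {f\<in>K. card f = 3 \<and> \<not> ?s \<subseteq> f}" using gK by blast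
    qed
    have n: "{p, a, b} \<in> {{p, a, b} | a b. a \<noteq> b \<and> {a, b} \<union> ?s \<in> K \<and> \<not> ?s \<subseteq> {a, b}}"
      if "a \<in> ?s" "b \<in> {w, x}" for a b
    proof -
      have "b \<notin> ?s" using that(2) d by auto
      then have "a \<noteq> b" "\<not> ?s \<subseteq> {a, b}" using that(1) d(1) by auto
      moreover have "{a, b} \<union> ?s = insert b ?s" using that(1) by blast
      then have "{a, b} \<union> ?s \<in> K" using mem[of b] that(2) by simp
      ultimately show ?thesis by blast
    qed
    show "{{p, u, w}, {p, v, w}, {p, u, x}, {p, v, x}} \<subseteq>
        {{p, a, b} | a b. a \<noteq> b \<and> {a, b} \<union> ?s \<in> K \<and> \<not> ?s \<subseteq> {a, b}}"
      by (intro insert_subsetI n empty_subsetI) simp_all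
  qed
  show ?thesis using plane_tri_mono[OF T' G] unfolding E K(3) .
qed

section \<open>Live and dead vertices\<close>

definition spokes :: "'a set \<Rightarrow> 'a set \<Rightarrow> 'a set set" where
  "spokes W Z = {{w, z} | w z. w \<in> W \<and> z \<in> Z}"

lemma spokesI: "w \<in> W \<Longrightarrow> z \<in> Z \<Longrightarrow> {w, z} \<in> spokes W Z"
  unfolding spokes_def by blast

lemma spokesE:
  assumes "e \<in> spokes W Z"
  obtains w z where "e = {w, z}" "w \<in> W" "z \<in> Z"
  using assms unfolding spokes_def by blast

lemma spokes_mono: "W \<subseteq> W' \<Longrightarrow> Z \<subseteq> Z' \<Longrightarrow> spokes W Z \<subseteq> spokes W' Z'"
  unfolding spokes_def by blast

lemma not_in_spokes:
  assumes "u \<in> W" "v \<in> W" "W \<inter> Z = {}"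
  shows "{u, v} \<notin> spokes W Z"
proof
  assume "{u, v} \<in> spokes W Z"
  then obtain w z where wz: "{u, v} = {w, z}" "z \<in> Z" by (rule spokesE)
  have "z \<in> {u, v}" unfolding wz(1) by simp
  then show False using assms wz(2) by blast
qed

text \<open>\<open>W\<close> and \<open>Z\<close> are the live and the dead vertices and \<open>L\<close> is the exact set of edges between live
  vertices; of the remaining edges only their kind matters.\<close>

definition live_tri :: "'a set \<Rightarrow> 'a set set \<Rightarrow> 'a set \<Rightarrow> 'a set set \<Rightarrow> bool" where
  "live_tri W L Z G \<longleftrightarrow> (\<exists>S. plane_tri (W \<union> Z) (L \<union> S) G \<and> W \<inter> Z = {} \<and> (\<forall>e\<in>L. e \<subseteq> W) \<and>
     S \<subseteq> spokes W Z \<and> Z \<subseteq> \<Union>S)"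

lemma live_triI:
  assumes "plane_tri (W \<union> Z) (L \<union> S) G" "W \<inter> Z = {}" "\<And>e. e \<in> L \<Longrightarrow> e \<subseteq> W"
    "S \<subseteq> spokes W Z" "Z \<subseteq> \<Union>S"
  shows "live_tri W L Z G"
  using assms unfolding live_tri_def by (intro exI[of _ S] conjI ballI)

lemma live_triE:
  assumes "live_tri W L Z G"
  obtains S where "plane_tri (W \<union> Z) (L \<union> S) G" "W \<inter> Z = {}" "\<And>e. e \<in> L \<Longrightarrow> e \<subseteq> W"
    "S \<subseteq> spokes W Z" "Z \<subseteq> \<Union>S"
proof -
  obtain S where S: "plane_tri (W \<union> Z) (L \<union> S) G" "W \<inter> Z = {}" "\<forall>e\<in>L. e \<subseteq> W"
    "S \<subseteq> spokes W Z" "Z \<subseteq> \<Union>S"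
    using assms unfolding live_tri_def by (elim exE conjE) rule
  show ?thesis by (rule that[OF S(1,2) bspec[OF S(3)] S(4,5)])
qed

lemma live_tri_mono:
  assumes "live_tri W L Z G" "G' \<subseteq> G"
  shows "live_tri W L Z G'"
  using assms(1)
proof (rule live_triE)
  fix S assume S: "plane_tri (W \<union> Z) (L \<union> S) G" "W \<inter> Z = {}" "\<And>e. e \<in> L \<Longrightarrow> e \<subseteq> W"
    "S \<subseteq> spokes W Z" "Z \<subseteq> \<Union>S"
  show ?thesis by (rule live_triI[OF plane_tri_mono[OF S(1) assms(2)] S(2-5)])
qed

lemma live_tri_face:
  assumes "live_tri W L Z G" "f \<in> G"
  shows "f \<subseteq> W \<union> Z"
  using assms(1) by (rule live_triE) (rule plane_tri_face(1)[OF _ assms(2)])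

lemma live_tri_disjoint: "live_tri W L Z G \<Longrightarrow> W \<inter> Z = {}"
  by (rule live_triE)

lemma live_tri_edge: "live_tri W L Z G \<Longrightarrow> e \<in> L \<Longrightarrow> e \<subseteq> W"
  by (rule live_triE)

text \<open>The start of the base graph: its first edge and the centre of the first face.\<close>

lemma live_tri_triangle:
  assumes "x \<noteq> y" "y \<noteq> z" "x \<noteq> z"
  shows "live_tri {x, y} {{x, y}} {z} {{x, y, z}}"
proof (rule live_triI[where S = "{{y, z}, {x, z}}"])
  have eq: "{x, y} \<union> {z} = {x, y, z}" "{{x, y}} \<union> {{y, z}, {x, z}} = {{x, y}, {y, z}, {x, z}}" by auto
  show "plane_tri ({x, y} \<union> {z}) ({{x, y}} \<union> {{y, z}, {x, z}}) {{x, y, z}}"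
    unfolding eq by (rule plane_tri_triangle[OF assms])
  show "{{y, z}, {x, z}} \<subseteq> spokes {x, y} {z}"
    by (intro insert_subsetI empty_subsetI spokesI) simp_all
qed (use assms in auto)

lemma live_tri_stack_beside_dead:
  assumes T: "live_tri W L Z G" and f: "{u, v, z} \<in> G" "u \<in> W" "v \<in> W" "z \<in> Z" and p: "p \<notin> W \<union> Z"
  shows "live_tri (insert p W) (L \<union> {{p, u}, {p, v}}) Z (G - {{u, v, z}} \<union> {{p, u, v}, {p, v, z}, {p, u, z}})"
  using T
proof (rule live_triE)
  fix S assume S: "plane_tri (W \<union> Z) (L \<union> S) G" "W \<inter> Z = {}" "\<And>e. e \<in> L \<Longrightarrow> e \<subseteq> W"
    "S \<subseteq> spokes W Z" "Z \<subseteq> \<Union>S"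
  have eq: "insert p (W \<union> Z) = insert p W \<union> Z"
    "L \<union> S \<union> {{p, u}, {p, v}, {p, z}} = (L \<union> {{p, u}, {p, v}}) \<union> (insert {p, z} S)" by auto
  show ?thesis
  proof (rule live_triI)
    show "plane_tri (insert p W \<union> Z) ((L \<union> {{p, u}, {p, v}}) \<union> (insert {p, z} S))
        (G - {{u, v, z}} \<union> {{p, u, v}, {p, v, z}, {p, u, z}})"
      using plane_tri_stack[OF S(1) f(1) p] unfolding eq .
    show "insert p W \<inter> Z = {}" using S(2) p by auto
    show "e \<subseteq> insert p W" if "e \<in> L \<union> {{p, u}, {p, v}}" for e
      using that S(3)[of e] f by auto
    show "insert {p, z} S \<subseteq> spokes (insert p W) Z"
      by (intro insert_subsetI spokesI f(4) subset_trans[OF S(4)] spokes_mono) auto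
    show "Z \<subseteq> \<Union>(insert {p, z} S)" using S(5) by auto
  qed
qed

lemma live_tri_stack_live:
  assumes T: "live_tri W L Z G" and f: "{u, v, w} \<in> G" "u \<in> W" "v \<in> W" "w \<in> W" and p: "p \<notin> W \<union> Z"
  shows "live_tri (insert p W) (L \<union> {{p, u}, {p, v}, {p, w}}) Z (G - {{u, v, w}} \<union> {{p, u, v}, {p, v, w}, {p, u, w}})"
  using T
proof (rule live_triE)
  fix S assume S: "plane_tri (W \<union> Z) (L \<union> S) G" "W \<inter> Z = {}" "\<And>e. e \<in> L \<Longrightarrow> e \<subseteq> W"
    "S \<subseteq> spokes W Z" "Z \<subseteq> \<Union>S"
  have eq: "insert p (W \<union> Z) = insert p W \<union> Z"
    "L \<union> S \<union> {{p, u}, {p, v}, {p, w}} = (L \<union> {{p, u}, {p, v}, {p, w}}) \<union> S" by auto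
  show ?thesis
  proof (rule live_triI)
    show "plane_tri (insert p W \<union> Z) ((L \<union> {{p, u}, {p, v}, {p, w}}) \<union> S)
        (G - {{u, v, w}} \<union> {{p, u, v}, {p, v, w}, {p, u, w}})"
      using plane_tri_stack[OF S(1) f(1) p] unfolding eq .
    show "insert p W \<inter> Z = {}" using S(2) p by auto
    show "e \<subseteq> insert p W" if "e \<in> L \<union> {{p, u}, {p, v}, {p, w}}" for e
      using that S(3)[of e] f by auto
    show "S \<subseteq> spokes (insert p W) Z"
      by (intro subset_trans[OF S(4)] spokes_mono) auto
    show "Z \<subseteq> \<Union>S" by (rule S(5))
  qed
qed

text \<open>The three corners have to be live, since two adjacent dead vertices would give an edge
  that is neither live nor a spoke.\<close>

lemma live_tri_stack_dead:
  assumes T: "live_tri W L Z G" and f: "{u, v, w} \<in> G" "u \<in> W" "v \<in> W" "w \<in> W" and p: "p \<notin> W \<union> Z"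
  shows "live_tri W L (insert p Z) (G - {{u, v, w}} \<union> {{p, u, v}, {p, v, w}, {p, u, w}})"
  using T
proof (rule live_triE)
  fix S assume S: "plane_tri (W \<union> Z) (L \<union> S) G" "W \<inter> Z = {}" "\<And>e. e \<in> L \<Longrightarrow> e \<subseteq> W"
    "S \<subseteq> spokes W Z" "Z \<subseteq> \<Union>S"
  let ?S = "{{p, u}, {p, v}, {p, w}}"
  have eq: "insert p (W \<union> Z) = W \<union> insert p Z"
    "L \<union> S \<union> {{p, u}, {p, v}, {p, w}} = L \<union> (S \<union> ?S)" by auto
  show ?thesis
  proof (rule live_triI)
    show "plane_tri (W \<union> insert p Z) (L \<union> (S \<union> ?S))
        (G - {{u, v, w}} \<union> {{p, u, v}, {p, v, w}, {p, u, w}})"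
      using plane_tri_stack[OF S(1) f(1) p] unfolding eq .
    show "W \<inter> insert p Z = {}" using S(2) p by auto
    show "e \<subseteq> W" if "e \<in> L" for e by (rule S(3)[OF that])
    have "{p, a} \<in> spokes W (insert p Z)" if "a \<in> W" for a
      using spokesI[OF that, of p "insert p Z"] by (simp add: insert_commute)
    then have "?S \<subseteq> spokes W (insert p Z)"
      using f by (intro insert_subsetI empty_subsetI)
    moreover have "S \<subseteq> spokes W (insert p Z)"
      by (intro subset_trans[OF S(4)] spokes_mono) auto
    ultimately show "S \<union> ?S \<subseteq> spokes W (insert p Z)" by (rule Un_least[rotated])
    show "insert p Z \<subseteq> \<Union>(S \<union> ?S)" using S(5) by auto
  qed
qed

lemma live_tri_subdivide:
  assumes T: "live_tri W L Z G" and f: "{u, v, z} \<in> G" "{u, v, z'} \<in> G" "u \<in> W" "v \<in> W"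
    "z \<in> Z" "z' \<in> Z" "z \<noteq> z'" and p: "p \<notin> W \<union> Z"
  shows "live_tri (insert p W) (L - {{u, v}} \<union> {{p, u}, {p, v}}) Z
    (G - {{u, v, z}, {u, v, z'}} \<union> {{p, u, z}, {p, v, z}, {p, u, z'}, {p, v, z'}})"
  using T
proof (rule live_triE)
  fix S assume S: "plane_tri (W \<union> Z) (L \<union> S) G" "W \<inter> Z = {}" "\<And>e. e \<in> L \<Longrightarrow> e \<subseteq> W"
    "S \<subseteq> spokes W Z" "Z \<subseteq> \<Union>S"
  let ?S = "S \<union> {{p, z}, {p, z'}}"
  have "{u, v} \<notin> S" using not_in_spokes[OF f(3,4) S(2)] S(4) by blast
  then have eq: "insert p (W \<union> Z) = insert p W \<union> Z"
    "L \<union> S - {{u, v}} \<union> {{p, u}, {p, v}, {p, z}, {p, z'}} = (L - {{u, v}} \<union> {{p, u}, {p, v}}) \<union> ?S" by auto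
  show ?thesis
  proof (rule live_triI)
    show "plane_tri (insert p W \<union> Z) ((L - {{u, v}} \<union> {{p, u}, {p, v}}) \<union> ?S)
        (G - {{u, v, z}, {u, v, z'}} \<union> {{p, u, z}, {p, v, z}, {p, u, z'}, {p, v, z'}})"
      using plane_tri_subdivide[OF S(1) f(1,2,7) p] unfolding eq .
    show "insert p W \<inter> Z = {}" using S(2) p by auto
    show "e \<subseteq> insert p W" if "e \<in> L - {{u, v}} \<union> {{p, u}, {p, v}}" for e
      using that S(3)[of e] f by auto
    show "?S \<subseteq> spokes (insert p W) Z"
      by (intro Un_least insert_subsetI empty_subsetI spokesI f(5,6) subset_trans[OF S(4)] spokes_mono) auto
    show "Z \<subseteq> \<Union>?S" using S(5) by auto
  qed
qed

text \<open>Induction from the far end: the last inner vertex is placed on the whole edge, and the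
  remaining path subdivides the part that starts at \<open>s 0\<close>. Both centres stay beside
  every new edge, so the next subdivision again finds its two faces.\<close>

lemma live_tri_subdivide_path:
  assumes "live_tri W L Z G" "{s 0, s m, z} \<in> G" "{s 0, s m, z'} \<in> G" "s 0 \<in> W" "s m \<in> W"
    "z \<in> Z" "z' \<in> Z" "z \<noteq> z'" "0 < m" "inj_on s {..m}" "\<And>t. 0 < t \<Longrightarrow> t < m \<Longrightarrow> s t \<notin> W \<union> Z"
  shows "live_tri (W \<union> s ` {0<..<m}) (L - {{s 0, s m}} \<union> {{s t, s (Suc t)} | t. t < m}) Z
    (G - {{s 0, s m, z}, {s 0, s m, z'}} \<union> {{s t, s (Suc t), z} | t. t < m} \<union> {{s t, s (Suc t), z'} | t. t < m})"
  using assms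
proof (induction m arbitrary: W L G)
  case 0
  then show ?case by simp
next
  case (Suc m)
  show ?case
  proof (cases "m = 0")
    \<comment> \<open>Nothing is subdivided here. The formula removes the edge and adds it again, so
      it must be shown to be live: it is a side of a face and no spoke.\<close>
    case True
    have "{s 0, s (Suc 0)} \<in> L"
    proof (rule live_triE[OF Suc.prems(1)])
      fix S assume S: "plane_tri (W \<union> Z) (L \<union> S) G" "W \<inter> Z = {}"
        "S \<subseteq> spokes W Z"
      have "s 0 \<noteq> s (Suc 0)" using inj_onD[OF Suc.prems(10), of 0 "Suc 0"] by auto
      then have "{s 0, s (Suc 0)} \<in> L \<union> S"
        using True by (intro plane_tri_face(3)[OF S(1) Suc.prems(2)]) auto
      moreover have "{s 0, s (Suc 0)} \<notin> S"
        using not_in_spokes[OF Suc.prems(4,5) S(2)] S(3) True by auto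
      ultimately show ?thesis by blast
    qed
    then have eq: "W \<union> s ` {0<..<Suc m} = W"
      "L - {{s 0, s (Suc m)}} \<union> {{s t, s (Suc t)} | t. t < Suc m} = L"
      "G - {{s 0, s (Suc m), z}, {s 0, s (Suc m), z'}} \<union> {{s t, s (Suc t), z} | t. t < Suc m} \<union> {{s t, s (Suc t), z'} | t. t < Suc m} = G"
      using True Suc.prems(2,3) by auto
    show ?thesis unfolding eq by (rule Suc.prems(1))
  next
    case False
    then have m: "0 < m" by simp
    let ?p = "s m"
    let ?L = "L - {{s 0, s (Suc m)}} \<union> {{?p, s 0}, {?p, s (Suc m)}}"
    let ?R = "{{s 0, s (Suc m), z}, {s 0, s (Suc m), z'}}"
    let ?G = "G - ?R \<union> {{?p, s 0, z}, {?p, s (Suc m), z}, {?p, s 0, z'}, {?p, s (Suc m), z'}}"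
    have pW: "?p \<notin> W \<union> Z" by (rule Suc.prems(11)) (use m in simp_all)
    have T: "live_tri (insert ?p W) ?L Z ?G"
      by (rule live_tri_subdivide) (use Suc.prems pW in simp_all)
    have inj: "inj_on s {..m}" by (rule inj_on_subset[OF Suc.prems(10)]) simp
    have T': "live_tri (insert ?p W \<union> s ` {0<..<m}) (?L - {{s 0, s m}} \<union> {{s t, s (Suc t)} | t. t < m}) Z
      (?G - {{s 0, s m, z}, {s 0, s m, z'}} \<union> {{s t, s (Suc t), z} | t. t < m} \<union> {{s t, s (Suc t), z'} | t. t < m})"
    proof (rule Suc.IH[OF T])
      show "{s 0, s m, z} \<in> ?G" "{s 0, s m, z'} \<in> ?G" by (simp_all add: insert_commute)
      show "s 0 \<in> insert ?p W" "s m \<in> insert ?p W" using Suc.prems(4) by simp_all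
      show "s t \<notin> insert ?p W \<union> Z" if "0 < t" "t < m" for t
        using Suc.prems(11)[of t] inj_onD[OF inj, of t m] that by auto
    qed (use Suc.prems m inj in simp_all)
    have ne: "s 0 \<noteq> s m" "s 0 \<noteq> s (Suc m)" "s m \<noteq> s (Suc m)"
      using inj_onD[OF Suc.prems(10), of 0 m] inj_onD[OF Suc.prems(10), of 0 "Suc m"]
        inj_onD[OF Suc.prems(10), of m "Suc m"] m by auto
    have LW: "\<And>e. e \<in> L \<Longrightarrow> e \<subseteq> W" by (rule live_tri_edge[OF Suc.prems(1)])
    have GW: "\<And>f. f \<in> G \<Longrightarrow> f \<subseteq> W \<union> Z" by (rule live_tri_face[OF Suc.prems(1)])
    have "{0<..<Suc m} = insert m {0<..<m}" using m by auto
    then have e1: "insert ?p W \<union> s ` {0<..<m} = W \<union> s ` {0<..<Suc m}" by auto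
    have "{s 0, s m} \<notin> L" using LW[of "{s 0, s m}"] pW by blast
    moreover have "{s m, s (Suc m)} \<noteq> {s 0, s m}" using ne by (auto simp: doubleton_eq_iff)
    moreover have Ls: "{F t | t. t < Suc m} = insert (F m) {F t | t. t < m}" for F :: "nat \<Rightarrow> 'a set"
      by (auto simp: less_Suc_eq)
    ultimately have e2: "?L - {{s 0, s m}} \<union> {{s t, s (Suc t)} | t. t < m} =
      L - {{s 0, s (Suc m)}} \<union> {{s t, s (Suc t)} | t. t < Suc m}"
      by (auto simp: insert_commute)
    have zn: "z \<notin> W" "z' \<notin> W" "z \<noteq> s m" "z' \<noteq> s m"
      using Suc.prems(6,7) live_tri_disjoint[OF Suc.prems(1)] pW by auto
    have g: "{s 0, s m, y} \<notin> G" for y using GW[of "{s 0, s m, y}"] pW by auto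
    have e3: "G - ?R \<union> {{s t, s (Suc t), z} | t. t < Suc m} \<union> {{s t, s (Suc t), z'} | t. t < Suc m} \<subseteq>
      ?G - {{s 0, s m, z}, {s 0, s m, z'}} \<union> {{s t, s (Suc t), z} | t. t < m} \<union> {{s t, s (Suc t), z'} | t. t < m}"
    proof -
      have "s (Suc m) \<notin> {s 0, s m, y}" if "y \<in> Z" for y
        using ne that Suc.prems(5) live_tri_disjoint[OF Suc.prems(1)] by auto
      then have n: "{s m, s (Suc m), y'} \<notin> {{s 0, s m, z}, {s 0, s m, z'}}" for y'
        using Suc.prems(6,7) by (metis insertCI insertE singletonD)
      have gen: "X \<union> insert a A \<union> insert b B \<subseteq> H \<union> A \<union> B"
        if "X \<subseteq> H" "a \<in> H" "b \<in> H" for X H A B :: "'a set set" and a b using that by blast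
      have 1: "G - ?R \<subseteq> ?G - {{s 0, s m, z}, {s 0, s m, z'}}" using g by blast
      have 2: "{s m, s (Suc m), z} \<in> ?G - {{s 0, s m, z}, {s 0, s m, z'}}"
        "{s m, s (Suc m), z'} \<in> ?G - {{s 0, s m, z}, {s 0, s m, z'}}" using n by simp_all
      show ?thesis unfolding Ls by (rule gen[OF 1 2])
    qed
    show ?thesis using live_tri_mono[OF T' e3] unfolding e1 e2 .
  qed
qed


text \<open>Together with the edge \<open>{u, v}\<close>, this is a path of \<open>m\<close>
  vertices joined completely to \<open>u\<close> and \<open>v\<close>: a stacked triangulation on
  \<open>m + 2\<close> vertices.\<close>

definition block_edges :: "'a \<Rightarrow> 'a \<Rightarrow> (nat \<Rightarrow> 'a) \<Rightarrow> nat \<Rightarrow> 'a set set" where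
  "block_edges u v b m = {{b j, u} | j. j < m} \<union> {{b j, v} | j. j < m} \<union> {{b j, b (Suc j)} | j. Suc j < m}"

lemma block_edges_Suc:
  "0 < m \<Longrightarrow> block_edges u v b (Suc m) = block_edges u v b m \<union> {{b m, b (m - 1)}, {b m, u}, {b m, v}}"
proof -
  assume m: "0 < m"
  have 1: "{F j | j. j < Suc m} = insert (F m) {F j | j. j < m}" for F :: "nat \<Rightarrow> 'a set"
    by (auto simp: less_Suc_eq)
  obtain n where n: "m = Suc n" using m gr0_implies_Suc by blast
  have "{{b j, b (Suc j)} | j. Suc j < Suc m} = insert {b n, b (Suc n)} {{b j, b (Suc j)} | j. j < n}"
    unfolding n by (auto simp: less_Suc_eq)
  moreover have "{b n, b (Suc n)} = {b m, b (m - 1)}" using n by (simp add: insert_commute)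
  moreover have "{{b j, b (Suc j)} | j. j < n} = {{b j, b (Suc j)} | j. Suc j < m}" unfolding n by simp
  ultimately have 2: "{{b j, b (Suc j)} | j. Suc j < Suc m} = insert {b m, b (m - 1)} {{b j, b (Suc j)} | j. Suc j < m}"
    by (simp only:)
  show ?thesis unfolding block_edges_def 2 1 by (simp add: Un_ac insert_commute)
qed

text \<open>After \<open>b 0\<close> every vertex goes into the face on \<open>{u, v}\<close> that
  its predecessor left, so only \<open>b 0\<close> becomes a neighbour of \<open>z\<close>. Of the
  two faces that are recorded, \<open>{b (m - 1), u, v}\<close> carries the induction, and
  \<open>{b 0, v, z}\<close> is what a \<open>k\<close>-cycle through the centre \<open>z\<close>
  uses later.\<close>

lemma live_tri_block:
  assumes T: "live_tri W L Z G" and f: "{u, v, z} \<in> G" "u \<in> W" "v \<in> W" "z \<in> Z"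
    and "0 < m" "inj_on b {..<m}" "\<And>j. j < m \<Longrightarrow> b j \<notin> W \<union> Z"
  shows "live_tri (W \<union> b ` {..<m}) (L \<union> block_edges u v b m) Z
    (G - {{u, v, z}} \<union> {{b 0, v, z}, {b (m - 1), u, v}})"
  using assms(6-)
proof (induction m)
  case 0
  then show ?case by simp
next
  case (Suc m)
  have z: "z \<notin> W" using f(4) live_tri_disjoint[OF T] by blast
  show ?case
  proof (cases "m = 0")
    case True
    have "live_tri (insert (b 0) W) (L \<union> {{b 0, u}, {b 0, v}}) Z (G - {{u, v, z}} \<union> {{b 0, u, v}, {b 0, v, z}, {b 0, u, z}})"
      by (rule live_tri_stack_beside_dead[OF T f]) (use Suc.prems(3)[of 0] in simp)
    then have "live_tri (insert (b 0) W) (L \<union> {{b 0, u}, {b 0, v}}) Z (G - {{u, v, z}} \<union> {{b 0, v, z}, {b 0, u, v}})"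
      by (rule live_tri_mono) blast
    moreover have "block_edges u v b (Suc m) = {{b 0, u}, {b 0, v}}" using True by (auto simp: block_edges_def)
    ultimately show ?thesis using True by (simp add: lessThan_Suc)
  next
    case False
    then have m: "0 < m" by simp
    let ?W = "W \<union> b ` {..<m}" and ?G = "G - {{u, v, z}} \<union> {{b 0, v, z}, {b (m - 1), u, v}}"
    have T': "live_tri ?W (L \<union> block_edges u v b m) Z ?G"
      by (rule Suc.IH[OF m]) (use Suc.prems in \<open>auto intro: inj_on_subset\<close>)
    have bm: "b m \<notin> W \<union> Z" using Suc.prems(3) by simp
    moreover have "b m \<notin> b ` {..<m}" using inj_onD[OF Suc.prems(2), of m] by force
    ultimately have p: "b m \<notin> ?W \<union> Z" by blast
    have b1: "b (m - 1) \<notin> W \<union> Z" using Suc.prems(3)[of "m - 1"] m by simp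
    have T'': "live_tri (insert (b m) ?W) ((L \<union> block_edges u v b m) \<union> {{b m, b (m - 1)}, {b m, u}, {b m, v}}) Z
      (?G - {{b (m - 1), u, v}} \<union> {{b m, b (m - 1), u}, {b m, u, v}, {b m, b (m - 1), v}})"
      by (rule live_tri_stack_live[OF T' _ _ _ _ p]) (use f m in auto)
    have n1: "{b (m - 1), u, v} \<notin> G" using live_tri_face[OF T, of "{b (m - 1), u, v}"] b1 by auto
    have "z \<notin> {b (m - 1), u, v}" "z \<in> {b 0, v, z}" using b1 f z by auto
    then have n2: "{b 0, v, z} \<noteq> {b (m - 1), u, v}" by metis
    have G: "G - {{u, v, z}} \<union> {{b 0, v, z}, {b m, u, v}} \<subseteq>
      ?G - {{b (m - 1), u, v}} \<union> {{b m, b (m - 1), u}, {b m, u, v}, {b m, b (m - 1), v}}" (is "_ \<subseteq> ?H")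
    proof (intro Un_least insert_subsetI empty_subsetI)
      show "G - {{u, v, z}} \<subseteq> ?H" using n1 by blast
      show "{b 0, v, z} \<in> ?H" using n2 by simp
      show "{b m, u, v} \<in> ?H" by simp
    qed
    have W: "insert (b m) ?W = W \<union> b ` {..<Suc m}" by (simp add: lessThan_Suc)
    have E: "(L \<union> block_edges u v b m) \<union> {{b m, b (m - 1)}, {b m, u}, {b m, v}} = L \<union> block_edges u v b (Suc m)"
      unfolding block_edges_Suc[OF m] by blast
    show ?thesis using live_tri_mono[OF T'' G] unfolding W E by simp
  qed
qed

text \<open>The blocks do not compete for faces: \<open>z\<close> is dead, so the live vertices of a
  face \<open>{u, v, z (u, v)}\<close> give back the edge to which it was assigned.\<close>

lemma live_tri_blocks:
  assumes "finite Q" and T: "live_tri W L Z G" and "0 < m"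
    and f: "\<And>u v. (u, v) \<in> Q \<Longrightarrow> u \<in> W \<and> v \<in> W \<and> z (u, v) \<in> Z \<and> {u, v, z (u, v)} \<in> G"
    and Q: "\<And>u v u' v'. (u, v) \<in> Q \<Longrightarrow> (u', v') \<in> Q \<Longrightarrow> {u, v} = {u', v'} \<Longrightarrow> (u, v) = (u', v')"
    and b: "inj_on (\<lambda>(q, j). b q j) (Q \<times> {..<m})" "\<And>q j. q \<in> Q \<Longrightarrow> j < m \<Longrightarrow> b q j \<notin> W \<union> Z"
  shows "live_tri (W \<union> (\<Union>q\<in>Q. b q ` {..<m})) (L \<union> (\<Union>(u, v)\<in>Q. block_edges u v (b (u, v)) m)) Z
    (G - (\<lambda>(u, v). {u, v, z (u, v)}) ` Q)"
  using assms(1) f Q b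
proof (induction Q)
  case empty
  then show ?case using T by simp
next
  case (insert q Q)
  obtain u v where q: "q = (u, v)" by fastforce
  let ?W = "W \<union> (\<Union>q\<in>Q. b q ` {..<m})" and ?L = "L \<union> (\<Union>(u, v)\<in>Q. block_edges u v (b (u, v)) m)"
  let ?f = "\<lambda>(u, v). {u, v, z (u, v)}"
  have IH: "live_tri ?W ?L Z (G - ?f ` Q)"
  proof (rule insert.IH)
    show "u \<in> W \<and> v \<in> W \<and> z (u, v) \<in> Z \<and> {u, v, z (u, v)} \<in> G" if "(u, v) \<in> Q" for u v
      by (rule insert.prems(1)) (use that in simp)
    show "(u, v) = (u', v')" if "(u, v) \<in> Q" "(u', v') \<in> Q" "{u, v} = {u', v'}" for u v u' v'
      by (rule insert.prems(2)) (use that in simp_all)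
    show "inj_on (\<lambda>(q, j). b q j) (Q \<times> {..<m})" by (rule inj_on_subset[OF insert.prems(3)]) auto
    show "b q j \<notin> W \<union> Z" if "q \<in> Q" "j < m" for q j by (rule insert.prems(4)) (use that in simp_all)
  qed
  have uv: "u \<in> W" "v \<in> W" "z q \<in> Z" "{u, v, z q} \<in> G" using insert.prems(1)[of u v] q by simp_all
  have dj: "W \<inter> Z = {}" by (rule live_tri_disjoint[OF T])
  have nf: "{u, v, z q} \<notin> ?f ` Q"
  proof
    assume "{u, v, z q} \<in> ?f ` Q"
    then obtain u' v' where uv': "(u', v') \<in> Q" "{u, v, z q} = {u', v', z (u', v')}" by auto
    have w: "u' \<in> W" "v' \<in> W" "z (u', v') \<in> Z" using insert.prems(1)[of u' v'] uv'(1) by simp_all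
    have "{u, v} = {u, v, z q} \<inter> W" using uv dj by auto
    also have "\<dots> = {u', v'}" unfolding uv'(2) using w dj by auto
    finally have "(u, v) = (u', v')" using insert.prems(2)[of u v u' v'] uv'(1) q by simp
    then show False using insert.hyps uv'(1) q by simp
  qed
  have "live_tri (?W \<union> b q ` {..<m}) (?L \<union> block_edges u v (b q) m) Z
    ((G - ?f ` Q) - {{u, v, z q}} \<union> {{b q 0, v, z q}, {b q (m - 1), u, v}})"
  proof (rule live_tri_block[OF IH])
    show "{u, v, z q} \<in> G - ?f ` Q" using uv(4) nf by blast
    show "u \<in> ?W" "v \<in> ?W" "z q \<in> Z" "0 < m" using uv assms(3) by auto
    show "inj_on (b q) {..<m}"
    proof (rule inj_onI)
      fix i j assume "i \<in> {..<m}" "j \<in> {..<m}" "b q i = b q j"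
      then have "(q, i) = (q, j)" by (intro inj_onD[OF insert.prems(3)]) auto
      then show "i = j" by simp
    qed
    show "b q j \<notin> ?W \<union> Z" if jm: "j < m" for j
    proof
      assume "b q j \<in> ?W \<union> Z"
      then obtain q' i where "q' \<in> Q" "i < m" "b q j = b q' i"
        using insert.prems(4)[OF insertI1 jm] by auto
      then have "(q, j) = (q', i)" using jm by (intro inj_onD[OF insert.prems(3)]) auto
      then show False using insert.hyps \<open>q' \<in> Q\<close> by simp
    qed
  qed
  then have "live_tri (?W \<union> b q ` {..<m}) (?L \<union> block_edges u v (b q) m) Z (G - ?f ` (insert q Q))"
    by (rule live_tri_mono) (auto simp: q)
  moreover have "?W \<union> b q ` {..<m} = W \<union> (\<Union>q\<in>insert q Q. b q ` {..<m})" by auto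
  moreover have "?L \<union> block_edges u v (b q) m = L \<union> (\<Union>(u, v)\<in>insert q Q. block_edges u v (b (u, v)) m)"
    unfolding q by auto
  ultimately show ?case by (simp only:)
qed

section \<open>Cycles\<close>

definition map_graph :: "('a \<Rightarrow> 'b) \<Rightarrow> 'a graph \<Rightarrow> 'b graph" where
  "map_graph f G = (f ` verts G, (`) f ` edges G)"

lemma copy_of_map_graph:
  assumes S: "copy_of H S G" and inj: "inj_on f (verts G)"
  shows "copy_of H (map_graph f S) (map_graph f G)"
proof -
  have sg: "simple_graph S" "verts S \<subseteq> verts G" "edges S \<subseteq> edges G"
    using S unfolding copy_of_def subgraph_def by simp_all
  obtain g where g: "bij_betw g (verts S) (verts H)" "(\<lambda>e. g ` e) ` edges S = edges H"
    using S unfolding copy_of_def isomorphic_def by blast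
  have injS: "inj_on f (verts S)" by (rule inj_on_subset[OF inj sg(2)])
  have eS: "finite (verts S)" "\<And>e. e \<in> edges S \<Longrightarrow> e \<subseteq> verts S \<and> card e = 2"
    using sg(1) unfolding simple_graph_def by simp_all
  have "simple_graph (map_graph f S)"
    unfolding simple_graph_def map_graph_def
  proof (intro conjI ballI)
    show "finite (verts (f ` verts S, (`) f ` edges S))" using eS(1) by simp
    fix e assume "e \<in> edges (f ` verts S, (`) f ` edges S)"
    then obtain d where d: "d \<in> edges S" "e = f ` d" by auto
    show "e \<subseteq> verts (f ` verts S, (`) f ` edges S)" using d eS(2)[OF d(1)] by auto
    have "inj_on f d" using injS eS(2)[OF d(1)] inj_on_subset by blast
    then show "card e = 2" using d eS(2)[OF d(1)] card_image[of f d] by simp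
  qed
  then have 1: "subgraph (map_graph f S) (map_graph f G)"
    using sg(2,3) unfolding subgraph_def map_graph_def by auto
  let ?i = "inv_into (verts S) f"
  have "bij_betw ?i (f ` verts S) (verts S)" by (rule bij_betw_inv_into[OF inj_on_imp_bij_betw[OF injS]])
  then have 2: "bij_betw (g \<circ> ?i) (f ` verts S) (verts H)" using g(1) by (rule bij_betw_trans)
  have "(g \<circ> ?i) ` (f ` e) = g ` e" if "e \<in> edges S" for e
    unfolding image_image o_def using eS(2)[OF that] injS by (intro image_cong) auto
  then have "(\<lambda>e. (g \<circ> ?i) ` e) ` ((`) f ` edges S) = (\<lambda>e. g ` e) ` edges S"
    unfolding image_image[of _ "(`) f"] by (intro image_cong) simp_all
  then have 3: "(\<lambda>e. (g \<circ> ?i) ` e) ` ((`) f ` edges S) = edges H" using g(2) by (rule trans)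
  have "isomorphic (map_graph f S) H" unfolding isomorphic_def map_graph_def fst_conv snd_conv
    by (intro exI[of _ "g \<circ> ?i"] conjI 2 3)
  with 1 show ?thesis unfolding copy_of_def by (rule conjI)
qed

text \<open>The maximum is attained over a finite set. The crude bound \<open>2 ^ n\<close>
  suffices, edges being sets of vertices.\<close>

lemma ar_planar_ge:
  assumes "T \<in> triangulations n H" "\<not> (\<exists>S. copy_of H S T \<and> rainbow c S)"
  shows "card (c ` edges T) \<le> ar_planar n H"
proof -
  let ?M = "{card (c ` edges T) | T c. T \<in> triangulations n H \<and> \<not> (\<exists>S. copy_of H S T \<and> rainbow c S)}"
  have "?M \<subseteq> {..2 ^ n}"
  proof
    fix x assume "x \<in> ?M"
    then obtain T and c :: "complex set \<Rightarrow> nat" where T: "T \<in> triangulations n H" "x = card (c ` edges T)" by blast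
    then obtain V A where V: "T = graph_of V A" "plane_triangulation V A" "card V = n"
      unfolding triangulations_def by blast
    have fin: "finite V" using V(2) unfolding plane_triangulation_def plane_graph_def by blast
    have sub: "edges T \<subseteq> Pow V" unfolding V(1) graph_of_def by auto
    have fe: "finite (edges T)" by (rule finite_subset[OF sub]) (simp add: fin)
    have "x \<le> card (edges T)" unfolding T(2) by (rule card_image_le[OF fe])
    also have "\<dots> \<le> card (Pow V)" by (rule card_mono[OF _ sub]) (simp add: fin)
    also have "\<dots> = 2 ^ n" using card_Pow[OF fin] V(3) by simp
    finally show "x \<in> {..2 ^ n}" by simp
  qed
  then have "finite ?M" by (rule finite_subset) simp
  moreover have "card (c ` edges T) \<in> ?M" using assms by blast
  ultimately show ?thesis unfolding ar_planar_def by (rule Max_ge)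
qed

text \<open>The right-hand side is the cyclic predecessor of \<open>i\<close>; the added
  \<open>k\<close> avoids truncated subtraction at \<open>i = 0\<close>.\<close>

lemma mod_Suc_eq_iff:
  assumes "i < k" "j < k" "0 < k"
  shows "Suc j mod k = i \<longleftrightarrow> j = (i + k - 1) mod k"
proof (cases "i = 0")
  case True
  then show ?thesis using assms by (auto simp: mod_Suc)
next
  case False
  then have "i + k - 1 = (i - 1) + k" by linarith
  then have "(i + k - 1) mod k = (i - 1) mod k" by (metis mod_add_self2)
  also have "\<dots> = i - 1" by (rule mod_less) (use assms(1) in linarith)
  finally have "(i + k - 1) mod k = i - 1" .
  then show ?thesis using False assms by (auto simp: mod_Suc)
qed

lemma cycle_copy_enumeration:
  assumes "copy_of (cycle_graph k) S G" "3 \<le> k"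
  obtains s where "inj_on s {..<k}" "verts S = s ` {..<k}" "edges S = (\<lambda>i. {s i, s (Suc i mod k)}) ` {..<k}"
proof -
  have sg: "simple_graph S" using assms(1) unfolding copy_of_def subgraph_def by simp
  obtain f where f: "bij_betw f (verts S) (verts (cycle_graph k))" "(\<lambda>e. f ` e) ` edges S = edges (cycle_graph k)"
    using assms(1) unfolding copy_of_def isomorphic_def by blast
  let ?s = "inv_into (verts S) f"
  have v: "verts (cycle_graph k) = {..<k}" by (auto simp: cycle_graph_def)
  have e: "edges (cycle_graph k) = (\<lambda>i. {i, Suc i mod k}) ` {..<k}" by (auto simp: cycle_graph_def)
  have bij: "bij_betw ?s {..<k} (verts S)" using bij_betw_inv_into[OF f(1)] v by simp
  have inj: "inj_on f (verts S)" using f(1) by (rule bij_betw_imp_inj_on)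
  have id: "?s ` (f ` d) = d" if "d \<in> edges S" for d
  proof -
    have "d \<subseteq> verts S" using sg that unfolding simple_graph_def by blast
    then show ?thesis using inj by (rule inv_into_image_cancel[rotated])
  qed
  have "(\<lambda>d. ?s ` (f ` d)) ` edges S = (\<lambda>d. d) ` edges S" by (rule image_cong[OF refl id])
  then have "edges S = (\<lambda>d. ?s ` (f ` d)) ` edges S" by (simp only: image_ident)
  also have "\<dots> = (\<lambda>d. ?s ` d) ` (edges (cycle_graph k))" unfolding f(2)[symmetric] by (simp add: image_image)
  also have "\<dots> = (\<lambda>i. {?s i, ?s (Suc i mod k)}) ` {..<k}" unfolding e by (simp add: image_image)
  finally show ?thesis
    by (rule that[OF bij_betw_imp_inj_on[OF bij] bij_betw_imp_surj_on[OF bij, symmetric]])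
qed

lemma cycle_copyI:
  assumes k: "3 \<le> k" and s: "inj_on s {..<k}" "\<And>i. i < k \<Longrightarrow> s i \<in> V" "\<And>i. i < k \<Longrightarrow> {s i, s (Suc i mod k)} \<in> E"
  shows "\<exists>S. copy_of (cycle_graph k) S (V, E)"
proof -
  have S: "subgraph (cycle_graph k) (cycle_graph k)"
  proof -
    have "Suc i mod k \<noteq> i" if "i < k" for i using that k by (auto simp: mod_Suc)
    then have "card {i, Suc i mod k} = 2" if "i < k" for i using that by (simp add: card_insert_if) metis
    then show ?thesis using k unfolding subgraph_def simple_graph_def cycle_graph_def by auto
  qed
  have "isomorphic (cycle_graph k) (cycle_graph k)" unfolding isomorphic_def
    by (intro exI[of _ id]) (simp add: image_def)
  with S have "copy_of (cycle_graph k) (cycle_graph k) (cycle_graph k)" unfolding copy_of_def by simp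
  then have c: "copy_of (cycle_graph k) (map_graph s (cycle_graph k)) (map_graph s (cycle_graph k))"
    by (rule copy_of_map_graph) (use s(1) in \<open>simp add: cycle_graph_def lessThan_atLeast0\<close>)
  have "verts (map_graph s (cycle_graph k)) \<subseteq> V" "edges (map_graph s (cycle_graph k)) \<subseteq> E"
    using s(2,3) unfolding map_graph_def cycle_graph_def by auto
  then have "copy_of (cycle_graph k) (map_graph s (cycle_graph k)) (V, E)"
    using c unfolding copy_of_def subgraph_def by simp
  then show ?thesis by blast
qed

lemma cycle_copy_degree:
  assumes "copy_of (cycle_graph k) S G" "3 \<le> k" "v \<in> verts S"
  shows "card {e\<in>edges S. v \<in> e} = 2"
  using assms(1,2)
proof (rule cycle_copy_enumeration)
  fix s assume s: "inj_on s {..<k}" "verts S = s ` {..<k}" "edges S = (\<lambda>i. {s i, s (Suc i mod k)}) ` {..<k}"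
  obtain i where i: "i < k" "v = s i" using assms(3) s(2) by auto
  let ?e = "\<lambda>i. {s i, s (Suc i mod k)}" and ?p = "(i + k - 1) mod k"
  have k: "0 < k" using assms(2) by simp
  have lt: "Suc j mod k < k" "?p < k" for j using k by simp_all
  have mem: "v \<in> ?e j \<longleftrightarrow> j = i \<or> j = ?p" if "j < k" for j
    using inj_onD[OF s(1), of i j] inj_onD[OF s(1), of i "Suc j mod k"] that i lt(1)[of j]
      mod_Suc_eq_iff[OF i(1) that k] by auto
  have "{e\<in>edges S. v \<in> e} = ?e ` {i, ?p}"
  proof
    show "{e\<in>edges S. v \<in> e} \<subseteq> ?e ` {i, ?p}"
    proof
      fix e assume "e \<in> {e\<in>edges S. v \<in> e}"
      then obtain j where "j < k" "e = ?e j" "v \<in> ?e j" unfolding s(3) by auto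
      then show "e \<in> ?e ` {i, ?p}" using mem by blast
    qed
    show "?e ` {i, ?p} \<subseteq> {e\<in>edges S. v \<in> e}"
      unfolding s(3) using mem i(1) lt(2) by auto
  qed
  \<comment> \<open>If the two edges were equal, the successor and the predecessor of
    \<open>i\<close> would coincide, which \<open>3 \<le> k\<close> excludes.\<close>
  moreover have "?e i \<noteq> ?e ?p"
  proof
    assume eq: "?e i = ?e ?p"
    have p: "Suc ?p mod k = i" using mod_Suc_eq_iff[OF i(1) lt(2) k] by simp
    have "s (Suc i mod k) \<in> ?e ?p" using eq by blast
    then have "Suc i mod k = ?p \<or> Suc i mod k = i"
      using inj_onD[OF s(1), of "Suc i mod k" ?p] inj_onD[OF s(1), of "Suc i mod k" i] p lt i(1) by auto
    then show False using assms(2) i(1) p by (auto simp: mod_Suc split: if_splits)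
  qed
  ultimately show ?thesis by simp
qed

lemma cycle_copy_card:
  assumes "copy_of (cycle_graph k) S G" "3 \<le> k"
  shows "card (verts S) = k" "card (edges S) \<le> k" "finite (edges S)" "edges S \<noteq> {}"
  using assms
proof -
  obtain s where s: "inj_on s {..<k}" "verts S = s ` {..<k}" "edges S = (\<lambda>i. {s i, s (Suc i mod k)}) ` {..<k}"
    using assms by (rule cycle_copy_enumeration)
  show "card (verts S) = k" unfolding s(2) using card_image[OF s(1)] by simp
  show "card (edges S) \<le> k" unfolding s(3) using card_image_le[of "{..<k}"] by fastforce
  show "finite (edges S)" unfolding s(3) by simp
  show "edges S \<noteq> {}" unfolding s(3) using assms(2) by (simp add: lessThan_empty_iff)
qed

text \<open>Walking along the cycle, the vertex where \<open>D\<close> stops would have degree 1 in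
  \<open>D\<close>. So \<open>D\<close> contains with every edge the next one.\<close>

lemma cycle_copy_minimal:
  assumes S: "copy_of (cycle_graph k) S G" "3 \<le> k" and D: "D \<subseteq> edges S" "D \<noteq> {}"
    and deg: "\<And>v. v \<in> verts S \<Longrightarrow> card {e\<in>D. v \<in> e} \<noteq> 1"
  shows "D = edges S"
proof -
  obtain s where s: "inj_on s {..<k}" "verts S = s ` {..<k}" "edges S = (\<lambda>i. {s i, s (Suc i mod k)}) ` {..<k}"
    using S by (rule cycle_copy_enumeration)
  let ?e = "\<lambda>i. {s i, s (Suc i mod k)}"
  have k: "0 < k" using S(2) by simp
  have lt: "j mod k < k" for j using k by simp
  have step: "?e (Suc i mod k) \<in> D" if i: "i < k" "?e i \<in> D" for i
  proof (rule ccontr)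
    let ?j = "Suc i mod k"
    assume n: "?e ?j \<notin> D"
    have "{e\<in>D. s ?j \<in> e} = {?e i}"
    proof
      show "{e\<in>D. s ?j \<in> e} \<subseteq> {?e i}"
      proof
        fix e assume "e \<in> {e\<in>D. s ?j \<in> e}"
        then obtain l where l: "l < k" "e = ?e l" "s ?j \<in> ?e l" "?e l \<in> D" using D(1) unfolding s(3) by auto
        have "?j = l \<or> ?j = Suc l mod k"
          using l(1,3) inj_onD[OF s(1), of ?j l] inj_onD[OF s(1), of ?j "Suc l mod k"] lt by auto
        moreover have "?j \<noteq> l" using n l(4) by metis
        ultimately have "Suc l mod k = Suc i mod k" by simp
        then have "l = i" using mod_Suc_eq_iff[OF lt l(1) k, of "Suc i"] mod_Suc_eq_iff[OF lt i(1) k, of "Suc i"] by simp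
        then show "e \<in> {?e i}" using l(2) by simp
      qed
      show "{?e i} \<subseteq> {e\<in>D. s ?j \<in> e}" using i(2) by simp
    qed
    then have "card {e\<in>D. s ?j \<in> e} = 1" by simp
    moreover have "s ?j \<in> verts S" unfolding s(2) using lt by simp
    ultimately show False using deg by blast
  qed
  obtain i where i: "i < k" "?e i \<in> D" using D unfolding s(3) by blast
  have all: "?e ((i + d) mod k) \<in> D" for d
  proof (induction d)
    case 0
    then show ?case using i by simp
  next
    case (Suc d)
    have "?e (Suc ((i + d) mod k) mod k) \<in> D" by (rule step[OF lt Suc])
    then show ?case by (simp add: mod_Suc_eq)
  qed
  have "?e j \<in> D" if "j < k" for j
  proof -
    \<comment> \<open>It takes \<open>k - i + j\<close> steps to walk from \<open>i\<close> once
      around and on to \<open>j\<close>.\<close>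
    have "(i + (k - i + j)) mod k = j" using i(1) that by simp
    then show ?thesis using all[of "k - i + j"] by simp
  qed
  then have "edges S \<subseteq> D" unfolding s(3) by blast
  then show ?thesis using D(1) by blast
qed

text \<open>A \<open>k\<close>-cycle does not fit into one block, and the blocks that it meets form a cycle
  of the same or smaller length in the base graph.\<close>

lemma no_cycle_in_blocks:
  fixes ends inner :: "'i \<Rightarrow> 'a set"
  assumes k: "3 \<le> k"
    and Q: "\<And>q. q \<in> Q \<Longrightarrow> ends q \<subseteq> U \<and> card (ends q) = 2" "inj_on ends Q"
    and inner: "\<And>q. q \<in> Q \<Longrightarrow> inner q \<inter> U = {}" "\<And>q. q \<in> Q \<Longrightarrow> finite (inner q)"
      "\<And>q q'. q \<in> Q \<Longrightarrow> q' \<in> Q \<Longrightarrow> q \<noteq> q' \<Longrightarrow> inner q \<inter> inner q' = {}"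
      "\<And>q. q \<in> Q \<Longrightarrow> card (ends q \<union> inner q) < k"
    and L: "\<And>e. e \<in> L \<Longrightarrow> \<exists>q\<in>Q. e \<subseteq> ends q \<union> inner q"
    and girth: "\<And>D. D \<subseteq> Q \<Longrightarrow> finite D \<Longrightarrow> D \<noteq> {} \<Longrightarrow> (\<And>v. card {q\<in>D. v \<in> ends q} \<in> {0, 2}) \<Longrightarrow> k < card D"
    and S: "copy_of (cycle_graph k) S G" "edges S \<subseteq> L"
  shows False
proof -
  let ?E = "edges S"
  define B where "B q = ends q \<union> inner q" for q
  define D where "D q = {e\<in>?E. e \<subseteq> B q}" for q
  have sg: "simple_graph S" using S(1) unfolding copy_of_def subgraph_def by simp
  have eS: "finite (verts S)" "\<And>e. e \<in> ?E \<Longrightarrow> e \<subseteq> verts S" "\<And>e. e \<in> ?E \<Longrightarrow> card e = 2"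
    using sg unfolding simple_graph_def by simp_all
  note finE = cycle_copy_card(3)[OF S(1) k]
  have finends: "finite (ends q)" if "q \<in> Q" for q using Q(1)[OF that] card.infinite by fastforce
  have finB: "finite (B q)" if "q \<in> Q" for q unfolding B_def using finends[OF that] inner(2)[OF that] by simp
  have finD: "finite (D q)" for q unfolding D_def using finE by simp
  \<comment> \<open>Different blocks meet in ends only, so a common edge would consist of the ends
    of both, against the injectivity of \<open>ends\<close>.\<close>
  have cap: "q = q'" if q: "q \<in> Q" "q' \<in> Q" and e: "e \<subseteq> B q" "e \<subseteq> B q'" "card e = 2" for q q' e
  proof (rule ccontr)
    assume ne: "q \<noteq> q'"
    have "B q \<inter> B q' \<subseteq> ends q \<inter> ends q'"
      using inner(1)[OF q(1)] inner(1)[OF q(2)] inner(3)[OF q ne] Q(1)[OF q(1)] Q(1)[OF q(2)] unfolding B_def by blast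
    then have sub: "e \<subseteq> ends q" "e \<subseteq> ends q'" using e by blast+
    have "e = ends q" using card_seteq[OF finends[OF q(1)] sub(1)] e(3) Q(1)[OF q(1)] by simp
    moreover have "e = ends q'" using card_seteq[OF finends[OF q(2)] sub(2)] e(3) Q(1)[OF q(2)] by simp
    ultimately show False using inj_onD[OF Q(2) _ q] ne by simp
  qed
  have disj: "D q \<inter> D q' = {}" if "q \<in> Q" "q' \<in> Q" "q \<noteq> q'" for q q'
    using cap[OF that(1,2)] eS(3) that(3) unfolding D_def by blast
  have cover: "\<exists>q\<in>Q. e \<in> D q" if "e \<in> ?E" for e
    using L[of e] S(2) that unfolding D_def B_def by blast
  have deg2: "card {e\<in>?E. v \<in> e} \<in> {0, 2}" for v
  proof (cases "v \<in> verts S")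
    case True
    then show ?thesis using cycle_copy_degree[OF S(1) k] by simp
  next
    case False
    then have "{e\<in>?E. v \<in> e} = {}" using eS(2) by blast
    then show ?thesis by (metis card.empty insertI1)
  qed
  have inner_deg: "{e\<in>D q. v \<in> e} = {e\<in>?E. v \<in> e}" if q: "q \<in> Q" and v: "v \<in> inner q" for q v
  proof
    show "{e\<in>D q. v \<in> e} \<subseteq> {e\<in>?E. v \<in> e}" unfolding D_def by blast
    show "{e\<in>?E. v \<in> e} \<subseteq> {e\<in>D q. v \<in> e}"
    proof
      fix e assume "e \<in> {e\<in>?E. v \<in> e}"
      then obtain q' where q': "q' \<in> Q" "e \<in> D q'" "v \<in> e" using cover by blast
      then have "v \<in> B q'" unfolding D_def by blast
      moreover have "v \<notin> U" using inner(1)[OF q] v by blast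
      ultimately have "v \<in> inner q'" using Q(1)[OF q'(1)] unfolding B_def by blast
      then have "q = q'" using inner(3)[OF q q'(1)] v by blast
      then show "e \<in> {e\<in>D q. v \<in> e}" using q' by blast
    qed
  qed
  have proper: "D q \<noteq> ?E" if q: "q \<in> Q" for q
  proof
    assume eq: "D q = ?E"
    have "verts S \<subseteq> B q"
    proof
      fix v assume "v \<in> verts S"
      then have "card {e\<in>?E. v \<in> e} = 2" by (rule cycle_copy_degree[OF S(1) k])
      then have "{e\<in>?E. v \<in> e} \<noteq> {}" by (metis card.empty zero_neq_numeral)
      then show "v \<in> B q" using eq unfolding D_def by blast
    qed
    then have "k \<le> card (B q)" using card_mono[OF finB[OF q]] cycle_copy_card(1)[OF S(1) k] by metis
    then show False using inner(4)[OF q] unfolding B_def by simp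
  qed
  \<comment> \<open>The part of the cycle in one block is proper, so it has a vertex of degree 1.
    Inner vertices keep their full degree 0 or 2, hence this vertex is an end of the block. By
    double counting of incidences the other end has odd degree as well, and as the degree is at most
    2, it is 1.\<close>
  have ends_deg: "card {e\<in>D q. v \<in> e} = 1" if q: "q \<in> Q" "D q \<noteq> {}" and v: "v \<in> ends q" for q v
  proof -
    have "\<not> (\<forall>v\<in>verts S. card {e\<in>D q. v \<in> e} \<noteq> 1)"
      using cycle_copy_minimal[OF S(1) k _ q(2)] proper[OF q(1)] unfolding D_def by blast
    then obtain x where x: "card {e\<in>D q. x \<in> e} = 1" by blast
    then have "{e\<in>D q. x \<in> e} \<noteq> {}" by (metis card.empty zero_neq_one)
    then have xB: "x \<in> B q" unfolding D_def by blast
    have "x \<notin> inner q"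
    proof
      assume "x \<in> inner q"
      then have "card {e\<in>?E. x \<in> e} = 1" using x inner_deg[OF q(1)] by simp
      then show False using deg2[of x] by simp
    qed
    then have xe: "x \<in> ends q" using xB unfolding B_def by blast
    show ?thesis
    proof (cases "v = x")
      case False
      then have "ends q = {x, v}"
        using card_seteq[OF finends[OF q(1)], of "{x, v}"] xe v Q(1)[OF q(1)] by simp
      moreover have "inner q \<inter> ends q = {}" using inner(1)[OF q(1)] Q(1)[OF q(1)] by blast
      ultimately have "(\<Sum>u\<in>B q. card {e\<in>D q. u \<in> e})
          = (\<Sum>u\<in>inner q. card {e\<in>D q. u \<in> e}) + (1 + card {e\<in>D q. v \<in> e})"
        unfolding B_def using False x inner(2)[OF q(1)] by (subst sum.union_disjoint) (auto simp: add.commute)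
      moreover have "even (\<Sum>u\<in>inner q. card {e\<in>D q. u \<in> e})"
      proof (rule dvd_sum)
        fix u assume "u \<in> inner q"
        then have "card {e\<in>D q. u \<in> e} \<in> {0, 2}" using inner_deg[OF q(1)] deg2[of u] by simp
        then show "even (card {e\<in>D q. u \<in> e})" by auto
      qed
      moreover have "even (\<Sum>u\<in>B q. card {e\<in>D q. u \<in> e})"
      proof -
        have "(\<Sum>u\<in>B q. card {e\<in>D q. u \<in> e}) = (\<Sum>u\<in>B q. \<Sum>e\<in>D q. if u \<in> e then 1 else 0)"
          by (simp only: card_eq_sum sum.inter_filter[OF finD])
        also have "\<dots> = (\<Sum>e\<in>D q. \<Sum>u\<in>B q. if u \<in> e then 1 else 0)" by (rule sum.swap)
        also have "\<dots> = (\<Sum>e\<in>D q. 2)"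
        proof (rule sum.cong[OF refl])
          fix e assume e: "e \<in> D q"
          have "(\<Sum>u\<in>B q. if u \<in> e then 1 else 0) = card (B q \<inter> e)"
            using finB[OF q(1)] by (simp add: sum.If_cases)
          also have "B q \<inter> e = e" using e unfolding D_def by blast
          also have "card e = 2" using e eS(3) unfolding D_def by blast
          finally show "(\<Sum>u\<in>B q. if u \<in> e then 1 else 0) = (2::nat)" .
        qed
        finally show ?thesis by simp
      qed
      ultimately have odd: "odd (card {e\<in>D q. v \<in> e})" by simp
      have "card {e\<in>D q. v \<in> e} \<le> card {e\<in>?E. v \<in> e}"
        by (rule card_mono) (use finE in \<open>auto simp: D_def\<close>)
      also have "\<dots> \<le> 2" using deg2[of v] by auto
      finally show ?thesis using odd by (cases "card {e\<in>D q. v \<in> e} = 2") (auto simp: le_Suc_eq numeral_2_eq_2)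
    qed (use x in simp)
  qed
  define M where "M = {q\<in>Q. D q \<noteq> {}}"
  have UM: "?E = (\<Union>q\<in>M. D q)"
  proof
    show "?E \<subseteq> (\<Union>q\<in>M. D q)"
    proof
      fix e assume "e \<in> ?E"
      then obtain q where "q \<in> Q" "e \<in> D q" using cover by blast
      then show "e \<in> (\<Union>q\<in>M. D q)" unfolding M_def by blast
    qed
    show "(\<Union>q\<in>M. D q) \<subseteq> ?E" unfolding D_def by blast
  qed
  have "inj_on D M"
  proof (rule inj_onI)
    fix q q' assume "q \<in> M" "q' \<in> M" "D q = D q'"
    then show "q = q'" using disj[of q q'] unfolding M_def by blast
  qed
  moreover have "D ` M \<subseteq> Pow ?E" unfolding D_def by blast
  ultimately have finM: "finite M" using finE inj_on_finite by (metis finite_Pow_iff)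
  have "card ?E = (\<Sum>q\<in>M. card (D q))"
    unfolding UM by (rule card_UN_disjoint) (use finM finD disj in \<open>auto simp: M_def\<close>)
  moreover have "card M \<le> (\<Sum>q\<in>M. card (D q))"
  proof -
    have "1 \<le> card (D q)" if "q \<in> M" for q
      using that finD[of q] card_gt_0_iff[of "D q"] unfolding M_def by simp
    then have "(\<Sum>q\<in>M. 1) \<le> (\<Sum>q\<in>M. card (D q))" by (rule sum_mono)
    then show ?thesis by simp
  qed
  \<comment> \<open>Each block in \<open>M\<close> takes at least one of the at most
    \<open>k\<close> edges of the cycle. The contradiction comes from the other side, as
    \<open>M\<close> is an even set of base edges.\<close>
  ultimately have "card M \<le> k" using cycle_copy_card(2)[OF S(1) k] by simp
  moreover have "k < card M"
  proof (rule girth)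
    show "M \<subseteq> Q" unfolding M_def by blast
    show "finite M" by (rule finM)
    show "M \<noteq> {}" using UM cycle_copy_card(4)[OF S(1) k] by blast
    fix v
    let ?Mv = "{q\<in>M. v \<in> ends q}"
    show "card ?Mv \<in> {0, 2}"
    proof (cases "v \<in> U")
      case False
      then have "?Mv = {}" using Q(1) unfolding M_def by blast
      then show ?thesis by (metis card.empty insertI1)
    next
      case True
      \<comment> \<open>At a base vertex every block of \<open>M\<close> that ends there contributes
        exactly one edge of the cycle, so the degrees in \<open>M\<close> and in the cycle
        agree.\<close>
      have "{e\<in>?E. v \<in> e} = (\<Union>q\<in>?Mv. {e\<in>D q. v \<in> e})"
      proof
        show "{e\<in>?E. v \<in> e} \<subseteq> (\<Union>q\<in>?Mv. {e\<in>D q. v \<in> e})"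
        proof
          fix e assume e: "e \<in> {e\<in>?E. v \<in> e}"
          then obtain q where q: "q \<in> M" "e \<in> D q" using UM by blast
          then have "v \<in> B q" using e unfolding D_def by blast
          then have "v \<in> ends q" using True inner(1)[of q] q(1) unfolding B_def M_def by blast
          then show "e \<in> (\<Union>q\<in>?Mv. {e\<in>D q. v \<in> e})" using q e by blast
        qed
        show "(\<Union>q\<in>?Mv. {e\<in>D q. v \<in> e}) \<subseteq> {e\<in>?E. v \<in> e}" unfolding D_def by blast
      qed
      then have "card {e\<in>?E. v \<in> e} = card (\<Union>q\<in>?Mv. {e\<in>D q. v \<in> e})" by (rule arg_cong)
      also have "\<dots> = (\<Sum>q\<in>?Mv. card {e\<in>D q. v \<in> e})"
      proof (rule card_UN_disjoint)
        show "finite ?Mv" using finM by simp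
        show "\<forall>q\<in>?Mv. finite {e\<in>D q. v \<in> e}" using finD by simp
        show "\<forall>q\<in>?Mv. \<forall>q'\<in>?Mv. q \<noteq> q' \<longrightarrow> {e\<in>D q. v \<in> e} \<inter> {e\<in>D q'. v \<in> e} = {}"
          using disj unfolding M_def by blast
      qed
      also have "\<dots> = (\<Sum>q\<in>?Mv. 1)"
        by (rule sum.cong[OF refl]) (use ends_deg in \<open>simp add: M_def\<close>)
      finally have "card ?Mv = card {e\<in>?E. v \<in> e}" by simp
      then show ?thesis using deg2[of v] by simp
    qed
  qed
  ultimately show False by simp
qed

section \<open>The base graph\<close>

text \<open>\<open>Pt i t\<close> is the vertex at distance \<open>t\<close> from \<open>Top\<close>
  along path \<open>i\<close>, \<open>Ctr\<close> gives the centres of the faces, and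
  \<open>Inner e j\<close> is inner vertex \<open>j\<close> of the block that replaces the base edge
  \<open>e\<close>.\<close>

datatype vertex = Top | Bot | Pt nat nat | Ctr nat | Inner "vertex \<times> vertex" nat

definition mid :: "nat \<Rightarrow> nat \<Rightarrow> nat" where
  "mid k i = (if even i then k div 2 else k - k div 2)"

definition pt :: "nat \<Rightarrow> nat \<Rightarrow> nat \<Rightarrow> vertex" where
  "pt k i t = (if t = 0 then Top else if t = k then Bot else Pt i t)"

definition path_edge :: "nat \<Rightarrow> nat \<Rightarrow> nat \<Rightarrow> vertex \<times> vertex" where
  "path_edge k i t = (pt k i t, pt k i (Suc t))"

definition rung :: "nat \<Rightarrow> nat \<Rightarrow> vertex \<times> vertex" where
  "rung k i = (Pt i (mid k i), Pt (Suc i) (mid k (Suc i)))"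

text \<open>\<open>q\<close> paths of length \<open>k\<close> from \<open>Top\<close> to \<open>Bot\<close>, the edge between \<open>Top\<close> and \<open>Bot\<close>, and a rung between the
  middle vertices of consecutive paths. For odd \<open>k\<close> the two unequal halves of the paths alternate,
  which makes every face a cycle of length \<open>k + 1\<close>.\<close>

definition base :: "nat \<Rightarrow> nat \<Rightarrow> (vertex \<times> vertex) set" where
  "base k q = insert (Top, Bot) ((\<lambda>(i, t). path_edge k i t) ` ({..<q} \<times> {..<k}) \<union> rung k ` {i. Suc i < q})"

definition ends :: "vertex \<times> vertex \<Rightarrow> vertex set" where
  "ends e = {fst e, snd e}"

lemma base_cases:
  assumes "e \<in> base k q"
  obtains (TB) "e = (Top, Bot)" | (path_edge) i t where "e = path_edge k i t" "i < q" "t < k"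
  | (rung) i where "e = rung k i" "Suc i < q"
  using assms unfolding base_def by auto

lemma base_intros:
  "(Top, Bot) \<in> base k q" "i < q \<Longrightarrow> t < k \<Longrightarrow> path_edge k i t \<in> base k q" "Suc i < q \<Longrightarrow> rung k i \<in> base k q"
  unfolding base_def by auto

lemma mid_bounds:
  assumes "5 \<le> k"
  shows "0 < mid k i" "mid k i < k" "k div 2 \<le> mid k i" "k div 2 \<le> k - mid k i" "mid k i + mid k (Suc i) = k"
  using assms unfolding mid_def by auto

lemma path_edge_inj:
  assumes "path_edge k i t = path_edge k j u" "t < k" "u < k" "2 \<le> k"
  shows "i = j \<and> t = u"
  using assms unfolding path_edge_def pt_def by (auto split: if_splits)

lemma path_edge_neq:
  assumes "2 \<le> k" "t < k"
  shows "path_edge k i t \<noteq> (Top, Bot)" "path_edge k i t \<noteq> rung k j"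
  using assms unfolding path_edge_def rung_def pt_def by (auto split: if_splits)

lemma rung_neq: "rung k i \<noteq> (Top, Bot)" "rung k i = rung k j \<longleftrightarrow> i = j"
  unfolding rung_def by auto

lemma incident_Top:
  assumes "e \<in> base k q" "Top \<in> ends e"
  shows "e = (Top, Bot) \<or> (\<exists>i<q. e = path_edge k i 0)"
  using assms(1)
proof (cases rule: base_cases)
  case (path_edge i t)
  then show ?thesis using assms(2) by (auto simp: ends_def path_edge_def pt_def split: if_splits)
qed (use assms in \<open>auto simp: ends_def rung_def\<close>)

lemma incident_Bot:
  assumes "e \<in> base k q" "Bot \<in> ends e"
  shows "e = (Top, Bot) \<or> (\<exists>i<q. e = path_edge k i (k - 1))"
  using assms(1)
proof (cases rule: base_cases)
  case (path_edge i t)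
  then have "t = k - 1" using assms(2) by (auto simp: ends_def path_edge_def pt_def split: if_splits)
  then show ?thesis using path_edge by blast
qed (use assms in \<open>auto simp: ends_def rung_def\<close>)

lemma incident_Pt:
  assumes "e \<in> base k q" "Pt i t \<in> ends e"
  shows "e = path_edge k i (t - 1) \<or> e = path_edge k i t \<or>
    t = mid k i \<and> (e = rung k i \<and> Suc i < q \<or> 0 < i \<and> e = rung k (i - 1))"
  using assms(1)
proof (cases rule: base_cases)
  case (path_edge j u)
  then show ?thesis using assms(2) by (auto simp: ends_def path_edge_def pt_def split: if_splits)
qed (use assms in \<open>auto simp: ends_def rung_def\<close>)

lemma ends_path_edge: "ends (path_edge k i t) = {pt k i t, pt k i (Suc t)}"
  by (simp add: ends_def path_edge_def)

lemma ends_inj: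
  assumes "2 \<le> k"
  shows "inj_on ends (base k q)"
proof (rule inj_onI)
  fix e f assume e: "e \<in> base k q" "f \<in> base k q" "ends e = ends f"
  have pp: "path_edge k i t = path_edge k j u"
    if "ends (path_edge k i t) = ends (path_edge k j u)" "t < k" "u < k" for i t j u
    using that assms unfolding ends_def path_edge_def pt_def by (auto simp: doubleton_eq_iff split: if_splits)
  have pr: "ends (path_edge k i t) \<noteq> ends (rung k j)" if "t < k" for i t j
    using that assms unfolding path_edge_def rung_def ends_def pt_def by (auto simp: doubleton_eq_iff split: if_splits)
  have pT: "ends (path_edge k i t) \<noteq> ends (Top, Bot)" if "t < k" for i t
    using that assms unfolding path_edge_def ends_def pt_def by (auto simp: doubleton_eq_iff split: if_splits)
  have rr: "rung k i = rung k j" if "ends (rung k i) = ends (rung k j)" for i j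
    using that unfolding ends_def rung_def by (auto simp: doubleton_eq_iff)
  have rT: "ends (rung k i) \<noteq> ends (Top, Bot)" for i
    unfolding ends_def rung_def by (auto simp: doubleton_eq_iff)
  show "e = f" using e(1)
  proof (cases rule: base_cases)
    case TB
    show ?thesis using e(2) by (cases rule: base_cases) (use e(3) TB pT rT in metis)+
  next
    case (path_edge i t)
    show ?thesis using e(2) by (cases rule: base_cases) (use e(3) path_edge pT pr pp in metis)+
  next
    case (rung i)
    show ?thesis using e(2) by (cases rule: base_cases) (use e(3) rung rT pr rr in metis)+
  qed
qed

lemma finite_base: "finite (base k q)"
proof -
  have "finite {i. Suc i < q}" by (rule finite_subset[of _ "{..<q}"]) auto
  then show ?thesis unfolding base_def by simp
qed

text \<open>There are \<open>q * k\<close> path edges, \<open>q - 1\<close> rungs and the edge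
  between \<open>Top\<close> and \<open>Bot\<close>.\<close>

lemma card_base:
  assumes "2 \<le> k" "0 < q"
  shows "card (base k q) = q * (k + 1)"
proof -
  let ?P = "(\<lambda>(i, t). path_edge k i t) ` ({..<q} \<times> {..<k})" and ?R = "rung k ` {i. Suc i < q}"
  have "inj_on (\<lambda>(i, t). path_edge k i t) ({..<q} \<times> {..<k})"
    using path_edge_inj[OF _ _ _ assms(1)] by (auto simp: inj_on_def)
  then have P: "card ?P = q * k" by (simp add: card_image)
  have "{i. Suc i < q} = {..<q - 1}" by auto
  moreover have "inj_on (rung k) {..<q - 1}" by (auto simp: inj_on_def rung_neq)
  ultimately have R: "card ?R = q - 1" by (simp add: card_image)
  have fin: "finite ?P" "finite ?R" using finite_base[of k q] by (simp_all add: base_def)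
  have "?P \<inter> ?R = {}" using path_edge_neq(2)[OF assms(1), THEN not_sym] by auto
  then have PR: "card (?P \<union> ?R) = q * k + (q - 1)" using card_Un_disjoint[OF fin] P R by simp
  have "(Top, Bot) \<notin> ?P \<union> ?R" using path_edge_neq(1)[OF assms(1), THEN not_sym] rung_neq(1)[THEN not_sym] by auto
  then have "card (base k q) = Suc (q * k + (q - 1))" unfolding base_def using fin PR by simp
  then show ?thesis using assms(2) by (simp add: algebra_simps)
qed

lemma card_disjoint_parts_le:
  assumes "finite D" "A \<subseteq> D" "B \<subseteq> D" "R \<subseteq> D" "A \<inter> B = {}" "A \<inter> R = {}" "B \<inter> R = {}"
  shows "card A + card B + card R \<le> card D"
proof -
  have fin: "finite A" "finite B" "finite R" by (rule finite_subset[OF _ assms(1)], fact)+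
  have "card A + card B + card R = card (A \<union> B) + card R" using card_Un_disjoint[OF fin(1,2) assms(5)] by simp
  also have "\<dots> = card (A \<union> B \<union> R)" using fin assms(6,7) by (subst card_Un_disjoint) auto
  also have "\<dots> \<le> card D" using assms by (intro card_mono) auto
  finally show ?thesis .
qed

text \<open>The vertices \<open>v i = Pt i (mid k i)\<close> cut every path into two halves, each of which \<open>D\<close>
  contains or avoids; two halves already have \<open>k - 1\<close> edges.\<close>

lemma base_girth:
  assumes k: "5 \<le> k" and D: "D \<subseteq> base k q" "finite D" "D \<noteq> {}"
    and deg: "\<And>v. card {e\<in>D. v \<in> ends e} \<in> {0, 2}"
  shows "k < card D"
proof -
  have k2: "2 \<le> k" using k by simp
  note m = mid_bounds[OF k]
  have other: "\<exists>f\<in>D. f \<noteq> e \<and> v \<in> ends f" if e: "e \<in> D" "v \<in> ends e" for e v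
  proof (rule ccontr)
    assume "\<not> (\<exists>f\<in>D. f \<noteq> e \<and> v \<in> ends f)"
    then have "{f\<in>D. v \<in> ends f} = {e}" using e by blast
    then show False using deg[of v] by simp
  qed
  define upper where "upper i = path_edge k i ` {..<mid k i}" for i
  define lower where "lower i = path_edge k i ` {mid k i..<k}" for i
  have inj: "inj_on (path_edge k i) {..<k}" for i
    using path_edge_inj[OF _ _ _ k2] by (auto simp: inj_on_def)
  have card_upper: "card (upper i) = mid k i" for i
    unfolding upper_def using inj_on_subset[OF inj[of i], of "{..<mid k i}"] m(2)[of i] by (simp add: card_image)
  have card_lower: "card (lower i) = k - mid k i" for i
    unfolding lower_def using inj_on_subset[OF inj[of i], of "{mid k i..<k}"] by (simp add: card_image subset_iff)
  \<comment> \<open>Away from the cut, an inner vertex of a path has no other base edges than these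
    two.\<close>
  have pass: "path_edge k i t \<in> D \<longleftrightarrow> path_edge k i (Suc t) \<in> D" if t: "Suc t < k" "Suc t \<noteq> mid k i" for i t
  proof -
    have v: "Pt i (Suc t) \<in> ends (path_edge k i t)" "Pt i (Suc t) \<in> ends (path_edge k i (Suc t))"
      using t(1) unfolding ends_path_edge pt_def by auto
    have inc: "f = path_edge k i t \<or> f = path_edge k i (Suc t)" if "f \<in> D" "Pt i (Suc t) \<in> ends f" for f
    proof -
      have "f \<in> base k q" using D(1) \<open>f \<in> D\<close> by blast
      from incident_Pt[OF this \<open>Pt i (Suc t) \<in> ends f\<close>] show ?thesis using t(2) by auto
    qed
    show ?thesis using other[OF _ v(1)] other[OF _ v(2)] inc by metis
  qed
  have up: "path_edge k i t \<in> D \<longleftrightarrow> path_edge k i 0 \<in> D" if "t < mid k i" for i t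
    using that
  proof (induction t)
    case (Suc t)
    then show ?case using pass[of t i] m(2)[of i] by simp
  qed simp
  have low: "path_edge k i (k - 1 - t) \<in> D \<longleftrightarrow> path_edge k i (k - 1) \<in> D" if "t < k - mid k i" for i t
    using that
  proof (induction t)
    case (Suc t)
    have "Suc (k - 1 - Suc t) = k - 1 - t" "k - 1 - t < k" "k - 1 - t \<noteq> mid k i" using Suc.prems by auto
    then show ?case using Suc pass[of "k - 1 - Suc t" i] by simp
  qed simp
  have upper_sub: "upper i \<subseteq> D" if "path_edge k i 0 \<in> D" for i
    unfolding upper_def using up[of _ i] that by blast
  have lower_sub: "lower i \<subseteq> D" if "path_edge k i (k - 1) \<in> D" for i
  proof
    fix e assume "e \<in> lower i"
    then obtain t where t: "mid k i \<le> t" "t < k" "e = path_edge k i t" unfolding lower_def by auto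
    then have "k - 1 - (k - 1 - t) = t" "k - 1 - t < k - mid k i" by auto
    then show "e \<in> D" using low[of "k - 1 - t" i] that t(3) by simp
  qed
  have half_cases: "path_edge k i 0 \<in> D \<or> path_edge k i (k - 1) \<in> D" if "path_edge k i t \<in> D" "t < k" for i t
  proof (cases "t < mid k i")
    case True
    then show ?thesis using up that by blast
  next
    case False
    then have "k - 1 - (k - 1 - t) = t" "k - 1 - t < k - mid k i" using that m(2)[of i] by auto
    then show ?thesis using low[of "k - 1 - t" i] that by simp
  qed
  have TopD: "e = (Top, Bot) \<or> (\<exists>i<q. e = path_edge k i 0)" if "e \<in> D" "Top \<in> ends e" for e
    by (rule incident_Top) (use that D(1) in blast)+
  have BotD: "e = (Top, Bot) \<or> (\<exists>i<q. e = path_edge k i (k - 1))" if "e \<in> D" "Bot \<in> ends e" for e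
    by (rule incident_Bot) (use that D(1) in blast)+
  have at_mid: "path_edge k i (mid k i - 1) \<in> D \<longleftrightarrow> path_edge k i 0 \<in> D"
      "path_edge k i (mid k i) \<in> D \<longleftrightarrow> path_edge k i (k - 1) \<in> D" for i
  proof -
    show "path_edge k i (mid k i - 1) \<in> D \<longleftrightarrow> path_edge k i 0 \<in> D" using up[of "mid k i - 1" i] m(1)[of i] by simp
    have "k - 1 - (k - 1 - mid k i) = mid k i" "k - 1 - mid k i < k - mid k i" using m(2)[of i] by auto
    then show "path_edge k i (mid k i) \<in> D \<longleftrightarrow> path_edge k i (k - 1) \<in> D" using low[of "k - 1 - mid k i" i] by simp
  qed
  define rungs where "rungs i = {e\<in>D. Pt i (mid k i) \<in> ends e \<and> (e = rung k i \<or> 0 < i \<and> e = rung k (i - 1))}" for i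
  \<comment> \<open>If \<open>D\<close> contains only one half of a path, it has to leave the path
    at the cut along a rung.\<close>
  have rungs_ne: "rungs i \<noteq> {}" if "(path_edge k i 0 \<in> D) \<noteq> (path_edge k i (k - 1) \<in> D)" for i
  proof -
    let ?v = "Pt i (mid k i)"
    have v: "?v \<in> ends (path_edge k i (mid k i - 1))" "?v \<in> ends (path_edge k i (mid k i))"
      using m(1)[of i] m(2)[of i] unfolding ends_path_edge pt_def by auto
    have inc: "f \<in> rungs i \<or> f = path_edge k i (mid k i - 1) \<or> f = path_edge k i (mid k i)"
      if f: "f \<in> D" "?v \<in> ends f" for f
    proof -
      have "f \<in> base k q" using D(1) f(1) by blast
      from incident_Pt[OF this f(2)] show ?thesis using f unfolding rungs_def by blast
    qed
    show ?thesis using that other[OF _ v(1)] other[OF _ v(2)] inc at_mid by (metis empty_iff)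
  qed
  have dis: "upper i \<inter> upper j = {}" "lower i \<inter> lower j = {}" if "i \<noteq> j" for i j
    using that path_edge_inj[OF _ _ _ k2] m(2) unfolding upper_def lower_def by (auto, (metis less_trans)+)
  have dis': "upper i \<inter> lower j = {}" for i j
  proof -
    have "False" if e: "e \<in> upper i" "e \<in> lower j" for e
    proof -
      obtain t u where tu: "t < mid k i" "mid k j \<le> u" "u < k" "e = path_edge k i t" "e = path_edge k j u"
        using e unfolding upper_def lower_def by auto
      have "i = j \<and> t = u" by (rule path_edge_inj[OF _ _ tu(3) k2]) (use tu m(2)[of i] in auto)
      then show False using tu by simp
    qed
    then show ?thesis by blast
  qed
  have disR: "upper i \<inter> rungs j = {}" "lower i \<inter> rungs j = {}" for i j
    using path_edge_neq(2)[OF k2] m(2)[of i] unfolding upper_def lower_def rungs_def by (auto, (metis less_trans)+)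
  have rungsD: "rungs i \<subseteq> D" for i unfolding rungs_def by blast
  have f: "k \<le> 2 * (k div 2) + 1" by simp
  \<comment> \<open>\<open>H\<close> stands for \<open>upper\<close> or \<open>lower\<close>. On
    consecutive paths the two halves have \<open>k\<close> edges together, and one rung is enough.
    On other paths they may have \<open>k - 1\<close> edges only, but then the rungs at the two cuts
    are different.\<close>
  have key: "k < card D"
    if ij: "i < j" and H: "H i \<subseteq> D" "H j \<subseteq> D" "H i \<inter> H j = {}" "\<And>l l'. H l \<inter> rungs l' = {}"
      "k div 2 \<le> card (H i)" "k div 2 \<le> card (H j)" "j = Suc i \<Longrightarrow> card (H i) + card (H j) = k"
      and R: "rungs i \<noteq> {}" "rungs j \<noteq> {}" for i j and H :: "nat \<Rightarrow> (vertex \<times> vertex) set"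
  proof -
    obtain r r' where r: "r \<in> rungs i" "r' \<in> rungs j" using R by blast
    have rD: "{r, r'} \<subseteq> D" using r rungsD by blast
    have dr: "H l \<inter> {r, r'} = {}" for l using r H(4)[of l i] H(4)[of l j] by blast
    have le: "card (H i) + card (H j) + card {r, r'} \<le> card D"
      by (rule card_disjoint_parts_le[OF D(2) H(1,2) rD H(3) dr dr])
    show ?thesis
    proof (cases "j = Suc i")
      case True
      have "1 \<le> card {r, r'}" by (simp add: card_insert_if)
      then show ?thesis using le H(7)[OF True] by linarith
    next
      case False
      have "r \<noteq> r'" using r ij False rung_neq(2)[of k] unfolding rungs_def by auto
      then have "card {r, r'} = 2" by simp
      then show ?thesis using le H(5,6) f by linarith
    qed
  qed
  have keyU: "k < card D" if "i \<noteq> j" "path_edge k i 0 \<in> D" "path_edge k j 0 \<in> D" "rungs i \<noteq> {}" "rungs j \<noteq> {}" for i j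
  proof -
    have "k < card D" if ij: "i < j" "path_edge k i 0 \<in> D" "path_edge k j 0 \<in> D" "rungs i \<noteq> {}" "rungs j \<noteq> {}" for i j
      by (rule key[of i j upper, OF ij(1) upper_sub[OF ij(2)] upper_sub[OF ij(3)] _ _ _ _ _ ij(4,5)])
        (use dis(1) disR ij(1) m in \<open>simp_all add: card_upper\<close>)
    then show ?thesis using that by (metis nat_neq_iff)
  qed
  have keyL: "k < card D" if "i \<noteq> j" "path_edge k i (k - 1) \<in> D" "path_edge k j (k - 1) \<in> D" "rungs i \<noteq> {}" "rungs j \<noteq> {}" for i j
  proof -
    have "(k - mid k i) + (k - mid k (Suc i)) = k" for i using m(5)[of i] by linarith
    then have "k < card D" if ij: "i < j" "path_edge k i (k - 1) \<in> D" "path_edge k j (k - 1) \<in> D" "rungs i \<noteq> {}" "rungs j \<noteq> {}" for i j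
      by (rule_tac key[of i j lower, OF ij(1) lower_sub[OF ij(2)] lower_sub[OF ij(3)] _ _ _ _ _ ij(4,5)])
        (use dis(2) disR ij(1) m in \<open>simp_all add: card_lower\<close>)
    then show ?thesis using that by (metis nat_neq_iff)
  qed
  show ?thesis
  proof (cases "(Top, Bot) \<in> D")
    case True
    \<comment> \<open>\<open>D\<close> continues from \<open>Top\<close> along an upper half and
      from \<open>Bot\<close> along a lower half. If path \<open>i\<close> lies in \<open>D\<close>
      entirely, it has \<open>k\<close> edges besides this one. Otherwise \<open>D\<close> leaves
      path \<open>i\<close> by a rung, and the two halves, the rung and this edge are
      enough.\<close>
    have "\<exists>e\<in>D. e \<noteq> (Top, Bot) \<and> Top \<in> ends e" "\<exists>e\<in>D. e \<noteq> (Top, Bot) \<and> Bot \<in> ends e"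
      using other[OF True, of Top] other[OF True, of Bot] by (simp_all add: ends_def)
    then obtain i j where ij: "path_edge k i 0 \<in> D" "path_edge k j (k - 1) \<in> D" using TopD BotD by metis
    have TB: "(Top, Bot) \<notin> upper i" "(Top, Bot) \<notin> lower i" "(Top, Bot) \<notin> rungs i" for i
    proof -
      show "(Top, Bot) \<notin> upper i" "(Top, Bot) \<notin> lower i"
        unfolding upper_def lower_def using path_edge_neq(1)[OF k2] m(2)[of i] by (metis imageE lessThan_iff less_trans, metis atLeastLessThan_iff imageE)
      show "(Top, Bot) \<notin> rungs i" unfolding rungs_def by (simp add: ends_def)
    qed
    show ?thesis
    proof (cases "path_edge k i (k - 1) \<in> D")
      case i: True
      have "card (upper i) + card (lower i) + card {(Top, Bot)} \<le> card D"
        by (rule card_disjoint_parts_le[OF D(2) upper_sub[OF ij(1)] lower_sub[OF i]]) (use True dis' TB in auto)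
      then show ?thesis using m(2)[of i] by (simp add: card_upper card_lower)
    next
      case False
      then obtain r where r: "r \<in> rungs i" using rungs_ne[of i] ij(1) by blast
      have "r \<in> D" using r rungsD by blast
      have "r \<notin> upper i" "r \<notin> lower j" using r disR[of i i] disR[of j i] by blast+
      then have "card (upper i) + card (lower j) + card {(Top, Bot), r} \<le> card D"
        by (intro card_disjoint_parts_le[OF D(2) upper_sub[OF ij(1)] lower_sub[OF ij(2)]]) (use True dis' TB \<open>r \<in> D\<close> in auto)
      moreover have "(Top, Bot) \<noteq> r" using TB(3)[of i] r by blast
      then have "card {(Top, Bot), r} = 2" by simp
      ultimately show ?thesis using m(3)[of i] m(4)[of j] f by (simp add: card_upper card_lower)
    qed
  next
    case False
    have two_upper: "\<exists>j. j \<noteq> i \<and> path_edge k j 0 \<in> D" if i: "path_edge k i 0 \<in> D" for i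
    proof -
      have "Top \<in> ends (path_edge k i 0)" by (simp add: ends_path_edge pt_def)
      then obtain e where e: "e \<in> D" "e \<noteq> path_edge k i 0" "Top \<in> ends e" using other[OF i] by blast
      then show ?thesis using TopD[OF e(1,3)] False by metis
    qed
    have two_lower: "\<exists>j. j \<noteq> i \<and> path_edge k j (k - 1) \<in> D" if i: "path_edge k i (k - 1) \<in> D" for i
    proof -
      have "Bot \<in> ends (path_edge k i (k - 1))" using k2 by (simp add: ends_path_edge pt_def)
      then obtain e where e: "e \<in> D" "e \<noteq> path_edge k i (k - 1)" "Bot \<in> ends e" using other[OF i] by blast
      then show ?thesis using BotD[OF e(1,3)] False by metis
    qed
    consider (both) i l where "path_edge k i 0 \<in> D" "path_edge k l (k - 1) \<in> D"
      | (upper) i where "path_edge k i 0 \<in> D" "\<And>l. path_edge k l (k - 1) \<notin> D"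
      | (lower) i where "path_edge k i (k - 1) \<in> D" "\<And>l. path_edge k l 0 \<notin> D"
      | (none) "\<And>l. path_edge k l 0 \<notin> D" "\<And>l. path_edge k l (k - 1) \<notin> D" by blast
    then show ?thesis
    proof cases
      case both
      obtain j where j: "j \<noteq> i" "path_edge k j 0 \<in> D" using two_upper[OF both(1)] by blast
      obtain h where h: "h \<noteq> l" "path_edge k h (k - 1) \<in> D" using two_lower[OF both(2)] by blast
      \<comment> \<open>Without the edge between them, \<open>Top\<close> and \<open>Bot\<close>
        need two halves each; four halves have at least \<open>2 * (k - 1)\<close> edges.\<close>
      have "card (upper i) + card (upper j) + card (lower l \<union> lower h) \<le> card D"
        by (rule card_disjoint_parts_le[OF D(2) upper_sub[OF both(1)] upper_sub[OF j(2)]])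
          (use lower_sub[OF both(2)] lower_sub[OF h(2)] dis(1)[OF j(1)] dis'[of i l] dis'[of i h] dis'[of j l] dis'[of j h] in blast)+
      moreover have "card (lower l \<union> lower h) = card (lower l) + card (lower h)"
        by (rule card_Un_disjoint) (use dis(2)[OF h(1)] in \<open>auto simp: lower_def\<close>)
      ultimately show ?thesis using m(3)[of i] m(3)[of j] m(4)[of l] m(4)[of h] f k
        by (simp add: card_upper card_lower)
    next
      case upper
      obtain j where j: "j \<noteq> i" "path_edge k j 0 \<in> D" using two_upper[OF upper(1)] by blast
      show ?thesis by (rule keyU[of i j]) (use j upper rungs_ne in auto)
    next
      case lower
      obtain j where j: "j \<noteq> i" "path_edge k j (k - 1) \<in> D" using two_lower[OF lower(1)] by blast
      show ?thesis by (rule keyL[of i j]) (use j lower rungs_ne in auto)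
    next
      case none
      have only: "\<exists>i. e = rung k i \<and> Suc i < q" if e: "e \<in> D" for e
      proof -
        have "e \<in> base k q" using e D(1) by blast
        then show ?thesis
        proof (cases rule: base_cases)
          case (path_edge i t)
          then show ?thesis using half_cases[of i t] none e by blast
        qed (use False e in auto)
      qed
      let ?I = "{i. rung k i \<in> D}"
      have "?I \<subseteq> {..<q}"
      proof
        fix i assume "i \<in> ?I"
        then obtain j where "rung k i = rung k j" "Suc j < q" using only by blast
        then show "i \<in> {..<q}" using rung_neq(2)[of k i j] by simp
      qed
      then have fin: "finite ?I" by (rule finite_subset) simp
      have ne: "?I \<noteq> {}" using D(3) only by blast
      \<comment> \<open>All rungs together form a path, so the rung of largest index in
        \<open>D\<close> has an end of degree 1.\<close>
      define i where "i = Max ?I"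
      have i: "rung k i \<in> D" "\<And>j. rung k j \<in> D \<Longrightarrow> j \<le> i" using Max_in[OF fin ne] Max_ge[OF fin] unfolding i_def by auto
      have "Pt (Suc i) (mid k (Suc i)) \<in> ends (rung k i)" by (simp add: rung_def ends_def)
      then obtain e where e: "e \<in> D" "e \<noteq> rung k i" "Pt (Suc i) (mid k (Suc i)) \<in> ends e" using other[OF i(1)] by blast
      obtain j where j: "e = rung k j" using only[OF e(1)] by blast
      have "j \<le> i" using i(2) e(1) j by simp
      then have "j < i" using e(2) j by (cases "j = i") simp_all
      then show ?thesis using e(3) j by (simp add: rung_def ends_def)
    qed
  qed
qed

section \<open>Stellating the base graph\<close>

text \<open>Refines the coarse path \<open>x\<close>, \<open>v\<close>, \<open>y\<close> to
  \<open>s\<close>. The two halves may lie between different pairs of centres. Of the result only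
  two things are kept: the faces away from the two coarse edges, and for each edge of
  \<open>s\<close> one face with a dead apex, in which its block will be placed.\<close>

lemma live_tri_split_path:
  assumes T: "live_tri W L Z G"
    and G: "{x, v, d} \<in> G" "{x, v, c} \<in> G" "{v, y, d'} \<in> G" "{v, y, c'} \<in> G"
    and W: "x \<in> W" "v \<in> W" "y \<in> W" and Z: "d \<in> Z" "c \<in> Z" "d' \<in> Z" "c' \<in> Z" "d \<noteq> c" "d' \<noteq> c'"
    and s: "s 0 = x" "s m = v" "s k = y" "0 < m" "m < k" "inj_on s {..k}"
      "\<And>t. 0 < t \<Longrightarrow> t < k \<Longrightarrow> t \<noteq> m \<Longrightarrow> s t \<notin> W \<union> Z"
  shows "\<exists>G'. live_tri (W \<union> s ` {0<..<k}) (L - {{x, v}, {v, y}} \<union> (\<lambda>t. {s t, s (Suc t)}) ` {..<k}) Z G' \<and>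
    {f\<in>G. \<not> {x, v} \<subseteq> f \<and> \<not> {v, y} \<subseteq> f} \<subseteq> G' \<and> (\<forall>t<k. \<exists>z\<in>Z. {s t, s (Suc t), z} \<in> G')"
proof -
  have ne: "x \<noteq> v" "x \<noteq> y" "v \<noteq> y"
    using inj_onD[OF s(6), of 0 m] inj_onD[OF s(6), of 0 k] inj_onD[OF s(6), of m k] s(1-5) by auto
  have dj: "W \<inter> Z = {}" by (rule live_tri_disjoint[OF T])
  \<comment> \<open>The faces at \<open>{v, y}\<close> contain \<open>y\<close>, so the subdivision
    of \<open>{x, v}\<close> does not remove them.\<close>
  have yn: "y \<notin> {x, v, d}" "y \<notin> {x, v, c}" using ne W Z dj by auto
  define W1 where "W1 = W \<union> s ` {0<..<m}"
  define L1 where "L1 = L - {{s 0, s m}} \<union> {{s t, s (Suc t)} | t. t < m}"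
  define G1 where "G1 = G - {{s 0, s m, d}, {s 0, s m, c}} \<union> {{s t, s (Suc t), d} | t. t < m} \<union> {{s t, s (Suc t), c} | t. t < m}"
  have T1: "live_tri W1 L1 Z G1"
    unfolding W1_def L1_def G1_def
  proof (rule live_tri_subdivide_path[OF T])
    show "inj_on s {..m}" by (rule inj_on_subset[OF s(6)]) (use s(5) in auto)
    show "s t \<notin> W \<union> Z" if "0 < t" "t < m" for t by (rule s(7)) (use that s(5) in auto)
  qed (use G W Z s in simp_all)
  define s' where "s' t = s (m + t)" for t
  have G1': "{s' 0, s' (k - m), d'} \<in> G1" "{s' 0, s' (k - m), c'} \<in> G1"
  proof -
    have "{v, y, z} \<in> G1" if "{v, y, z} \<in> G" for z
    proof -
      have "{v, y, z} \<noteq> {x, v, d}" "{v, y, z} \<noteq> {x, v, c}" using yn by blast+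
      then show ?thesis using that s(1,2) unfolding G1_def by simp
    qed
    then show "{s' 0, s' (k - m), d'} \<in> G1" "{s' 0, s' (k - m), c'} \<in> G1"
      using G(3,4) s(2,3,5) unfolding s'_def by simp_all
  qed
  define G2 where "G2 = G1 - {{s' 0, s' (k - m), d'}, {s' 0, s' (k - m), c'}} \<union>
    {{s' t, s' (Suc t), d'} | t. t < k - m} \<union> {{s' t, s' (Suc t), c'} | t. t < k - m}"
  have T2: "live_tri (W1 \<union> s' ` {0<..<k - m}) (L1 - {{s' 0, s' (k - m)}} \<union> {{s' t, s' (Suc t)} | t. t < k - m}) Z G2"
    unfolding G2_def
  proof (rule live_tri_subdivide_path[OF T1 G1'])
    show "inj_on s' {..k - m}"
    proof (rule inj_onI)
      fix a b assume "a \<in> {..k - m}" "b \<in> {..k - m}" "s' a = s' b"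
      then show "a = b" using inj_onD[OF s(6), of "m + a" "m + b"] s(5) unfolding s'_def by auto
    qed
    show "s' t \<notin> W1 \<union> Z" if t: "0 < t" "t < k - m" for t
    proof -
      have "s' t \<notin> W \<union> Z" unfolding s'_def by (rule s(7)) (use t in auto)
      moreover have ne: "s' t \<noteq> s u" if "u < m" for u
      proof -
        have "m + t \<le> k" "u \<le> k" "m + t \<noteq> u" using t that s(5) by linarith+
        then show ?thesis using inj_onD[OF s(6), of "m + t" u] unfolding s'_def by auto
      qed
      moreover have "s' t \<notin> s ` {0<..<m}"
      proof
        assume "s' t \<in> s ` {0<..<m}"
        then obtain u where "s' t = s u" "u \<in> {0<..<m}" by (rule imageE)
        then show False using ne[of u] by simp
      qed
      ultimately show ?thesis unfolding W1_def by blast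
    qed
  qed (use W Z s in \<open>simp_all add: s'_def W1_def\<close>)
  have eW: "W1 \<union> s' ` {0<..<k - m} = W \<union> s ` {0<..<k}"
  proof -
    have "s' ` {0<..<k - m} = s ` {m<..<k}"
    proof -
      have "x \<in> (+) m ` {0<..<k - m}" if "m < x" "x < k" for x
        by (rule image_eqI[of _ _ "x - m"]) (use that in simp_all)
      then have "(+) m ` {0<..<k - m} = {m<..<k}" by auto
      then show ?thesis unfolding s'_def by (metis image_image)
    qed
    moreover have "{0<..<k} = {0<..<m} \<union> {m} \<union> {m<..<k}" using s(4,5) by auto
    ultimately show ?thesis unfolding W1_def using s(2) W(2) by auto
  qed
  have split: "F ` {..<k} = F ` {..<m} \<union> (\<lambda>t. F (m + t)) ` {..<k - m}" for F :: "nat \<Rightarrow> 'a set"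
  proof -
    have "x \<in> (+) m ` {..<k - m}" if "m \<le> x" "x < k" for x
      by (rule image_eqI[of _ _ "x - m"]) (use that in simp_all)
    then have "(+) m ` {..<k - m} = {m..<k}" by auto
    then have "(\<lambda>t. F (m + t)) ` {..<k - m} = F ` {m..<k}" by (metis image_image)
    moreover have "{..<k} = {..<m} \<union> {m..<k}" using s(5) by auto
    ultimately show ?thesis by (simp add: image_Un)
  qed
  have img: "{F t | t. t < n} = F ` {..<n}" for F :: "nat \<Rightarrow> 'a set" and n by auto
  have eL: "L1 - {{s' 0, s' (k - m)}} \<union> {{s' t, s' (Suc t)} | t. t < k - m} =
    L - {{x, v}, {v, y}} \<union> (\<lambda>t. {s t, s (Suc t)}) ` {..<k}"
  proof -
    have "y \<notin> {s t, s (Suc t)}" if "t < m" for t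
      using inj_onD[OF s(6), of t k] inj_onD[OF s(6), of "Suc t" k] s(3,5) that by auto
    then have "{v, y} \<notin> (\<lambda>t. {s t, s (Suc t)}) ` {..<m}" by blast
    moreover have "{s' 0, s' (k - m)} = {v, y}" using s(2,3,5) by (simp add: s'_def)
    ultimately show ?thesis
      unfolding L1_def img split[of "\<lambda>t. {s t, s (Suc t)}"] using s(1,2) by (auto simp: s'_def)
  qed
  have "{f\<in>G. \<not> {x, v} \<subseteq> f \<and> \<not> {v, y} \<subseteq> f} \<subseteq> G2"
  proof
    fix f assume f: "f \<in> {f\<in>G. \<not> {x, v} \<subseteq> f \<and> \<not> {v, y} \<subseteq> f}"
    then have "f \<notin> {{s 0, s m, d}, {s 0, s m, c}}" using s(1,2) by blast
    then have "f \<in> G1" using f unfolding G1_def by blast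
    moreover have "f \<notin> {{s' 0, s' (k - m), d'}, {s' 0, s' (k - m), c'}}" using f s(2,3,5) unfolding s'_def by auto
    ultimately show "f \<in> G2" unfolding G2_def by blast
  qed
  moreover have "\<forall>t<k. \<exists>z\<in>Z. {s t, s (Suc t), z} \<in> G2"
  proof (intro allI impI)
    fix t assume t: "t < k"
    show "\<exists>z\<in>Z. {s t, s (Suc t), z} \<in> G2"
    proof (cases "t < m")
      case True
      have y: "y \<notin> {s t, s (Suc t), d}"
        using inj_onD[OF s(6), of t k] inj_onD[OF s(6), of "Suc t" k] s(3,5) True Z(1) W(3) dj by auto
      have "{s t, s (Suc t), d} \<in> G1" unfolding G1_def using True by blast
      moreover have "{s t, s (Suc t), d} \<notin> {{s' 0, s' (k - m), d'}, {s' 0, s' (k - m), c'}}"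
        using y s(3,5) unfolding s'_def by auto
      ultimately have "{s t, s (Suc t), d} \<in> G2" unfolding G2_def by blast
      then show ?thesis using Z(1) by blast
    next
      case False
      then have "{s' (t - m), s' (Suc (t - m)), d'} \<in> G2" unfolding G2_def using t by force
      then show ?thesis using False Z(3) by (intro bexI[of _ d']) (simp_all add: s'_def)
    qed
  qed
  ultimately show ?thesis using T2 unfolding eW eL by (intro exI[of _ G2] conjI)
qed

section \<open>The base graph and its centres, grown path by path\<close>

abbreviation mid_vertex :: "nat \<Rightarrow> nat \<Rightarrow> vertex" where
  "mid_vertex k i \<equiv> Pt i (mid k i)"

text \<open>At stage \<open>i\<close> the paths before path \<open>i\<close> are complete, whereas
  path \<open>i\<close> still consists of the two coarse edges from its cut vertex to
  \<open>Top\<close> and \<open>Bot\<close>.\<close>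

definition stage_verts :: "nat \<Rightarrow> nat \<Rightarrow> vertex set" where
  "stage_verts k i = {Top, Bot, mid_vertex k i} \<union> (\<Union>j<i. pt k j ` {0<..<k})"

definition stage_base :: "nat \<Rightarrow> nat \<Rightarrow> (vertex \<times> vertex) set" where
  "stage_base k i = (\<Union>j<i. path_edge k j ` {..<k}) \<union> rung k ` {..<i}"

definition stage_edges :: "nat \<Rightarrow> nat \<Rightarrow> vertex set set" where
  "stage_edges k i = {{Top, Bot}, {Top, mid_vertex k i}, {mid_vertex k i, Bot}} \<union> ends ` stage_base k i"

lemma pt_inner: "0 < t \<Longrightarrow> t < k \<Longrightarrow> pt k i t = Pt i t"
  by (simp add: pt_def)

lemma pt_inj: "0 < k \<Longrightarrow> inj_on (pt k i) {..k}"
  by (auto simp: inj_on_def pt_def split: if_splits)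

text \<open>Ensures that the splitting of the two coarse edges of path \<open>i\<close> spares the
  finished base edges and the faces beside them.\<close>

lemma stage_base_ends:
  assumes "e \<in> stage_base k i" "5 \<le> k"
  shows "ends e \<subseteq> stage_verts k i" "\<not> {Top, mid_vertex k i} \<subseteq> ends e" "\<not> {mid_vertex k i, Bot} \<subseteq> ends e"
proof -
  have pt_mem: "pt k j t \<in> stage_verts k i" if "j < i" "t \<le> k" for j t
  proof (cases "t = 0 \<or> t = k")
    case True
    then show ?thesis unfolding stage_verts_def by (auto simp: pt_def)
  next
    case False
    then have "pt k j t \<in> pt k j ` {0<..<k}" using that by (intro imageI) simp
    then show ?thesis using that(1) unfolding stage_verts_def by blast
  qed
  have mid_mem: "mid_vertex k j \<in> stage_verts k i" if "j \<le> i" for j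
  proof (cases "j = i")
    case False
    then have "pt k j (mid k j) \<in> stage_verts k i" using that mid_bounds(2)[OF assms(2), of j] by (intro pt_mem) auto
    then show ?thesis using mid_bounds(1,2)[OF assms(2), of j] by (simp add: pt_inner)
  qed (simp add: stage_verts_def)
  consider j t where "e = path_edge k j t" "j < i" "t < k" | j where "e = rung k j" "j < i"
    using assms(1) unfolding stage_base_def by blast
  then have "ends e \<subseteq> stage_verts k i \<and> \<not> {Top, mid_vertex k i} \<subseteq> ends e \<and> \<not> {mid_vertex k i, Bot} \<subseteq> ends e"
  proof cases
    case 1
    then have "mid_vertex k i \<notin> ends e" by (auto simp: ends_path_edge pt_def)
    then show ?thesis using 1 pt_mem[of j t] pt_mem[of j "Suc t"] by (simp add: ends_path_edge)
  next
    case 2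
    then show ?thesis using mid_mem[of j] mid_mem[of "Suc j"] by (simp add: ends_def rung_def)
  qed
  then show "ends e \<subseteq> stage_verts k i" "\<not> {Top, mid_vertex k i} \<subseteq> ends e" "\<not> {mid_vertex k i, Bot} \<subseteq> ends e"
    by blast+
qed

lemma stage_verts_simps:
  "Top \<in> stage_verts k i" "Bot \<in> stage_verts k i" "mid_vertex k i \<in> stage_verts k i"
  "Ctr n \<notin> stage_verts k i" "Pt (Suc i) t \<notin> stage_verts k i"
  "Pt i t \<in> stage_verts k i \<longleftrightarrow> t = mid k i"
  by (auto simp: stage_verts_def pt_def split: if_splits)

lemma stage_split:
  assumes k: "5 \<le> k" and T: "live_tri W L Z G"
    and W: "stage_verts k i \<subseteq> W" "\<And>t. t \<noteq> mid k i \<Longrightarrow> Pt i t \<notin> W \<union> Z"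
    and G: "{Top, mid_vertex k i, d} \<in> G" "{Top, mid_vertex k i, c} \<in> G"
      "{mid_vertex k i, Bot, d'} \<in> G" "{mid_vertex k i, Bot, c'} \<in> G"
    and Z: "d \<in> Z" "c \<in> Z" "d' \<in> Z" "c' \<in> Z" "d \<noteq> c" "d' \<noteq> c'"
  shows "\<exists>G'. live_tri (W \<union> pt k i ` {0<..<k})
      (L - {{Top, mid_vertex k i}, {mid_vertex k i, Bot}} \<union> ends ` path_edge k i ` {..<k}) Z G' \<and>
    {f\<in>G. \<not> {Top, mid_vertex k i} \<subseteq> f \<and> \<not> {mid_vertex k i, Bot} \<subseteq> f} \<subseteq> G' \<and>
    (\<forall>t<k. \<exists>z\<in>Z. ends (path_edge k i t) \<union> {z} \<in> G')"
proof -
  have eq: "ends (path_edge k i t) \<union> {z} = {pt k i t, pt k i (Suc t), z}" for t z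
    by (auto simp: ends_path_edge)
  have img: "ends ` path_edge k i ` {..<k} = (\<lambda>t. {pt k i t, pt k i (Suc t)}) ` {..<k}"
    by (simp add: image_image ends_path_edge)
  show ?thesis unfolding eq img
  proof (rule live_tri_split_path[OF T G _ _ _ Z, where m = "mid k i"])
    show "Top \<in> W" "mid_vertex k i \<in> W" "Bot \<in> W" using W(1) stage_verts_simps(1-3) by blast+
    show "pt k i 0 = Top" "pt k i k = Bot" using k by (simp_all add: pt_def)
    show "0 < mid k i" "mid k i < k" by (rule mid_bounds[OF k])+
    then show "pt k i (mid k i) = mid_vertex k i" by (rule pt_inner)
    show "inj_on (pt k i) {..k}" using k by (intro pt_inj) simp
    show "pt k i t \<notin> W \<union> Z" if "0 < t" "t < k" "t \<noteq> mid k i" for t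
      unfolding pt_inner[OF that(1,2)] by (rule W(2)[OF that(3)])
  qed
qed

text \<open>\<open>Ctr (2 * i - 1)\<close> and \<open>Ctr (2 * i)\<close> are the centres on the
  finished side of the upper and the lower half of path \<open>i\<close>. For \<open>i = 0\<close>
  truncated subtraction makes both equal to \<open>Ctr 0\<close>, as it should be: between path 0
  and the edge from \<open>Top\<close> to \<open>Bot\<close> there is a single face. The triangle
  \<open>{Top, Bot, mid_vertex k i}\<close> is the free region for the next path.\<close>

lemma stage:
  assumes k: "5 \<le> k"
  shows "\<exists>G. live_tri (stage_verts k i) (stage_edges k i) (Ctr ` {..2 * i}) G \<and>
    {Top, Bot, mid_vertex k i} \<in> G \<and> {Top, mid_vertex k i, Ctr (2 * i - 1)} \<in> G \<and>
    {mid_vertex k i, Bot, Ctr (2 * i)} \<in> G \<and> (\<forall>e\<in>stage_base k i. \<exists>z\<in>Ctr ` {..2 * i}. ends e \<union> {z} \<in> G)"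
proof (induction i)
  case 0
  let ?v = "mid_vertex k 0"
  have T: "live_tri {Top, Bot} {{Top, Bot}} {Ctr 0} {{Top, Bot, Ctr 0}}"
    by (rule live_tri_triangle) simp_all
  define G where "G = {{Top, Bot, Ctr 0}} - {{Top, Bot, Ctr 0}} \<union> {{?v, Top, Bot}, {?v, Bot, Ctr 0}, {?v, Top, Ctr 0}}"
  have T': "live_tri (insert ?v {Top, Bot}) ({{Top, Bot}} \<union> {{?v, Top}, {?v, Bot}}) {Ctr 0} G"
    unfolding G_def by (rule live_tri_stack_beside_dead[OF T]) simp_all
  have eq: "insert ?v {Top, Bot} = stage_verts k 0" "{{Top, Bot}} \<union> {{?v, Top}, {?v, Bot}} = stage_edges k 0"
    "{Ctr 0} = Ctr ` {..2 * 0}" "stage_base k 0 = {}"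
    by (auto simp: stage_verts_def stage_edges_def stage_base_def insert_commute)
  have "{Top, Bot, ?v} \<in> G" "{Top, ?v, Ctr (2 * 0 - 1)} \<in> G" "{?v, Bot, Ctr (2 * 0)} \<in> G"
    unfolding G_def by (simp_all add: insert_commute)
  then show ?case using T' unfolding eq by blast
next
  case (Suc i)
  let ?v = "mid_vertex k i" and ?v' = "mid_vertex k (Suc i)"
  let ?W = "stage_verts k i" and ?L = "stage_edges k i" and ?Z = "Ctr ` {..2 * i}"
  let ?d = "Ctr (2 * i - 1)" and ?d' = "Ctr (2 * i)" and ?c = "Ctr (2 * i + 1)" and ?c' = "Ctr (2 * i + 2)"
  obtain G where T: "live_tri ?W ?L ?Z G" and G: "{Top, Bot, ?v} \<in> G" "{Top, ?v, ?d} \<in> G" "{?v, Bot, ?d'} \<in> G"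
    and B: "\<forall>e\<in>stage_base k i. \<exists>z\<in>?Z. ends e \<union> {z} \<in> G" using Suc.IH by (elim exE conjE) rule
  note S = stage_verts_simps[where k = k and i = i]
  have GW: "f \<subseteq> ?W \<union> ?Z" if "f \<in> G" for f by (rule live_tri_face[OF T that])
  have v'n: "?v' \<notin> ?W \<union> ?Z" using S(5) by auto
  \<comment> \<open>The next cut vertex goes into the free triangle. This creates the rung, an upper
    and a lower triangle, which receive the centres \<open>?c\<close> and \<open>?c'\<close>, and a
    smaller free triangle.\<close>
  define G1 where "G1 = G - {{Top, Bot, ?v}} \<union> {{?v', Top, Bot}, {?v', Bot, ?v}, {?v', Top, ?v}}"
  have T1: "live_tri (insert ?v' ?W) (?L \<union> {{?v', Top}, {?v', Bot}, {?v', ?v}}) ?Z G1"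
    unfolding G1_def by (rule live_tri_stack_live[OF T G(1) _ _ _ v'n]) (use S in simp_all)
  define G2 where "G2 = G1 - {{?v', Top, ?v}} \<union> {{?c, ?v', Top}, {?c, Top, ?v}, {?c, ?v', ?v}}"
  have T2: "live_tri (insert ?v' ?W) (?L \<union> {{?v', Top}, {?v', Bot}, {?v', ?v}}) (insert ?c ?Z) G2"
    unfolding G2_def by (rule live_tri_stack_dead[OF T1]) (use S in \<open>auto simp: G1_def\<close>)
  define G3 where "G3 = G2 - {{?v', Bot, ?v}} \<union> {{?c', ?v', Bot}, {?c', Bot, ?v}, {?c', ?v', ?v}}"
  have b2: "{?v', Bot, ?v} \<in> G2"
  proof -
    have "{?v', Bot, ?v} \<noteq> {?v', Top, ?v}" by blast
    then show ?thesis unfolding G2_def G1_def by simp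
  qed
  have T3: "live_tri (insert ?v' ?W) (?L \<union> {{?v', Top}, {?v', Bot}, {?v', ?v}}) (insert ?c' (insert ?c ?Z)) G3"
    unfolding G3_def by (rule live_tri_stack_dead[OF T2 b2]) (use S in auto)
  have keep: "f \<in> G3" if "f \<in> G" "f \<noteq> {Top, Bot, ?v}" for f
  proof -
    have "?v' \<notin> f" using GW[OF that(1)] v'n by blast
    then show ?thesis using that unfolding G1_def G2_def G3_def by auto
  qed
  have Zeq: "insert ?c' (insert ?c ?Z) = Ctr ` {..2 * Suc i}"
  proof -
    have "{..2 * Suc i} = insert (2 * i + 2) (insert (2 * i + 1) {..2 * i})" by auto
    then show ?thesis by simp
  qed
  have d3: "{Top, ?v, ?d} \<in> G3" "{?v, Bot, ?d'} \<in> G3" by (intro keep G; auto)+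
  have c3: "{Top, ?v, ?c} \<in> G3" "{?v, Bot, ?c'} \<in> G3" "{?c, ?v', Top} \<in> G3" "{?c', ?v', Bot} \<in> G3"
    "{?c, ?v', ?v} \<in> G3" "{Top, Bot, ?v'} \<in> G3"
  proof -
    have n: "{?c, a, b} \<noteq> {?v', Bot, ?v}" for a b by blast
    have "{?c, Top, ?v} \<in> G3" "{?c, ?v', Top} \<in> G3" "{?c, ?v', ?v} \<in> G3"
      unfolding G3_def G2_def using n by simp_all
    then show "{Top, ?v, ?c} \<in> G3" "{?c, ?v', Top} \<in> G3" "{?c, ?v', ?v} \<in> G3" by (simp_all add: insert_commute)
    show "{?v, Bot, ?c'} \<in> G3" "{?c', ?v', Bot} \<in> G3" unfolding G3_def by (simp_all add: insert_commute)
    have "?v \<notin> {?v', Top, Bot}" by simp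
    then have "{?v', Top, Bot} \<noteq> {?v', Top, ?v}" "{?v', Top, Bot} \<noteq> {?v', Bot, ?v}" by blast+
    then have "{?v', Top, Bot} \<in> G3" unfolding G3_def G2_def G1_def by simp
    then show "{Top, Bot, ?v'} \<in> G3" by (simp add: insert_commute)
  qed
  have W1: "?W \<subseteq> insert ?v' ?W" by blast
  have W2: "Pt i t \<notin> insert ?v' ?W \<union> Ctr ` {..2 * Suc i}" if "t \<noteq> mid k i" for t
    using S(6) that by auto
  have Z: "?d \<in> Ctr ` {..2 * Suc i}" "?c \<in> Ctr ` {..2 * Suc i}" "?d' \<in> Ctr ` {..2 * Suc i}"
    "?c' \<in> Ctr ` {..2 * Suc i}" "?d \<noteq> ?c" "?d' \<noteq> ?c'" by auto
  \<comment> \<open>Both coarse edges of path \<open>i\<close> now lie between two centres, so they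
    can be subdivided.\<close>
  obtain G4 where T4: "live_tri (insert ?v' ?W \<union> pt k i ` {0<..<k})
      (?L \<union> {{?v', Top}, {?v', Bot}, {?v', ?v}} - {{Top, ?v}, {?v, Bot}} \<union> ends ` path_edge k i ` {..<k}) (Ctr ` {..2 * Suc i}) G4"
    and G4: "{f\<in>G3. \<not> {Top, ?v} \<subseteq> f \<and> \<not> {?v, Bot} \<subseteq> f} \<subseteq> G4"
      "\<And>t. t < k \<Longrightarrow> \<exists>z\<in>Ctr ` {..2 * Suc i}. ends (path_edge k i t) \<union> {z} \<in> G4"
    using stage_split[OF k T3[unfolded Zeq] W1 W2 d3(1) c3(1) d3(2) c3(2) Z] by blast
  have W: "insert ?v' ?W \<union> pt k i ` {0<..<k} = stage_verts k (Suc i)"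
  proof -
    have "?v \<in> pt k i ` {0<..<k}" using mid_bounds(1,2)[OF k, of i] pt_inner[of "mid k i" k i] by (intro image_eqI[of _ _ "mid k i"]) auto
    then show ?thesis unfolding stage_verts_def lessThan_Suc by auto
  qed
  have base: "stage_base k (Suc i) = stage_base k i \<union> path_edge k i ` {..<k} \<union> {rung k i}"
    unfolding stage_base_def lessThan_Suc by auto
  have L: "?L \<union> {{?v', Top}, {?v', Bot}, {?v', ?v}} - {{Top, ?v}, {?v, Bot}} \<union> ends ` path_edge k i ` {..<k} = stage_edges k (Suc i)"
  proof -
    have n: "{Top, ?v} \<notin> ends ` stage_base k i" "{?v, Bot} \<notin> ends ` stage_base k i"
      using stage_base_ends(2,3)[OF _ k] by blast+
    have r: "ends (rung k i) = {?v', ?v}" by (auto simp: ends_def rung_def)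
    have "{Top, Bot} \<noteq> {Top, ?v}" "{Top, Bot} \<noteq> {?v, Bot}" by (simp_all add: doubleton_eq_iff)
    moreover have "{?v', a} \<noteq> {Top, ?v}" "{?v', a} \<noteq> {?v, Bot}" for a by (simp_all add: doubleton_eq_iff)
    ultimately show ?thesis unfolding stage_edges_def base image_Un using n r by (auto simp: insert_commute)
  qed
  have in4: "f \<in> G4" if "f \<in> G3" "\<not> {Top, ?v} \<subseteq> f" "\<not> {?v, Bot} \<subseteq> f" for f using G4(1) that by blast
  have B4: "\<exists>z\<in>Ctr ` {..2 * Suc i}. ends e \<union> {z} \<in> G4" if e: "e \<in> stage_base k (Suc i)" for e
  proof -
    consider "e \<in> stage_base k i" | t where "e = path_edge k i t" "t < k" | "e = rung k i"
      using e unfolding base by blast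
    then show ?thesis
    proof cases
      case 1
      then obtain z where z: "z \<in> ?Z" "ends e \<union> {z} \<in> G" using B by blast
      have zn: "z \<noteq> Top" "z \<noteq> Bot" "z \<noteq> ?v" using z(1) by auto
      have "ends e \<union> {z} \<noteq> {Top, Bot, ?v}" using zn by auto
      then have "ends e \<union> {z} \<in> G3" by (rule keep[OF z(2)])
      then have "ends e \<union> {z} \<in> G4" by (rule in4) (use stage_base_ends(2,3)[OF 1 k] zn in auto)
      moreover have "z \<in> Ctr ` {..2 * Suc i}" using z(1) by auto
      ultimately show ?thesis by blast
    next
      case 2
      then show ?thesis using G4(2) by blast
    next
      case 3
      have "ends e \<union> {?c} = {?c, ?v', ?v}" unfolding 3 by (auto simp: ends_def rung_def)
      moreover have "{?c, ?v', ?v} \<in> G4" by (rule in4[OF c3(5)]) auto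
      ultimately show ?thesis by (intro bexI[of _ ?c]) auto
    qed
  qed
  have "{Top, Bot, ?v'} \<in> G4" by (rule in4[OF c3(6)]) auto
  moreover have "{?c, ?v', Top} \<in> G4" by (rule in4[OF c3(3)]) auto
  then have "{Top, ?v', Ctr (2 * Suc i - 1)} \<in> G4" by (simp add: insert_commute)
  moreover have "{?c', ?v', Bot} \<in> G4" by (rule in4[OF c3(4)]) auto
  then have "{?v', Bot, Ctr (2 * Suc i)} \<in> G4" by (simp add: insert_commute)
  ultimately show ?case using T4[unfolded W L] B4 by (intro exI[of _ G4] conjI ballI)
qed

lemma base_eq_stage_base: "base k (Suc i) = insert (Top, Bot) (stage_base k i \<union> path_edge k i ` {..<k})"
proof -
  have "(\<lambda>(i, t). path_edge k i t) ` ({..<Suc i} \<times> {..<k}) = (\<Union>j<Suc i. path_edge k j ` {..<k})" by auto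
  moreover have "{j. Suc j < Suc i} = {..<i}" by auto
  ultimately show ?thesis unfolding base_def stage_base_def lessThan_Suc by auto
qed

definition base_verts :: "nat \<Rightarrow> nat \<Rightarrow> vertex set" where
  "base_verts k q = {Top, Bot} \<union> (\<Union>j<q. pt k j ` {0<..<k})"

text \<open>After the last path the free triangle is a face of the base graph. Its centre
  \<open>Ctr (2 * q - 1)\<close> lies beside both halves of the last path and beside the edge
  between \<open>Top\<close> and \<open>Bot\<close>.\<close>

lemma stellated_base:
  assumes k: "5 \<le> k" and q: "0 < q"
  shows "\<exists>G. live_tri (base_verts k q) (ends ` base k q) (Ctr ` {..<2 * q}) G \<and>
    (\<forall>e\<in>base k q. \<exists>z\<in>Ctr ` {..<2 * q}. ends e \<union> {z} \<in> G)"
proof -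
  obtain i where qi: "q = Suc i" using q gr0_implies_Suc by blast
  let ?v = "mid_vertex k i"
  let ?W = "stage_verts k i" and ?L = "stage_edges k i" and ?Z = "Ctr ` {..2 * i}"
  let ?d = "Ctr (2 * i - 1)" and ?d' = "Ctr (2 * i)" and ?c = "Ctr (2 * i + 1)"
  obtain G where T: "live_tri ?W ?L ?Z G" and G: "{Top, Bot, ?v} \<in> G" "{Top, ?v, ?d} \<in> G" "{?v, Bot, ?d'} \<in> G"
    and B: "\<forall>e\<in>stage_base k i. \<exists>z\<in>?Z. ends e \<union> {z} \<in> G" using stage[OF k, of i] by (elim exE conjE) rule
  note S = stage_verts_simps[where k = k and i = i]
  define G1 where "G1 = G - {{Top, Bot, ?v}} \<union> {{?c, Top, Bot}, {?c, Bot, ?v}, {?c, Top, ?v}}"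
  have T1: "live_tri ?W ?L (insert ?c ?Z) G1"
    unfolding G1_def by (rule live_tri_stack_dead[OF T G(1)]) (use S in auto)
  have Zeq: "insert ?c ?Z = Ctr ` {..<2 * q}"
  proof -
    have "{..<2 * q} = insert (2 * i + 1) {..2 * i}" using qi by auto
    then show ?thesis by simp
  qed
  have d1: "{Top, ?v, ?d} \<in> G1" "{?v, Bot, ?d'} \<in> G1"
  proof -
    have "{Top, ?v, ?d} \<noteq> {Top, Bot, ?v}" "{?v, Bot, ?d'} \<noteq> {Top, Bot, ?v}" by auto
    then show "{Top, ?v, ?d} \<in> G1" "{?v, Bot, ?d'} \<in> G1" using G unfolding G1_def by simp_all
  qed
  have c1: "{Top, ?v, ?c} \<in> G1" "{?v, Bot, ?c} \<in> G1" "{?c, Top, Bot} \<in> G1"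
    unfolding G1_def by (simp_all add: insert_commute)
  have W2: "Pt i t \<notin> ?W \<union> Ctr ` {..<2 * q}" if "t \<noteq> mid k i" for t using S(6) that by auto
  have Z: "?d \<in> Ctr ` {..<2 * q}" "?c \<in> Ctr ` {..<2 * q}" "?d' \<in> Ctr ` {..<2 * q}"
    "?c \<in> Ctr ` {..<2 * q}" "?d \<noteq> ?c" "?d' \<noteq> ?c" using qi by auto
  obtain G2 where T2: "live_tri (?W \<union> pt k i ` {0<..<k})
      (?L - {{Top, ?v}, {?v, Bot}} \<union> ends ` path_edge k i ` {..<k}) (Ctr ` {..<2 * q}) G2"
    and G2: "{f\<in>G1. \<not> {Top, ?v} \<subseteq> f \<and> \<not> {?v, Bot} \<subseteq> f} \<subseteq> G2"
      "\<And>t. t < k \<Longrightarrow> \<exists>z\<in>Ctr ` {..<2 * q}. ends (path_edge k i t) \<union> {z} \<in> G2"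
    using stage_split[OF k T1[unfolded Zeq] subset_refl W2 d1(1) c1(1) d1(2) c1(2) Z] by blast
  have W: "?W \<union> pt k i ` {0<..<k} = base_verts k q"
  proof -
    have "?v \<in> pt k i ` {0<..<k}" using mid_bounds(1,2)[OF k, of i] pt_inner[of "mid k i" k i] by (intro image_eqI[of _ _ "mid k i"]) auto
    then show ?thesis unfolding stage_verts_def base_verts_def qi lessThan_Suc by auto
  qed
  have L: "?L - {{Top, ?v}, {?v, Bot}} \<union> ends ` path_edge k i ` {..<k} = ends ` base k q"
  proof -
    have n: "{Top, ?v} \<notin> ends ` stage_base k i" "{?v, Bot} \<notin> ends ` stage_base k i"
      using stage_base_ends(2,3)[OF _ k] by blast+
    have "ends (Top, Bot) = {Top, Bot}" by (simp add: ends_def)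
    moreover have "{Top, Bot} \<noteq> {Top, ?v}" "{Top, Bot} \<noteq> {?v, Bot}" by (simp_all add: doubleton_eq_iff)
    ultimately show ?thesis unfolding stage_edges_def qi base_eq_stage_base image_insert image_Un using n by auto
  qed
  have in2: "f \<in> G2" if "f \<in> G1" "\<not> {Top, ?v} \<subseteq> f" "\<not> {?v, Bot} \<subseteq> f" for f using G2(1) that by blast
  have "\<exists>z\<in>Ctr ` {..<2 * q}. ends e \<union> {z} \<in> G2" if e: "e \<in> base k q" for e
  proof -
    consider "e = (Top, Bot)" | "e \<in> stage_base k i" | t where "e = path_edge k i t" "t < k"
      using e unfolding qi base_eq_stage_base by blast
    then show ?thesis
    proof cases
      case 1
      have "ends e \<union> {?c} = {?c, Top, Bot}" unfolding 1 by (auto simp: ends_def)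
      moreover have "{?c, Top, Bot} \<in> G2" by (rule in2[OF c1(3)]) auto
      ultimately show ?thesis using qi by (intro bexI[of _ ?c]) auto
    next
      case 2
      then obtain z where z: "z \<in> ?Z" "ends e \<union> {z} \<in> G" using B by blast
      have zn: "z \<noteq> Top" "z \<noteq> Bot" "z \<noteq> ?v" using z(1) by auto
      have "ends e \<union> {z} \<noteq> {Top, Bot, ?v}" using zn by auto
      then have "ends e \<union> {z} \<in> G1" using z(2) unfolding G1_def by blast
      then have "ends e \<union> {z} \<in> G2" by (rule in2) (use stage_base_ends(2,3)[OF 2 k] zn in auto)
      moreover have "z \<in> Ctr ` {..<2 * q}" using z(1) qi by auto
      ultimately show ?thesis by blast
    next
      case 3
      then show ?thesis using G2(2) by blast
    qed
  qed
  then show ?thesis using T2[unfolded W L] by blast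
qed

section \<open>Colouring\<close>

text \<open>A known face must remain so that further vertices can be placed, and some copy of the
  cycle must exist since the triangulation has to belong to the family of those that contain
  it.\<close>

definition rainbow_free_tri :: "nat \<Rightarrow> nat \<Rightarrow> nat \<Rightarrow> bool" where
  "rainbow_free_tri k n m \<longleftrightarrow> (\<exists>(V :: vertex set) E G c. plane_tri V E G \<and> G \<noteq> {} \<and> card V = n \<and> card (c ` E) = m \<and>
     (\<exists>S. copy_of (cycle_graph k) S (V, E)) \<and> \<not> (\<exists>S. copy_of (cycle_graph k) S (V, E) \<and> rainbow c S))"

text \<open>The colouring is carried over to the drawing along the inverse of \<open>\<phi>\<close>;
  a rainbow copy in the drawing could be pulled back.\<close>

lemma ar_planar_ge_plane_tri:
  fixes c :: "'a set \<Rightarrow> nat"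
  assumes T: "plane_tri V E G" and S: "copy_of H S (V, E)"
    and no: "\<not> (\<exists>S. copy_of H S (V, E) \<and> rainbow c S)"
  shows "card (c ` E) \<le> ar_planar (card V) H"
proof -
  obtain A and \<phi> :: "'a \<Rightarrow> complex" where \<phi>: "inj_on \<phi> V" "plane_triangulation (\<phi> ` V) A"
    "graph_of (\<phi> ` V) A = (\<phi> ` V, (`) \<phi> ` E)"
    using T by (rule plane_tri_realize)
  let ?\<psi> = "inv_into V \<phi>" and ?T = "graph_of (\<phi> ` V) A"
  have T': "?T = map_graph \<phi> (V, E)" unfolding \<phi>(3) map_graph_def by simp
  have \<psi>\<phi>: "?\<psi> ` (\<phi> ` e) = e" if "e \<in> E" for e
    using plane_tri_finite(3)[OF T that] \<phi>(1) by (intro inv_into_image_cancel) simp_all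
  have ET: "edges ?T = (`) \<phi> ` E" unfolding \<phi>(3) by simp
  have invE: "(\<lambda>e. ?\<psi> ` (\<phi> ` e)) ` E = E"
  proof -
    have "(\<lambda>e. ?\<psi> ` (\<phi> ` e)) ` E = (\<lambda>e. e) ` E" by (rule image_cong[OF refl \<psi>\<phi>])
    then show ?thesis by simp
  qed
  have pull: "map_graph ?\<psi> ?T = (V, E)"
  proof -
    have "?\<psi> ` (\<phi> ` V) = V" using \<phi>(1) by (intro inv_into_image_cancel) simp_all
    then show ?thesis using invE unfolding \<phi>(3) map_graph_def by (simp add: image_image)
  qed
  have "copy_of H (map_graph \<phi> S) ?T" unfolding T' by (rule copy_of_map_graph[OF S]) (use \<phi>(1) in simp)
  moreover have "card (\<phi> ` V) = card V" by (rule card_image[OF \<phi>(1)])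
  ultimately have mem: "?T \<in> triangulations (card V) H"
    unfolding triangulations_def using \<phi>(2) by blast
  let ?c = "\<lambda>e. c (?\<psi> ` e)"
  have "\<not> (\<exists>S. copy_of H S ?T \<and> rainbow ?c S)"
  proof
    assume "\<exists>S. copy_of H S ?T \<and> rainbow ?c S"
    then obtain S' where S': "copy_of H S' ?T" "rainbow ?c S'" by blast
    have "copy_of H (map_graph ?\<psi> S') (map_graph ?\<psi> ?T)"
      by (rule copy_of_map_graph[OF S'(1)]) (simp add: \<phi>(3) inj_on_inv_into)
    then have "copy_of H (map_graph ?\<psi> S') (V, E)" unfolding pull .
    moreover have "rainbow c (map_graph ?\<psi> S')"
      using S'(2) unfolding rainbow_def map_graph_def by (auto simp: inj_on_def)
    ultimately show False using no by blast
  qed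
  from ar_planar_ge[OF mem this] have "card (?c ` edges ?T) \<le> ar_planar (card V) H" .
  moreover have "?c ` edges ?T = c ` E"
  proof -
    have "?c ` edges ?T = c ` ((\<lambda>e. ?\<psi> ` (\<phi> ` e)) ` E)" unfolding ET by (simp add: image_image)
    then show ?thesis unfolding invE .
  qed
  ultimately show ?thesis by simp
qed

lemma infinite_vertex: "infinite (UNIV :: vertex set)"
proof
  assume "finite (UNIV :: vertex set)"
  then have "finite (range Ctr)" by (rule rev_finite_subset) simp
  then show False using finite_imageD[of Ctr UNIV] by (simp add: inj_on_def)
qed

lemma copy_cycle_two_edges:
  assumes "copy_of (cycle_graph k) S G" "3 \<le> k" "v \<in> verts S"
  obtains e f where "e \<in> edges S" "f \<in> edges S" "e \<noteq> f" "v \<in> e" "v \<in> f"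
proof -
  obtain e f where "{e\<in>edges S. v \<in> e} = {e, f}" "e \<noteq> f"
    using cycle_copy_degree[OF assms] unfolding card_2_iff by blast
  then show ?thesis by (intro that[of e f]) blast+
qed

lemma copy_of_simps:
  assumes "copy_of H S (V, E)"
  shows "verts S \<subseteq> V" "edges S \<subseteq> E" "\<And>e. e \<in> edges S \<Longrightarrow> e \<subseteq> verts S"
  using assms unfolding copy_of_def subgraph_def simple_graph_def by auto

text \<open>The three edges at the new vertex share one fresh colour. A cycle through this vertex
  repeats it, and any other cycle lies in the old graph.\<close>

lemma rainbow_free_tri_Suc:
  assumes "rainbow_free_tri k n m" and k: "3 \<le> k"
  shows "rainbow_free_tri k (Suc n) (Suc m)"
proof -
  obtain V :: "vertex set" and E G and c :: "vertex set \<Rightarrow> nat" where T: "plane_tri V E G" "G \<noteq> {}" "card V = n" "card (c ` E) = m"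
    and cp: "\<exists>S. copy_of (cycle_graph k) S (V, E)"
    and no: "\<not> (\<exists>S. copy_of (cycle_graph k) S (V, E) \<and> rainbow c S)"
    using assms(1) unfolding rainbow_free_tri_def by blast
  obtain f where f: "f \<in> G" using T(2) by blast
  obtain u v w where uvw: "f = {u, v, w}" using plane_tri_face(2)[OF T(1) f] by (rule card3_obtain)
  note fin = plane_tri_finite[OF T(1)]
  obtain p where p: "p \<notin> V" using ex_new_if_finite[OF infinite_vertex fin(1)] by blast
  obtain x where x: "x \<notin> c ` E" using ex_new_if_finite[OF infinite_UNIV_nat, of "c ` E"] fin(2) by blast
  let ?V = "insert p V" and ?E = "E \<union> {{p, u}, {p, v}, {p, w}}"
  let ?G = "G - {{u, v, w}} \<union> {{p, u, v}, {p, v, w}, {p, u, w}}"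
  define c' where "c' e = (if p \<in> e then x else c e)" for e
  have T': "plane_tri ?V ?E ?G" by (rule plane_tri_stack[OF T(1) _ p]) (use f uvw in simp)
  have pE: "p \<notin> e" if "e \<in> E" for e using fin(3)[OF that] p by blast
  have "c' ` E = c ` E" by (rule image_cong) (use pE in \<open>simp_all add: c'_def\<close>)
  then have "c' ` ?E = insert x (c ` E)" unfolding image_Un by (simp add: c'_def)
  then have m: "card (c' ` ?E) = Suc m" using x fin(2) T(4) by simp
  have n: "card ?V = Suc n" using p fin(1) T(3) by simp
  obtain S where S: "copy_of (cycle_graph k) S (V, E)" using cp by blast
  have S': "copy_of (cycle_graph k) S (?V, ?E)" using S unfolding copy_of_def subgraph_def by auto
  have "\<not> (\<exists>S. copy_of (cycle_graph k) S (?V, ?E) \<and> rainbow c' S)"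
  proof
    assume "\<exists>S. copy_of (cycle_graph k) S (?V, ?E) \<and> rainbow c' S"
    then obtain S where S: "copy_of (cycle_graph k) S (?V, ?E)" "rainbow c' S" by blast
    note sub = copy_of_simps[OF S(1)]
    have pS: "p \<notin> verts S"
    proof
      assume "p \<in> verts S"
      then obtain e f where ef: "e \<in> edges S" "f \<in> edges S" "e \<noteq> f" "p \<in> e" "p \<in> f"
        by (rule copy_cycle_two_edges[OF S(1) k])
      then have "c' e = c' f" by (simp add: c'_def)
      then show False using S(2) ef unfolding rainbow_def inj_on_def by blast
    qed
    then have pe: "p \<notin> e" if "e \<in> edges S" for e using sub(3)[OF that] by blast
    have "verts S \<subseteq> V" using sub(1) pS by blast
    moreover have "edges S \<subseteq> E" using sub(2) pe by blast
    ultimately have "copy_of (cycle_graph k) S (V, E)" using S(1) unfolding copy_of_def subgraph_def by simp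
    moreover have "rainbow c S"
      using S(2) pe unfolding rainbow_def inj_on_def c'_def by simp
    ultimately show False using no by blast
  qed
  moreover have "?G \<noteq> {}" by blast
  ultimately show ?thesis unfolding rainbow_free_tri_def using T' n m S' by blast
qed

lemma rainbow_free_tri_add:
  assumes "rainbow_free_tri k n m" "3 \<le> k"
  shows "rainbow_free_tri k (n + r) (m + r)"
  using assms(1) by (induction r) (use rainbow_free_tri_Suc[OF _ assms(2)] in simp_all)

text \<open>Live edges get pairwise different colours, and each dead vertex has a colour of its own
  for all its edges, so that no rainbow cycle passes through it.\<close>

lemma rainbow_free_tri_of_live_tri:
  assumes T: "live_tri W L Z G" and G: "G \<noteq> {}" and k: "3 \<le> k"
    and no: "\<And>S (H :: vertex graph). copy_of (cycle_graph k) S H \<Longrightarrow> edges S \<subseteq> L \<Longrightarrow> False"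
    and s: "inj_on s {..<k}" "\<And>i. i < k \<Longrightarrow> s i \<in> W \<union> Z"
      "\<And>i. i < k \<Longrightarrow> {s i, s (Suc i mod k)} \<in> L \<or> (\<exists>f\<in>G. {s i, s (Suc i mod k)} \<subseteq> f)"
  shows "rainbow_free_tri k (card W + card Z) (card L + card Z)"
proof -
  obtain S0 where S0: "plane_tri (W \<union> Z) (L \<union> S0) G" "W \<inter> Z = {}" "\<And>e. e \<in> L \<Longrightarrow> e \<subseteq> W"
    "S0 \<subseteq> spokes W Z" "Z \<subseteq> \<Union>S0" using T by (rule live_triE) blast
  note fin = plane_tri_finite[OF S0(1)]
  \<comment> \<open>The colours are the live edges and the dead vertices, coded as natural
    numbers.\<close>
  obtain g :: "vertex set + vertex \<Rightarrow> nat" where g: "inj_on g (L <+> Z)"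
    using fin(1,2) by (meson finite_Plus finite_Un finite_imp_inj_to_nat_seg)
  define z where "z e = (THE z. z \<in> Z \<and> z \<in> e)" for e
  define c where "c e = g (if e \<in> L then Inl e else Inr (z e))" for e
  have spoke: "\<exists>w y. e = {w, y} \<and> w \<in> W \<and> y \<in> Z" if "e \<in> S0" for e
    using S0(4) that unfolding spokes_def by blast
  have z: "z e = x" if "e \<in> S0" "x \<in> e" "x \<in> Z" for e x
  proof -
    obtain w y where wy: "e = {w, y}" "w \<in> W" "y \<in> Z" using spoke[OF \<open>e \<in> S0\<close>] by blast
    have "w \<notin> Z" using wy(2) S0(2) by blast
    then show ?thesis unfolding z_def using wy that by (intro the_equality) auto
  qed
  have S0L: "e \<notin> L" if "e \<in> S0" for e
  proof
    assume "e \<in> L"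
    obtain w y where "e = {w, y}" "y \<in> Z" using spoke[OF \<open>e \<in> S0\<close>] by blast
    then show False using S0(3)[OF \<open>e \<in> L\<close>] S0(2) by blast
  qed
  \<comment> \<open>Every dead vertex has a spoke, hence its colour does occur and may be
    counted.\<close>
  have zS0: "z ` S0 = Z"
  proof
    show "z ` S0 \<subseteq> Z"
    proof
      fix y assume "y \<in> z ` S0"
      then obtain e where e: "e \<in> S0" "y = z e" by blast
      obtain w x where wx: "e = {w, x}" "x \<in> Z" using spoke[OF e(1)] by blast
      then show "y \<in> Z" using z[OF e(1), of x] e(2) by simp
    qed
    show "Z \<subseteq> z ` S0"
    proof
      fix y assume y: "y \<in> Z"
      then obtain e where "e \<in> S0" "y \<in> e" using S0(5) by blast
      then show "y \<in> z ` S0" using z[OF _ _ y] by blast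
    qed
  qed
  have "c ` (L \<union> S0) = g ` (Inl ` L \<union> Inr ` (z ` S0))"
  proof -
    have "c ` L = g ` Inl ` L" unfolding c_def by (simp add: image_image)
    moreover have "c ` S0 = g ` Inr ` z ` S0"
      unfolding image_image by (rule image_cong[OF refl]) (use S0L in \<open>simp add: c_def\<close>)
    ultimately show ?thesis by (simp add: image_Un)
  qed
  also have "\<dots> = g ` (L <+> Z)" unfolding zS0 Plus_def ..
  finally have "card (c ` (L \<union> S0)) = card (L <+> Z)" using card_image[OF g] by simp
  then have m: "card (c ` (L \<union> S0)) = card L + card Z"
    using fin(1,2) by (simp add: card_Plus)
  have n: "card (W \<union> Z) = card W + card Z" using fin(1) S0(2) by (simp add: card_Un_disjoint)
  \<comment> \<open>Individual spokes are not recorded; that the cycle \<open>s\<close> may use one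
    is read off from a face that contains both ends.\<close>
  have cp: "\<exists>S. copy_of (cycle_graph k) S (W \<union> Z, L \<union> S0)"
  proof (rule cycle_copyI[OF k s(1,2)])
    fix i assume i: "i < k"
    show "{s i, s (Suc i mod k)} \<in> L \<union> S0"
    proof (cases "{s i, s (Suc i mod k)} \<in> L")
      case False
      then obtain f where f: "f \<in> G" "{s i, s (Suc i mod k)} \<subseteq> f" using s(3)[OF i] by blast
      have "Suc i mod k \<noteq> i" using i k by (auto simp: mod_Suc)
      then have "s i \<noteq> s (Suc i mod k)" using inj_onD[OF s(1), of i "Suc i mod k"] i by auto
      then show ?thesis by (intro plane_tri_face(3)[OF S0(1) f]) simp
    qed simp
  qed
  have "\<not> (\<exists>S. copy_of (cycle_graph k) S (W \<union> Z, L \<union> S0) \<and> rainbow c S)"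
  proof
    assume "\<exists>S. copy_of (cycle_graph k) S (W \<union> Z, L \<union> S0) \<and> rainbow c S"
    then obtain S where S: "copy_of (cycle_graph k) S (W \<union> Z, L \<union> S0)" "rainbow c S" by blast
    note sub = copy_of_simps[OF S(1)]
    have ZS: "x \<notin> verts S" if x: "x \<in> Z" for x
    proof
      assume "x \<in> verts S"
      then obtain e f where ef: "e \<in> edges S" "f \<in> edges S" "e \<noteq> f" "x \<in> e" "x \<in> f"
        by (rule copy_cycle_two_edges[OF S(1) k])
      have "c d = g (Inr x)" if d: "d \<in> edges S" "x \<in> d" for d
      proof -
        have "d \<notin> L" using S0(2,3) x d(2) by blast
        then have "d \<in> S0" using sub(2) d(1) by blast
        then show ?thesis using z[OF _ d(2) x] \<open>d \<notin> L\<close> by (simp add: c_def)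
      qed
      then have "c e = c f" using ef by simp
      then show False using S(2) ef unfolding rainbow_def inj_on_def by blast
    qed
    have "edges S \<subseteq> L"
    proof
      fix e assume e: "e \<in> edges S"
      have "e \<notin> S0"
      proof
        assume "e \<in> S0"
        then obtain w x where wx: "e = {w, x}" "x \<in> Z" using spoke by blast
        then show False using ZS[OF wx(2)] sub(3)[OF e] by simp
      qed
      then show "e \<in> L" using sub(2) e by blast
    qed
    then show False by (rule no[OF S(1)])
  qed
  then show ?thesis unfolding rainbow_free_tri_def using S0(1) G n m cp by blast
qed

section \<open>The blown-up base graph: its size, and its lack of live
  \<open>k\<close>-cycles\<close>

lemma block_edges_cases:
  assumes "e \<in> block_edges u v b m"
  obtains j where "j < m" "b j \<in> e" "e \<subseteq> {u, v} \<union> b ` {..<m}"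
proof -
  consider j where "e = {b j, u}" "j < m" | j where "e = {b j, v}" "j < m" | j where "e = {b j, b (Suc j)}" "Suc j < m"
    using assms unfolding block_edges_def by blast
  then show ?thesis by cases (rule that, auto)+
qed

lemma finite_block_edges: "finite (block_edges u v b m)"
proof -
  have "block_edges u v b m \<subseteq> Pow ({u, v} \<union> b ` {..<m})"
    using block_edges_cases by (metis PowI subsetI)
  then show ?thesis by (rule finite_subset) simp
qed

text \<open>With the edge \<open>{u, v}\<close> the number is
  \<open>3 * m = 3 * (m + 2) - 6\<close>, as for every triangulation on \<open>m + 2\<close>
  vertices.\<close>

lemma card_block_edges:
  assumes "0 < m" "inj_on b {..<m}" "u \<noteq> v" "u \<notin> b ` {..<m}" "v \<notin> b ` {..<m}"
  shows "card (block_edges u v b m) = 3 * m - 1"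
  using assms
proof (induction m)
  case 0
  then show ?case by simp
next
  case (Suc m)
  show ?case
  proof (cases "m = 0")
    case True
    have "block_edges u v b (Suc 0) = {{b 0, u}, {b 0, v}}" by (auto simp: block_edges_def)
    then show ?thesis using True Suc.prems(3) by (simp add: doubleton_eq_iff)
  next
    case False
    then have m: "0 < m" by simp
    have IH: "card (block_edges u v b m) = 3 * m - 1"
      by (rule Suc.IH[OF m]) (use Suc.prems in \<open>auto intro: inj_on_subset\<close>)
    have new: "b m \<notin> {u, v} \<union> b ` {..<m}"
    proof -
      have "b m \<noteq> b j" if "j < m" for j using inj_onD[OF Suc.prems(2), of m j] that by auto
      moreover have "b m \<in> b ` {..<Suc m}" by simp
      ultimately show ?thesis using Suc.prems(4,5) by blast
    qed
    have "e \<notin> block_edges u v b m" if "b m \<in> e" for e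
    proof
      assume "e \<in> block_edges u v b m"
      then have "e \<subseteq> {u, v} \<union> b ` {..<m}" by (rule block_edges_cases)
      then show False using new that by blast
    qed
    then have dj: "block_edges u v b m \<inter> {{b m, b (m - 1)}, {b m, u}, {b m, v}} = {}" by blast
    have "b (m - 1) \<in> b ` {..<Suc m}" by simp
    then have "b (m - 1) \<noteq> u" "b (m - 1) \<noteq> v" using Suc.prems(4,5) by metis+
    then have "card {{b m, b (m - 1)}, {b m, u}, {b m, v}} = 3" using Suc.prems(3) by (simp add: doubleton_eq_iff card_insert_if)
    then have "card (block_edges u v b m \<union> {{b m, b (m - 1)}, {b m, u}, {b m, v}}) = 3 * m - 1 + 3"
      using card_Un_disjoint[OF finite_block_edges _ dj] IH by simp
    then show ?thesis unfolding block_edges_Suc[OF m] using m by simp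
  qed
qed

definition block :: "nat \<Rightarrow> vertex \<times> vertex \<Rightarrow> vertex set set" where
  "block m e = insert (ends e) (block_edges (fst e) (snd e) (Inner e) m)"

lemma mem_base_verts:
  assumes "0 < k"
  shows "x \<in> base_verts k q \<longleftrightarrow> x = Top \<or> x = Bot \<or> (\<exists>j t. j < q \<and> 0 < t \<and> t < k \<and> x = Pt j t)"
  unfolding base_verts_def using assms by (auto simp: pt_def image_iff)

lemma card_base_verts:
  assumes "0 < k"
  shows "card (base_verts k q) = 2 + q * (k - 1)"
proof -
  let ?f = "\<lambda>(j, t). Pt j t" and ?D = "{..<q} \<times> {0<..<k}"
  have "x \<in> base_verts k q \<longleftrightarrow> x \<in> {Top, Bot} \<union> ?f ` ?D" for x
    unfolding mem_base_verts[OF assms] by force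
  then have "base_verts k q = {Top, Bot} \<union> ?f ` ?D" by (rule set_eqI)
  moreover have "inj_on ?f ?D" by (auto simp: inj_on_def)
  then have "card (?f ` ?D) = q * (k - 1)" by (simp add: card_image)
  moreover have "{Top, Bot} \<inter> ?f ` ?D = {}" by auto
  ultimately show ?thesis by (simp add: card_Un_disjoint)
qed

lemma base_ends:
  assumes "e \<in> base k q" "5 \<le> k" "0 < q"
  shows "ends e \<subseteq> base_verts k q" "fst e \<noteq> snd e" "card (ends e) = 2"
proof -
  have k: "0 < k" using assms(2) by simp
  have "ends e \<subseteq> base_verts k q \<and> fst e \<noteq> snd e"
    using assms(1)
  proof (cases rule: base_cases)
    case TB
    then show ?thesis by (simp add: ends_def base_verts_def)
  next
    case (path_edge i t)
    have "pt k i u \<in> base_verts k q" if "u \<le> k" for u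
      using that path_edge(2) unfolding mem_base_verts[OF k] by (cases "u = 0 \<or> u = k") (auto simp: pt_def)
    then have "ends e \<subseteq> base_verts k q" using path_edge(1,3) by (simp add: ends_path_edge)
    moreover have "pt k i t \<noteq> pt k i (Suc t)" using path_edge(3) k by (simp add: pt_def)
    ultimately show ?thesis using path_edge(1) by (simp add: path_edge_def)
  next
    case (rung i)
    then show ?thesis using mid_bounds(1,2)[OF assms(2), of i] mid_bounds(1,2)[OF assms(2), of "Suc i"]
      by (auto simp: rung_def ends_def mem_base_verts[OF k])
  qed
  then show "ends e \<subseteq> base_verts k q" "fst e \<noteq> snd e" by simp_all
  then show "card (ends e) = 2" by (simp add: ends_def)
qed

lemma ends_neq_Inner: "e \<in> base k q \<Longrightarrow> 5 \<le> k \<Longrightarrow> Inner d j \<notin> ends e"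
  by (erule base_cases) (auto simp: ends_def path_edge_def rung_def pt_def)

text \<open>Blocks share no edges: an edge that is not a base edge contains an inner vertex, and the
  inner vertex names its block.\<close>

lemma card_Union_block:
  assumes k: "5 \<le> k" and q: "0 < q" and m: "0 < m"
  shows "card (\<Union>e\<in>base k q. block m e) = q * (k + 1) * (3 * m)"
proof -
  have "card (\<Union>e\<in>base k q. block m e) = (\<Sum>e\<in>base k q. card (block m e))"
  proof (rule card_UN_disjoint[OF finite_base])
    show "\<forall>e\<in>base k q. finite (block m e)" by (simp add: block_def finite_block_edges)
    show "\<forall>e\<in>base k q. \<forall>f\<in>base k q. e \<noteq> f \<longrightarrow> block m e \<inter> block m f = {}"
    proof (intro ballI impI)
      fix e f assume ef: "e \<in> base k q" "f \<in> base k q" "e \<noteq> f"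
      have inn: "\<exists>j. Inner h j \<in> x" if "x \<in> block_edges (fst h) (snd h) (Inner h) m" for h x
        using that by (rule block_edges_cases) blast
      have oth: "h = h'" if "x \<in> block_edges (fst h) (snd h) (Inner h) m" "h \<in> base k q" "Inner h' j \<in> x" for h h' x j
      proof -
        have "x \<subseteq> {fst h, snd h} \<union> Inner h ` {..<m}" using that(1) by (rule block_edges_cases)
        moreover have "Inner h' j \<notin> {fst h, snd h}" using ends_neq_Inner[OF that(2) k] by (simp add: ends_def)
        ultimately show ?thesis using that(3) by blast
      qed
      have "ends e \<noteq> ends f" using inj_onD[OF ends_inj _ ef(1,2)] k ef(3) by auto
      moreover have "ends h \<notin> block_edges (fst h') (snd h') (Inner h') m" if "h \<in> base k q" for h h'
        using inn[of "ends h" h'] ends_neq_Inner[OF that k] by blast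
      moreover have "block_edges (fst e) (snd e) (Inner e) m \<inter> block_edges (fst f) (snd f) (Inner f) m = {}"
        using inn[of _ e] oth[of _ f e] ef by blast
      ultimately show "block m e \<inter> block m f = {}" using ef unfolding block_def by blast
    qed
  qed
  also have "\<dots> = (\<Sum>e\<in>base k q. 3 * m)"
  proof (rule sum.cong[OF refl])
    fix e assume e: "e \<in> base k q"
    have "Inner e j \<noteq> fst e" "Inner e j \<noteq> snd e" for j
      using ends_neq_Inner[OF e k, of e j] unfolding ends_def by blast+
    then have n: "fst e \<notin> Inner e ` {..<m}" "snd e \<notin> Inner e ` {..<m}" by (metis imageE)+
    have "card (block_edges (fst e) (snd e) (Inner e) m) = 3 * m - 1"
      by (rule card_block_edges[OF m _ base_ends(2)[OF e k q] n]) (simp add: inj_on_def)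
    moreover have "ends e \<notin> block_edges (fst e) (snd e) (Inner e) m"
    proof
      assume "ends e \<in> block_edges (fst e) (snd e) (Inner e) m"
      then obtain j where "Inner e j \<in> ends e" by (rule block_edges_cases)
      then show False using ends_neq_Inner[OF e k] by blast
    qed
    ultimately show "card (block m e) = 3 * m"
      unfolding block_def using m card_insert_disjoint[OF finite_block_edges, of "ends e"] by simp
  qed
  also have "\<dots> = q * (k + 1) * (3 * m)" using card_base[of k q] k q by simp
  finally show ?thesis .
qed

text \<open>With \<open>k - 3\<close> inner vertices and two ends a block falls one vertex short of
  a \<open>k\<close>-cycle.\<close>

lemma no_cycle_in_Union_block:
  assumes k: "5 \<le> k" and q: "0 < q"
    and S: "copy_of (cycle_graph k) S G" "edges S \<subseteq> (\<Union>e\<in>base k q. block (k - 3) e)"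
  shows False
proof (rule no_cycle_in_blocks[OF _ _ _ _ _ _ _ _ _ S, where Q = "base k q" and ends = ends
      and inner = "\<lambda>e. Inner e ` {..<k - 3}" and U = "base_verts k q"])
  show "3 \<le> k" using k by simp
  show "ends e \<subseteq> base_verts k q \<and> card (ends e) = 2" if "e \<in> base k q" for e
    using base_ends[OF that k q] by blast
  show "inj_on ends (base k q)" using k by (intro ends_inj) simp
  show "Inner e ` {..<k - 3} \<inter> base_verts k q = {}" for e
    using mem_base_verts[of k _ q] k by auto
  show "finite (Inner e ` {..<k - 3})" for e by simp
  show "Inner e ` {..<k - 3} \<inter> Inner f ` {..<k - 3} = {}" if "e \<noteq> f" for e f using that by auto
  show "card (ends e \<union> Inner e ` {..<k - 3}) < k" if "e \<in> base k q" for e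
  proof -
    have "card (ends e \<union> Inner e ` {..<k - 3}) \<le> card (ends e) + card (Inner e ` {..<k - 3})" by (rule card_Un_le)
    also have "\<dots> \<le> 2 + (k - 3)" using base_ends(3)[OF that k q] card_image_le[of "{..<k - 3}" "Inner e"] by simp
    finally show ?thesis using k by simp
  qed
  show "\<exists>e\<in>base k q. x \<subseteq> ends e \<union> Inner e ` {..<k - 3}" if x: "x \<in> (\<Union>e\<in>base k q. block (k - 3) e)" for x
  proof -
    obtain e where e: "e \<in> base k q" "x \<in> block (k - 3) e" using x by blast
    have "x \<subseteq> ends e \<union> Inner e ` {..<k - 3}"
    proof (cases "x = ends e")
      case False
      then have "x \<in> block_edges (fst e) (snd e) (Inner e) (k - 3)" using e(2) by (simp add: block_def)
      then show ?thesis unfolding ends_def by (rule block_edges_cases)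
    qed blast
    then show ?thesis using e(1) by blast
  qed
  show "k < card D" if "D \<subseteq> base k q" "finite D" "D \<noteq> {}" "\<And>v. card {e\<in>D. v \<in> ends e} \<in> {0, 2}" for D
    by (rule base_girth[OF k that])
qed

text \<open>The block of \<open>(Top, Bot)\<close> is placed last and separately, because the
  simultaneous placement records no new faces, while the single one exhibits the face between its
  vertex 0 and the centre \<open>z\<close>.\<close>

lemma blown_up_base:
  assumes k: "5 \<le> k" and q: "0 < q"
  obtains G z where "live_tri (base_verts k q \<union> (\<Union>e\<in>base k q. Inner e ` {..<k - 3}))
      (\<Union>e\<in>base k q. block (k - 3) e) (Ctr ` {..<2 * q}) G"
    "{Inner (Top, Bot) 0, Bot, z} \<in> G" "z \<in> Ctr ` {..<2 * q}"
proof -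
  let ?W = "base_verts k q" and ?L = "ends ` base k q" and ?Z = "Ctr ` {..<2 * q}" and ?m = "k - 3"
  let ?TB = "(Top, Bot)"
  obtain G where T: "live_tri ?W ?L ?Z G" and B: "\<forall>e\<in>base k q. \<exists>z\<in>?Z. ends e \<union> {z} \<in> G"
    using stellated_base[OF k q] by blast
  define z where "z e = (SOME z. z \<in> ?Z \<and> ends e \<union> {z} \<in> G)" for e
  have z: "z e \<in> ?Z \<and> ends e \<union> {z e} \<in> G" if "e \<in> base k q" for e
    unfolding z_def by (rule someI_ex) (use B that in blast)
  let ?Q = "base k q - {?TB}"
  let ?b = Inner
  let ?W1 = "?W \<union> (\<Union>e\<in>?Q. ?b e ` {..<?m})" and ?L1 = "?L \<union> (\<Union>(u, v)\<in>?Q. block_edges u v (?b (u, v)) ?m)"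
  let ?f = "\<lambda>(u, v). {u, v, z (u, v)}"
  have W: "?b e j \<notin> ?W \<union> ?Z" for e j using mem_base_verts[of k "?b e j" q] k by auto
  have dj: "?W \<inter> ?Z = {}" by (rule live_tri_disjoint[OF T])
  have f: "u \<in> ?W \<and> v \<in> ?W \<and> z (u, v) \<in> ?Z \<and> {u, v, z (u, v)} \<in> G" if "(u, v) \<in> base k q" for u v
  proof -
    have "ends (u, v) \<union> {z (u, v)} = {u, v, z (u, v)}" by (auto simp: ends_def)
    then show ?thesis using z[OF that] base_ends(1)[OF that k q] by (simp add: ends_def)
  qed
  have einj: "(u, v) = (u', v')" if "(u, v) \<in> base k q" "(u', v') \<in> base k q" "{u, v} = {u', v'}" for u v u' v'
    by (rule inj_onD[OF ends_inj _ that(1,2)]) (use k that(3) in \<open>simp_all add: ends_def\<close>)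
  have T1: "live_tri ?W1 ?L1 ?Z (G - ?f ` ?Q)"
  proof (rule live_tri_blocks[OF _ T])
    show "finite ?Q" using finite_base by simp
    show "0 < ?m" using k by simp
    show "u \<in> ?W \<and> v \<in> ?W \<and> z (u, v) \<in> ?Z \<and> {u, v, z (u, v)} \<in> G" if "(u, v) \<in> ?Q" for u v
      by (rule f) (use that in blast)
    show "(u, v) = (u', v')" if "(u, v) \<in> ?Q" "(u', v') \<in> ?Q" "{u, v} = {u', v'}" for u v u' v'
      by (rule einj) (use that in blast)+
    show "inj_on (\<lambda>(q, j). ?b q j) (?Q \<times> {..<?m})" by (auto simp: inj_on_def)
    show "?b e j \<notin> ?W \<union> ?Z" for e j by (rule W)
  qed
  have TB: "?TB \<in> base k q" by (rule base_intros)
  note fTB = f[OF TB]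
  have nf: "{Top, Bot, z ?TB} \<notin> ?f ` ?Q"
  proof
    assume "{Top, Bot, z ?TB} \<in> ?f ` ?Q"
    then obtain u v where uv: "(u, v) \<in> ?Q" "{Top, Bot, z ?TB} = {u, v, z (u, v)}" by auto
    have w: "u \<in> ?W" "v \<in> ?W" "z (u, v) \<in> ?Z" using f[of u v] uv(1) by simp_all
    have "{Top, Bot} = {Top, Bot, z ?TB} \<inter> ?W" using fTB dj by auto
    also have "\<dots> = {u, v}" unfolding uv(2) using w dj by auto
    finally have "?TB = (u, v)" using einj[OF TB, of u v] uv(1) by blast
    then show False using uv(1) by simp
  qed
  have T2: "live_tri (?W1 \<union> ?b ?TB ` {..<?m}) (?L1 \<union> block_edges Top Bot (?b ?TB) ?m) ?Z
    ((G - ?f ` ?Q) - {{Top, Bot, z ?TB}} \<union> {{?b ?TB 0, Bot, z ?TB}, {?b ?TB (?m - 1), Top, Bot}})"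
  proof (rule live_tri_block[OF T1])
    show "{Top, Bot, z ?TB} \<in> G - ?f ` ?Q" using fTB nf by blast
    show "Top \<in> ?W1" "Bot \<in> ?W1" "z ?TB \<in> ?Z" "0 < ?m" using fTB k by simp_all
    show "inj_on (?b ?TB) {..<?m}" by (simp add: inj_on_def)
    show "?b ?TB j \<notin> ?W1 \<union> ?Z" for j using W[of ?TB j] by auto
  qed
  have ins: "base k q = insert ?TB ?Q" using TB by blast
  have UN: "(\<Union>e\<in>base k q. F e) = (\<Union>e\<in>?Q. F e) \<union> F ?TB" for F :: "vertex \<times> vertex \<Rightarrow> vertex set"
    using TB by blast
  have eW: "?W1 \<union> ?b ?TB ` {..<?m} = ?W \<union> (\<Union>e\<in>base k q. ?b e ` {..<?m})"
    unfolding UN by (rule Un_assoc)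
  have eL: "?L1 \<union> block_edges Top Bot (?b ?TB) ?m = (\<Union>e\<in>base k q. block ?m e)"
  proof -
    have "(\<Union>e\<in>base k q. block ?m e) = ends ` base k q \<union> (\<Union>e\<in>base k q. block_edges (fst e) (snd e) (?b e) ?m)"
      unfolding block_def by blast
    also have "(\<Union>e\<in>base k q. block_edges (fst e) (snd e) (?b e) ?m) =
        (\<Union>(u, v)\<in>?Q. block_edges u v (?b (u, v)) ?m) \<union> block_edges Top Bot (?b ?TB) ?m"
      by (subst ins) (auto simp: case_prod_beta)
    finally show ?thesis by blast
  qed
  show ?thesis
    by (rule that[OF T2[unfolded eW eL], of "z ?TB"]) (use fTB in simp_all)
qed

lemma rainbow_free_tri_blown_up_base:
  assumes k: "5 \<le> k" and q: "0 < q"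
  shows "rainbow_free_tri k (2 + q * (k - 1) + q * (k + 1) * (k - 3) + 2 * q) (q * (k + 1) * (3 * (k - 3)) + 2 * q)"
proof -
  let ?W = "base_verts k q \<union> (\<Union>e\<in>base k q. Inner e ` {..<k - 3})"
  let ?L = "\<Union>e\<in>base k q. block (k - 3) e" and ?Z = "Ctr ` {..<2 * q}" and ?TB = "(Top, Bot)"
  obtain G z where T: "live_tri ?W ?L ?Z G" and f: "{Inner ?TB 0, Bot, z} \<in> G" and z: "z \<in> ?Z"
    by (rule blown_up_base[OF k q])
  have k3: "3 \<le> k" using k by simp
  have TB: "?TB \<in> base k q" by (rule base_intros)
  \<comment> \<open>The \<open>k\<close>-cycle that is required to exist: \<open>z\<close>,
    \<open>Bot\<close>, \<open>Top\<close>, then the inner vertices \<open>k - 4\<close> down to 0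
    of the block of \<open>(Top, Bot)\<close>, and back to \<open>z\<close>. It is a Hamiltonian
    cycle of the block extended by one centre.\<close>
  define s where "s i = (if i = 0 then z else if i = 1 then Bot else if i = 2 then Top else Inner ?TB (k - 1 - i))" for i
  have zc: "z \<noteq> Bot" "z \<noteq> Top" "z \<noteq> Inner e j" for e j using z by auto
  have bL: "x \<in> ?L" if "x \<in> block_edges Top Bot (Inner ?TB) (k - 3)" for x
    using that TB unfolding block_def by force
  have "rainbow_free_tri k (card ?W + card ?Z) (card ?L + card ?Z)"
  proof (rule rainbow_free_tri_of_live_tri[OF T _ k3])
    show "G \<noteq> {}" using f by blast
    show False if "copy_of (cycle_graph k) S H" "edges S \<subseteq> ?L" for S and H :: "vertex graph"
      by (rule no_cycle_in_Union_block[OF k q that])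
    show "inj_on s {..<k}"
      using zc zc[THEN not_sym] unfolding inj_on_def s_def by auto
    show "s i \<in> ?W \<union> ?Z" if "i < k" for i
    proof -
      have "Inner ?TB (k - 1 - i) \<in> (\<Union>e\<in>base k q. Inner e ` {..<k - 3})" if "2 < i"
        using TB that \<open>i < k\<close> by (intro UN_I[OF TB] imageI) simp
      moreover have "Top \<in> ?W" "Bot \<in> ?W" by (simp_all add: base_verts_def)
      ultimately show ?thesis using z unfolding s_def by auto
    qed
    show "{s i, s (Suc i mod k)} \<in> ?L \<or> (\<exists>f\<in>G. {s i, s (Suc i mod k)} \<subseteq> f)" if i: "i < k" for i
    proof -
      consider "i = 0" | "i = 1" | "i = 2" | "3 \<le> i" "Suc i < k" | "3 \<le> i" "Suc i = k" using i k by linarith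
      then show ?thesis
      proof cases
        case 1
        then have "{s i, s (Suc i mod k)} \<subseteq> {Inner ?TB 0, Bot, z}" using k by (simp add: s_def)
        then show ?thesis using f by blast
      next
        case 2
        then have "{s i, s (Suc i mod k)} = ends ?TB" using k by (auto simp: s_def ends_def)
        then show ?thesis using TB unfolding block_def by blast
      next
        case 3
        then have "{s i, s (Suc i mod k)} = {Inner ?TB (k - 4), Top}" using k by (auto simp: s_def)
        moreover have "{Inner ?TB (k - 4), Top} \<in> block_edges Top Bot (Inner ?TB) (k - 3)"
          unfolding block_edges_def using k by (intro UnI1 CollectI exI[of _ "k - 4"]) auto
        ultimately show ?thesis using bL by simp
      next
        case 4
        define j where "j = k - 2 - i"
        have j: "k - 1 - i = Suc j" "k - 1 - Suc i = j" "Suc j < k - 3" using 4 unfolding j_def by linarith+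
        have "{s i, s (Suc i mod k)} = {Inner ?TB j, Inner ?TB (Suc j)}"
          using 4 j unfolding s_def by (simp add: insert_commute)
        moreover have "{Inner ?TB j, Inner ?TB (Suc j)} \<in> block_edges Top Bot (Inner ?TB) (k - 3)"
          unfolding block_edges_def using j(3) by blast
        ultimately show ?thesis using bL by simp
      next
        case 5
        then have "{s i, s (Suc i mod k)} \<subseteq> {Inner ?TB 0, Bot, z}" unfolding s_def by auto
        then show ?thesis using f by blast
      qed
    qed
  qed
  moreover have "card ?W = 2 + q * (k - 1) + q * (k + 1) * (k - 3)"
  proof -
    have "card (\<Union>e\<in>base k q. Inner e ` {..<k - 3}) = (\<Sum>e\<in>base k q. card (Inner e ` {..<k - 3}))"
      by (rule card_UN_disjoint[OF finite_base]) auto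
    also have "\<dots> = (\<Sum>e\<in>base k q. k - 3)" by (intro sum.cong refl) (simp add: card_image inj_on_def)
    also have "\<dots> = q * (k + 1) * (k - 3)" using card_base[of k q] k q by simp
    finally have "card (\<Union>e\<in>base k q. Inner e ` {..<k - 3}) = q * (k + 1) * (k - 3)" .
    moreover have "base_verts k q \<inter> (\<Union>e\<in>base k q. Inner e ` {..<k - 3}) = {}"
      using mem_base_verts[of k _ q] k by auto
    moreover have "finite (base_verts k q)" unfolding base_verts_def by simp
    moreover have "finite (\<Union>e\<in>base k q. Inner e ` {..<k - 3})" using finite_base by simp
    ultimately show ?thesis using card_base_verts[of k q] k by (simp add: card_Un_disjoint)
  qed
  moreover have "card ?L = q * (k + 1) * (3 * (k - 3))" by (rule card_Union_block[OF k q]) (use k in simp)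
  moreover have "card ?Z = 2 * q" by (simp add: card_image inj_on_def)
  ultimately show ?thesis by simp
qed

theorem theorem3p2:
  fixes k n r :: nat
  assumes "k \<ge> 5" and "n \<ge> k^2 - k"
    and "r = (n - 2) mod (k^2 - k - 2)"
  shows "real (ar_planar n (cycle_graph k)) \<ge>
    ((real k - 3) / (real k - 2) + 2 / (3 * (real k + 1) * (real k - 2))) * (3 * real n - 6)
      - (2 * (real k)^2 - 5 * real k - 5) / ((real k)^2 - real k - 2) * real r"
proof -
  define N where "N = k^2 - k - 2"
  define q where "q = (n - 2) div N"
  \<comment> \<open>The substitution removes the truncated subtractions from all the
    formulas.\<close>
  obtain h where h: "k = h + 5" using assms(1) le_Suc_ex[of 5 k] by (auto simp: add.commute)
  have N: "N = (h + 3) * (h + 6)" unfolding N_def h by (simp add: power2_eq_square algebra_simps)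
  have "k^2 - k = N + 2" unfolding N h by (simp add: power2_eq_square algebra_simps)
  then have nN: "N + 2 \<le> n" using assms(2) by simp
  have Npos: "0 < N" unfolding N by simp
  \<comment> \<open>The bound \<open>n \<ge> k^2 - k\<close> says that \<open>n - 2 \<ge> N\<close>,
    so that there is at least one path.\<close>
  have q: "0 < q" unfolding q_def using nN Npos by (simp add: div_greater_zero_iff)
  have nq: "n = 2 + q * N + r"
  proof -
    have "n - 2 = q * N + r" unfolding q_def assms(3) N_def[symmetric] by simp
    then show ?thesis using nN by linarith
  qed
  let ?m = "q * (k + 1) * (3 * (k - 3)) + 2 * q + r"
  have "2 + q * (k - 1) + q * (k + 1) * (k - 3) + 2 * q + r = n"
    unfolding nq N h by (simp add: algebra_simps)
  then have "rainbow_free_tri k n ?m"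
    using rainbow_free_tri_add[OF rainbow_free_tri_blown_up_base[OF assms(1) q], of r] assms(1) by simp
  then have "?m \<le> ar_planar n (cycle_graph k)"
    unfolding rainbow_free_tri_def using ar_planar_ge_plane_tri by metis
  then have "real ?m \<le> real (ar_planar n (cycle_graph k))" by (rule of_nat_mono)
  moreover have "((real k - 3) / (real k - 2) + 2 / (3 * (real k + 1) * (real k - 2))) * (3 * real n - 6)
      - (2 * (real k)^2 - 5 * real k - 5) / ((real k)^2 - real k - 2) * real r = real ?m"
  proof -
    define H where "H = real h"
    have H: "0 \<le> H" by (simp add: H_def)
    have K: "real k = H + 5" "real (k - 3) = H + 2" by (simp_all add: h H_def)
    have n: "real n = 2 + real q * ((H + 3) * (H + 6)) + real r" unfolding nq N by (simp add: H_def)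
    have D: "(real k)^2 - real k - 2 = (H + 3) * (H + 6)" unfolding K by (simp add: power2_eq_square algebra_simps)
    have "real ?m = real q * (real k + 1) * (3 * real (k - 3)) + 2 * real q + real r"
      by (simp only: of_nat_add of_nat_mult of_nat_1 of_nat_numeral)
    then have "real ?m = real q * (H + 6) * (3 * (H + 2)) + 2 * real q + real r" unfolding K by simp
    moreover have "((real k - 3) / (real k - 2) + 2 / (3 * (real k + 1) * (real k - 2)))
        = (3 * (H + 2) * (H + 6) + 2) / (3 * ((H + 3) * (H + 6)))"
    proof -
      have frac: "a / b + 2 / (3 * c * b) = (3 * a * c + 2) / (3 * (b * c))" if "b \<noteq> 0" "c \<noteq> 0" for a b c :: real
        using that by (simp add: field_simps)
      have "real k - 3 = H + 2" "real k - 2 = H + 3" "real k + 1 = H + 6" unfolding K by simp_all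
      then show ?thesis using H by (simp only:) (rule frac, simp_all)
    qed
    moreover have "3 * real n - 6 = 3 * (real q * ((H + 3) * (H + 6)) + real r)" unfolding n by simp
    moreover have "2 * (real k)^2 - 5 * real k - 5 = 2 * (H + 5)^2 - 5 * (H + 5) - 5" unfolding K by simp
    moreover have "(3 * (H + 2) * (H + 6) + 2) / (3 * ((H + 3) * (H + 6))) * (3 * (real q * ((H + 3) * (H + 6)) + real r))
        - (2 * (H + 5)^2 - 5 * (H + 5) - 5) / ((H + 3) * (H + 6)) * real r
        = real q * (H + 6) * (3 * (H + 2)) + 2 * real q + real r"
    proof -
      define M where "M = (H + 3) * (H + 6)"
      have M: "M \<noteq> 0" using H by (simp add: M_def)
      \<comment> \<open>In terms of \<open>k\<close> this is
        \<open>(3 * k^2 - 6 * k - 7) - (2 * k^2 - 5 * k - 5) = k^2 - k - 2\<close>; it leaves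
        \<open>r\<close> with coefficient 1.\<close>
      have A: "3 * (H + 2) * (H + 6) + 2 - (2 * (H + 5)^2 - 5 * (H + 5) - 5) = M"
        unfolding M_def by (simp add: power2_eq_square algebra_simps)
      have "(3 * (H + 2) * (H + 6) + 2) / (3 * M) * (3 * (real q * M + real r))
          = (3 * (H + 2) * (H + 6) + 2) * real q + (3 * (H + 2) * (H + 6) + 2) / M * real r"
        using M by (simp add: field_simps)
      moreover have "(3 * (H + 2) * (H + 6) + 2) / M * real r - (2 * (H + 5)^2 - 5 * (H + 5) - 5) / M * real r = M / M * real r"
        unfolding left_diff_distrib[symmetric] diff_divide_distrib[symmetric] A ..
      ultimately show ?thesis unfolding M_def[symmetric] using M by (simp add: algebra_simps)
    qed
    ultimately show ?thesis by (simp only: D)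
  qed
  ultimately show ?thesis by simp
qed

end
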